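(* Let $0<r_i<r_e$, $\rho=r_i/r_e$, and let $\Gamma_i=\{|x|=r_i\}$, $\Gamma_e=\{|x|=r_e\}$ be concentric spheres in $\mathbb{R}^3$. The eigenvalues of the Neumann–Poincaré-type operator $\mathbb{K}^*$ on $L^2(\Gamma_i)\times L^2(\Gamma_e)$ (defined in the context) are $$\pm\frac{1}{2(2n+1)}\sqrt{1+4n(n+1)\rho^{2n+1}},\qquad n=0,1,2,\ldots,$$ and the corresponding eigenfunctions are, for the sign $+$ and the sign $-$ respectively, $$\begin{bmatrix}\left(\sqrt{1+4n(n+1)\rho^{2n+1}}-1\right)Y_n^m\\ 2(n+1)\rho^{n+2}\,Y_n^m\end{bmatrix},\qquad \begin{bmatrix}\left(-\sqrt{1+4n(n+1)\rho^{2n+1}}-1\right)Y_n^m\\ 2(n+1)\rho^{n+2}\,Y_n^m\end{bmatrix},\qquad m=-n,\ldots,n.$$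
   Context: $Y_n^m(\hat x)$, $\hat x=x/|x|$, $m=-n,\ldots,n$, are the orthonormal spherical harmonics of degree $n$ (viewed as functions on each sphere through $\hat x$). Let $G(x)=-\frac{1}{4\pi|x|}$ be the fundamental solution of the Laplacian in $\mathbb{R}^3$. For $\Gamma=\Gamma_i$ or $\Gamma_e$ with outward unit normal $\nu$ (denoted $\nu_i$, $\nu_e$ respectively) and $\varphi\in L^2(\Gamma)$, set $$\mathcal{S}_\Gamma[\varphi](x)=\int_\Gamma G(x-y)\varphi(y)\,d\sigma(y),\ x\in\mathbb{R}^3,\qquad \mathcal{K}_\Gamma^*[\varphi](x)=\int_\Gamma\frac{\partial G(x-y)}{\partial\nu(x)}\varphi(y)\,d\sigma(y),\ x\in\Gamma .$$ The operator $\mathbb{K}^*:L^2(\Gamma_i)\times L^2(\Gamma_e)\to L^2(\Gamma_i)\times L^2(\Gamma_e)$ is $$\mathbb{K}^*=\begin{bmatrix}-\mathcal{K}_{\Gamma_i}^* & -\frac{\partial}{\partial\nu_i}\mathcal{S}_{\Gamma_e}\\[2pt] \frac{\partial}{\partial\nu_e}\mathcal{S}_{\Gamma_i} & \mathcal{K}_{\Gamma_e}^*\end{bmatrix},$$ where $\frac{\partial}{\partial\nu_i}\mathcal{S}_{\Gamma_e}$ is the normal derivative on $\Gamma_i$ of the single layer potential on $\Gamma_e$, and $\frac{\partial}{\partial\nu_e}\mathcal{S}_{\Gamma_i}$ the normal derivative on $\Gamma_e$ of the single layer potential on $\Gamma_i$. *)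

theory Defs
  imports "HOL-Analysis.Analysis"
begin

section \<open>Surface measure on centred spheres\<close>

definition spherical_coords :: "real \<Rightarrow> real \<times> real \<Rightarrow> real^3" where
  "spherical_coords r = (\<lambda>(\<theta>, \<phi>).
     r *\<^sub>R vector [sin \<theta> * cos \<phi>, sin \<theta> * sin \<phi>, cos \<theta>])"

text \<open>
  The surface measure on the sphere of radius r about the origin (r > 0), written with the area
  element r^2 sin theta dtheta dphi of the parametrisation by spherical coordinates.
  Its underlying space is the sphere itself, so functions in the L2-space below matter only on
  the sphere.
\<close>

definition sphere_measure :: "real \<Rightarrow> (real^3) measure" where
  "sphere_measure r =
     distr
       (density lborel
          (\<lambda>(\<theta>, \<phi>). ennreal (r\<^sup>2 * sin \<theta>) * indicator ({0..pi} \<times> {0..2 * pi}) (\<theta>, \<phi>)))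
       (restrict_space borel (sphere 0 r))
       (spherical_coords r)"

definition L2_space :: "'a measure \<Rightarrow> ('a \<Rightarrow> complex) set" where
  "L2_space M = {f \<in> borel_measurable M. integrable M (\<lambda>x. (norm (f x))\<^sup>2)}"


section \<open>Spherical harmonics\<close>

definition laplacian :: "('a::euclidean_space \<Rightarrow> 'b::real_normed_vector) \<Rightarrow> 'a \<Rightarrow> 'b" where
  "laplacian f x =
     (\<Sum>b\<in>Basis. frechet_derivative (\<lambda>y. frechet_derivative f (at y) b) (at x) b)"

text \<open>
  Spherical harmonics of degree n: restrictions to the unit sphere of harmonic polynomials that
  are homogeneous of degree n.
\<close>

definition spherical_harmonic :: "nat \<Rightarrow> (real^3 \<Rightarrow> complex) \<Rightarrow> bool" where
  "spherical_harmonic n f \<longleftrightarrow>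
     (\<exists>p. polynomial_function p \<and>
          (\<forall>c x. p (c *\<^sub>R x) = c ^ n *\<^sub>R p x) \<and>
          (\<forall>x. laplacian p x = 0) \<and>
          (\<forall>x\<in>sphere 0 1. f x = p x))"

text \<open>
  The space of spherical harmonics of degree n has dimension 2n + 1, so for each n the
  functions Y n m with -n \<le> m \<le> n form an orthonormal basis of it. Both the real and the
  complex standard choices are instances, as is any other choice of basis.
\<close>

definition orthonormal_spherical_harmonics :: "(nat \<Rightarrow> int \<Rightarrow> real^3 \<Rightarrow> complex) \<Rightarrow> bool" where
  "orthonormal_spherical_harmonics Y \<longleftrightarrow>
     (\<forall>n. \<forall>m\<in>{- int n..int n}.
        spherical_harmonic n (Y n m) \<and>
        (\<forall>m'\<in>{- int n..int n}.
           (LINT x|sphere_measure 1. Y n m x * cnj (Y n m' x)) = (if m = m' then 1 else 0)))"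


section \<open>Layer potentials and the Neumann--Poincare-type operator\<close>

definition G :: "real^3 \<Rightarrow> real" where
  "G x = - 1 / (4 * pi * norm x)"

text \<open>
  On every sphere about the origin the outward unit normal at x is x / |x|.
\<close>

definition normal_derivative :: "(real^3 \<Rightarrow> 'b::real_normed_vector) \<Rightarrow> real^3 \<Rightarrow> 'b" where
  "normal_derivative u x = frechet_derivative u (at x) (x /\<^sub>R norm x)"

definition single_layer :: "real \<Rightarrow> (real^3 \<Rightarrow> complex) \<Rightarrow> real^3 \<Rightarrow> complex" where
  "single_layer r \<phi> x = (LINT y|sphere_measure r. G (x - y) *\<^sub>R \<phi> y)"

text \<open>
  The integrand below is unspecified at y = x, which is a null set. For square integrable
  densities the integral converges absolutely for almost every x on the sphere; elsewhere the
  Bochner integral has the default value 0.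
\<close>

definition NP_adjoint :: "real \<Rightarrow> (real^3 \<Rightarrow> complex) \<Rightarrow> real^3 \<Rightarrow> complex" where
  "NP_adjoint r \<phi> x =
     (LINT y|sphere_measure r. normal_derivative (\<lambda>z. G (z - y)) x *\<^sub>R \<phi> y)"

text \<open>
  Pairs of densities on the spheres of radii ri and re. Elements of the L2-spaces are handled
  through representatives, with equality almost everywhere.
\<close>

type_synonym density_pair = "(real^3 \<Rightarrow> complex) \<times> (real^3 \<Rightarrow> complex)"

definition L2_pairs :: "real \<Rightarrow> real \<Rightarrow> density_pair set" where
  "L2_pairs ri re = L2_space (sphere_measure ri) \<times> L2_space (sphere_measure re)"

definition eq_ae :: "real \<Rightarrow> real \<Rightarrow> density_pair \<Rightarrow> density_pair \<Rightarrow> bool" where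
  "eq_ae ri re \<Phi> \<Psi> \<longleftrightarrow>
     (AE x in sphere_measure ri. fst \<Phi> x = fst \<Psi> x) \<and>
     (AE x in sphere_measure re. snd \<Phi> x = snd \<Psi> x)"

definition NP_op :: "real \<Rightarrow> real \<Rightarrow> density_pair \<Rightarrow> density_pair" where
  "NP_op ri re = (\<lambda>(\<phi>i, \<phi>e).
     (\<lambda>x. - NP_adjoint ri \<phi>i x - normal_derivative (single_layer re \<phi>e) x,
      \<lambda>x. normal_derivative (single_layer ri \<phi>i) x + NP_adjoint re \<phi>e x))"

definition NP_eigenfunction :: "real \<Rightarrow> real \<Rightarrow> complex \<Rightarrow> density_pair \<Rightarrow> bool" where
  "NP_eigenfunction ri re \<kappa> \<Phi> \<longleftrightarrow>
     \<Phi> \<in> L2_pairs ri re \<and>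
     \<not> eq_ae ri re \<Phi> (\<lambda>x. 0, \<lambda>x. 0) \<and>
     eq_ae ri re (NP_op ri re \<Phi>) (\<lambda>x. \<kappa> * fst \<Phi> x, \<lambda>x. \<kappa> * snd \<Phi> x)"

definition NP_eigenvalue :: "real \<Rightarrow> real \<Rightarrow> complex \<Rightarrow> bool" where
  "NP_eigenvalue ri re \<kappa> \<longleftrightarrow> (\<exists>\<Phi>. NP_eigenfunction ri re \<kappa> \<Phi>)"

end

theory Submission
  imports Defs
begin

text \<open>
  On the unit sphere every block of the operator is an integral operator with a kernel of the form
  (t - x . y) / (4 pi |t x - y|^3). The Poisson formula for harmonic polynomials says that
  integration against the Poisson kernel P_r multiplies a spherical harmonic of degree n by r^n;
  the Newton potential follows from it by solving an ordinary differential equation in the radius,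
  and with it the eigenvalues of all blocks on the harmonics of degree n.

  Completeness of the given harmonics, and the fact that they span each degree, come from a trace
  argument. The integral of P_r(x, y)^2 over both variables is the sum of (2 n + 1) r^(2 n), and
  the 2 n + 1 given harmonics of each degree n already account for the whole sum in Bessel's
  inequality. A further orthogonal function is therefore annihilated by all P_r, and letting r
  tend to 1 shows that it vanishes.

  Pairing the eigenvalue equation with a harmonic of degree n leaves a 2 x 2 system. Its
  determinants for different n have different zeros because the squares of the claimed eigenvalues
  decrease strictly in n.
\<close>


section \<open>Surface measure on centred spheres\<close>

abbreviation S2 :: "(real^3) measure" where
  "S2 \<equiv> sphere_measure 1"

lemma inner_real3: "x \<bullet> y = x$1 * y$1 + x$2 * y$2 + x$3 * y$3" for x y :: "real^3"
  by (simp add: inner_vec_def sum_3)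

lemma spherical_coords_nth:
  "spherical_coords r (\<theta>, \<phi>) $ 1 = r * (sin \<theta> * cos \<phi>)"
  "spherical_coords r (\<theta>, \<phi>) $ 2 = r * (sin \<theta> * sin \<phi>)"
  "spherical_coords r (\<theta>, \<phi>) $ 3 = r * cos \<theta>"
  by (simp_all add: spherical_coords_def)

lemma spherical_coords_scale: "spherical_coords r p = r *\<^sub>R spherical_coords 1 p"
  by (cases p) (simp add: spherical_coords_def)

lemma norm_spherical_coords [simp]: "norm (spherical_coords r p) = \<bar>r\<bar>"
proof -
  have "(norm (spherical_coords 1 (\<theta>, \<phi>)))\<^sup>2 = 1" for \<theta> \<phi>
    unfolding power2_norm_eq_inner inner_real3 spherical_coords_nth
    using sin_cos_squared_add[of \<theta>] sin_cos_squared_add[of \<phi>] by algebra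
  then have "(norm (spherical_coords 1 p))\<^sup>2 = 1"
    by (cases p) simp
  then have "norm (spherical_coords 1 p) = 1"
    using norm_ge_zero[of "spherical_coords 1 p"] by (simp only: power2_eq_1_iff) linarith
  then show ?thesis
    by (subst spherical_coords_scale) simp
qed

lemma continuous_on_spherical_coords: "continuous_on A (spherical_coords r)"
proof -
  have "spherical_coords r =
      (\<lambda>p. \<chi> i. r * (if i = 1 then sin (fst p) * cos (snd p)
                     else if i = 2 then sin (fst p) * sin (snd p) else cos (fst p)))"
    by (auto simp: fun_eq_iff vec_eq_iff forall_3 spherical_coords_nth)
  moreover have "continuous_on A \<dots>"
  proof (rule continuous_on_vec_lambda)
    fix i :: 3
    show "continuous_on A (\<lambda>p. r * (if i = 1 then sin (fst p) * cos (snd p)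
        else if i = 2 then sin (fst p) * sin (snd p) else cos (fst p)))"
      by (cases "i = 1"; cases "i = 2") (auto intro!: continuous_intros)
  qed
  ultimately show ?thesis
    by simp
qed

lemma borel_measurable_spherical_coords [measurable]: "spherical_coords r \<in> borel_measurable borel"
  by (intro borel_measurable_continuous_onI continuous_on_spherical_coords)

lemma measurable_spherical_coords_sphere:
  assumes "0 < r"
  shows "spherical_coords r \<in> borel \<rightarrow>\<^sub>M restrict_space borel (sphere 0 r)"
  using assms by (intro measurable_restrict_space2) auto

lemma space_sphere_measure [simp]: "space (sphere_measure r) = sphere 0 r"
  by (simp add: sphere_measure_def space_restrict_space)

lemma sets_sphere_measure [measurable_cong]:
  "sets (sphere_measure r) = sets (restrict_space borel (sphere 0 r))"
  by (simp add: sphere_measure_def)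

lemma measurable_sphere_measureI:
  "f \<in> borel \<rightarrow>\<^sub>M N \<Longrightarrow> f \<in> sphere_measure r \<rightarrow>\<^sub>M N"
  by (subst measurable_cong_sets[OF sets_sphere_measure refl]) (rule measurable_restrict_space1)

definition angle_density :: "real \<Rightarrow> real \<times> real \<Rightarrow> real" where
  "angle_density r p = r\<^sup>2 * sin (fst p) * indicator ({0..pi} \<times> {0..2 * pi}) p"

definition angle_measure :: "real \<Rightarrow> (real \<times> real) measure" where
  "angle_measure r = density lborel (\<lambda>p. ennreal (angle_density r p))"

lemma sets_angle_measure [measurable_cong, simp]: "sets (angle_measure r) = sets borel"
  by (simp add: angle_measure_def)

lemma sphere_measure_eq:
  "sphere_measure r = distr (angle_measure r) (restrict_space borel (sphere 0 r)) (spherical_coords r)"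
proof -
  have "(\<lambda>(\<theta>, \<phi>). ennreal (r\<^sup>2 * sin \<theta>) * indicator ({0..pi} \<times> {0..2 * pi}) (\<theta>, \<phi>)) =
     (\<lambda>p. ennreal (angle_density r p))"
    by (auto simp: fun_eq_iff indicator_def angle_density_def)
  then show ?thesis
    unfolding sphere_measure_def angle_measure_def by simp
qed

lemma angle_density_nonneg: "0 \<le> angle_density r p"
  by (auto simp: angle_density_def indicator_def intro!: mult_nonneg_nonneg sin_ge_zero)

lemma angle_density_scale: "angle_density r p = r\<^sup>2 * angle_density 1 p"
  by (simp add: angle_density_def)

lemma angle_density_integrable: "integrable lborel (angle_density r)"
proof -
  have "integrable lborel (\<lambda>p. indicator (cbox (0,0) (pi, 2*pi)) p *\<^sub>R (r\<^sup>2 * sin (fst p)) :: real)"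
    by (rule borel_integrable_compact) (auto intro!: continuous_intros)
  then show ?thesis
    by (simp add: angle_density_def[abs_def] mult.commute cbox_Pair_eq)
qed

lemma angle_density_measurable [measurable]: "angle_density r \<in> borel_measurable borel"
  using borel_measurable_integrable[OF angle_density_integrable] by simp

lemma finite_angle_measure: "finite_measure (angle_measure r)"
proof
  have "integral\<^sup>N lborel (\<lambda>p. ennreal (angle_density r p)) \<noteq> \<infinity>"
    using angle_density_integrable[of r] angle_density_nonneg
    by (auto simp: integrable_iff_bounded less_top[symmetric])
  then show "emeasure (angle_measure r) (space (angle_measure r)) \<noteq> \<infinity>"
    by (simp add: angle_measure_def emeasure_density)
qed

lemma finite_sphere_measure:
  assumes "0 < r"
  shows "finite_measure (sphere_measure r)"
  unfolding sphere_measure_eq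
  using measurable_spherical_coords_sphere[OF assms]
  by (intro finite_measure.finite_measure_distr[OF finite_angle_measure])
     (simp add: measurable_cong_sets[OF sets_angle_measure refl])

interpretation S2: finite_measure S2
  by (rule finite_sphere_measure) simp

lemma emeasure_angle_measure_scale:
  assumes "A \<in> sets borel"
  shows "emeasure (angle_measure r) A = ennreal (r\<^sup>2) * emeasure (angle_measure 1) A"
proof -
  have "emeasure (angle_measure r) A = (\<integral>\<^sup>+p. ennreal (angle_density r p) * indicator A p \<partial>lborel)"
    using assms by (simp add: angle_measure_def emeasure_density)
  also have "\<dots> = (\<integral>\<^sup>+p. ennreal (r\<^sup>2) * (ennreal (angle_density 1 p) * indicator A p) \<partial>lborel)"
    by (simp add: angle_density_scale[of r] ennreal_mult' mult.assoc)
  also have "\<dots> = ennreal (r\<^sup>2) * (\<integral>\<^sup>+p. ennreal (angle_density 1 p) * indicator A p \<partial>lborel)"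
    using assms by (intro nn_integral_cmult) simp
  also have "\<dots> = ennreal (r\<^sup>2) * emeasure (angle_measure 1) A"
    using assms by (simp add: angle_measure_def emeasure_density)
  finally show ?thesis .
qed

lemma measurable_scale_sphere:
  assumes "0 < r"
  shows "(\<lambda>x. r *\<^sub>R x) \<in> restrict_space borel (sphere (0::real^3) 1) \<rightarrow>\<^sub>M restrict_space borel (sphere 0 r)"
proof (rule measurable_restrict_space3)
  show "(\<lambda>x::real^3. r *\<^sub>R x) \<in> borel \<rightarrow>\<^sub>M borel"
    by (intro borel_measurable_continuous_onI continuous_intros)
qed (use assms in auto)

lemma measurable_unscale_sphere:
  assumes "0 < r"
  shows "(\<lambda>x. x /\<^sub>R norm x) \<in> restrict_space borel (sphere (0::real^3) r) \<rightarrow>\<^sub>M restrict_space borel (sphere 0 1)"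
proof (rule measurable_restrict_space3)
  show "(\<lambda>x::real^3. x /\<^sub>R norm x) \<in> borel \<rightarrow>\<^sub>M borel"
    by measurable
qed (use assms in auto)

lemma sphere_measure_scale:
  assumes "0 < r"
  shows "sphere_measure r = density
           (distr S2 (restrict_space borel (sphere 0 r)) (\<lambda>x. r *\<^sub>R x)) (\<lambda>_. ennreal (r\<^sup>2))"
proof (rule measure_eqI)
  have m1: "spherical_coords 1 \<in> angle_measure 1 \<rightarrow>\<^sub>M restrict_space borel (sphere 0 1)"
    using measurable_spherical_coords_sphere[of 1]
    by (simp add: measurable_cong_sets[OF sets_angle_measure refl])
  have mr: "spherical_coords r \<in> angle_measure s \<rightarrow>\<^sub>M restrict_space borel (sphere 0 r)" for s
    using measurable_spherical_coords_sphere[OF assms]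
    by (simp add: measurable_cong_sets[OF sets_angle_measure refl])
  note ms = measurable_scale_sphere[OF assms]
  fix A assume A: "A \<in> sets (sphere_measure r)"
  have "distr S2 (restrict_space borel (sphere 0 r)) (\<lambda>x. r *\<^sub>R x) =
      distr (angle_measure 1) (restrict_space borel (sphere 0 r)) (\<lambda>p. r *\<^sub>R spherical_coords 1 p)"
    unfolding sphere_measure_eq by (subst distr_distr[OF ms m1]) (simp add: o_def)
  also have "(\<lambda>p. r *\<^sub>R spherical_coords 1 p) = spherical_coords r"
    by (simp add: fun_eq_iff flip: spherical_coords_scale)
  finally have d: "distr S2 (restrict_space borel (sphere 0 r)) (\<lambda>x. r *\<^sub>R x) =
      distr (angle_measure 1) (restrict_space borel (sphere 0 r)) (spherical_coords r)" .
  have A': "A \<in> sets (restrict_space borel (sphere 0 r))"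
    using A by (simp add: sets_sphere_measure)
  have "spherical_coords r -` A \<in> sets borel"
    using measurable_sets[OF measurable_spherical_coords_sphere[OF assms] A'] by simp
  moreover have "space (angle_measure s) = UNIV" for s
    by (simp add: angle_measure_def)
  ultimately show "emeasure (sphere_measure r) A = emeasure (density
           (distr S2 (restrict_space borel (sphere 0 r)) (\<lambda>x. r *\<^sub>R x)) (\<lambda>_. ennreal (r\<^sup>2))) A"
    using A' mr unfolding d
    by (simp only: emeasure_density_const sets_distr sphere_measure_eq emeasure_distr
        emeasure_angle_measure_scale[of _ r] Int_UNIV_right)
qed (simp add: sets_sphere_measure)

lemma measurable_S2_scale:
  assumes "0 < r" "f \<in> sphere_measure r \<rightarrow>\<^sub>M N"
  shows "(\<lambda>x. f (r *\<^sub>R x)) \<in> S2 \<rightarrow>\<^sub>M N"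
proof -
  have "(\<lambda>x. r *\<^sub>R x) \<in> S2 \<rightarrow>\<^sub>M sphere_measure r"
    using measurable_scale_sphere[OF assms(1)]
    by (simp add: measurable_cong_sets[OF sets_sphere_measure sets_sphere_measure])
  from measurable_compose[OF this assms(2)] show ?thesis .
qed

lemma measurable_sphere_unscale:
  assumes "0 < r" "f \<in> S2 \<rightarrow>\<^sub>M N"
  shows "(\<lambda>x. f (x /\<^sub>R norm x)) \<in> sphere_measure r \<rightarrow>\<^sub>M N"
proof -
  have "(\<lambda>x. x /\<^sub>R norm x) \<in> sphere_measure r \<rightarrow>\<^sub>M S2"
    using measurable_unscale_sphere[OF assms(1)]
    by (simp add: measurable_cong_sets[OF sets_sphere_measure sets_sphere_measure])
  from measurable_compose[OF this assms(2)] show ?thesis .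
qed

lemma nn_integral_sphere_scale:
  assumes "0 < r" and "f \<in> borel_measurable (sphere_measure r)"
  shows "(\<integral>\<^sup>+x. f x \<partial>sphere_measure r) = ennreal (r\<^sup>2) * (\<integral>\<^sup>+x. f (r *\<^sub>R x) \<partial>S2)"
proof -
  have ms: "(\<lambda>x. r *\<^sub>R x) \<in> S2 \<rightarrow>\<^sub>M restrict_space borel (sphere 0 r)"
    using measurable_scale_sphere[OF assms(1)]
    by (simp add: measurable_cong_sets[OF sets_sphere_measure refl])
  have mf: "f \<in> borel_measurable (restrict_space borel (sphere 0 r))"
    using assms(2) by (simp add: measurable_cong_sets[OF sets_sphere_measure refl])
  show ?thesis
    unfolding sphere_measure_scale[OF assms(1)]
    using mf ms by (subst nn_integral_density) (simp_all add: nn_integral_distr nn_integral_cmult measurable_S2_scale[OF assms])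
qed

lemma integrable_sphere_scale_iff:
  fixes f :: "real^3 \<Rightarrow> 'b::{banach, second_countable_topology}"
  assumes "0 < r" and "f \<in> borel_measurable (sphere_measure r)"
  shows "integrable (sphere_measure r) f \<longleftrightarrow> integrable S2 (\<lambda>x. f (r *\<^sub>R x))"
proof -
  have "(\<integral>\<^sup>+x. ennreal (norm (f x)) \<partial>sphere_measure r) =
      ennreal (r\<^sup>2) * (\<integral>\<^sup>+x. ennreal (norm (f (r *\<^sub>R x))) \<partial>S2)"
    using assms by (intro nn_integral_sphere_scale) simp_all
  then show ?thesis
    using assms measurable_S2_scale[OF assms]
    by (auto simp: integrable_iff_bounded ennreal_mult_less_top)
qed

lemma integral_sphere_scale:
  fixes f :: "real^3 \<Rightarrow> 'b::{banach, second_countable_topology}"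
  assumes "0 < r" and "f \<in> borel_measurable (sphere_measure r)"
  shows "(LINT x|sphere_measure r. f x) = r\<^sup>2 *\<^sub>R (LINT x|S2. f (r *\<^sub>R x))"
proof -
  have ms: "(\<lambda>x. r *\<^sub>R x) \<in> S2 \<rightarrow>\<^sub>M restrict_space borel (sphere 0 r)"
    using measurable_scale_sphere[OF assms(1)]
    by (simp add: measurable_cong_sets[OF sets_sphere_measure refl])
  have mf: "f \<in> borel_measurable (restrict_space borel (sphere 0 r))"
    using assms(2) by (simp add: measurable_cong_sets[OF sets_sphere_measure refl])
  show ?thesis
    unfolding sphere_measure_scale[OF assms(1)]
    using mf ms by (subst integral_density) (simp_all add: integral_distr)
qed

lemma AE_sphere_scale:
  assumes "0 < r"
  shows "(AE x in sphere_measure r. P x) \<longleftrightarrow> (AE x in S2. P (r *\<^sub>R x))"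
proof -
  have sc: "emeasure (sphere_measure r) N = ennreal (r\<^sup>2) * emeasure S2 ((\<lambda>x. r *\<^sub>R x) -` N \<inter> sphere 0 1)"
    if "N \<in> sets (sphere_measure r)" for N
  proof -
    have "emeasure (sphere_measure r) N = (\<integral>\<^sup>+x. indicator N x \<partial>sphere_measure r)"
      using that by simp
    also have "\<dots> = ennreal (r\<^sup>2) * (\<integral>\<^sup>+x. indicator N (r *\<^sub>R x) \<partial>S2)"
      using that assms by (intro nn_integral_sphere_scale) auto
    also have "(\<integral>\<^sup>+x. indicator N (r *\<^sub>R x) \<partial>S2) = (\<integral>\<^sup>+x. indicator ((\<lambda>x. r *\<^sub>R x) -` N \<inter> sphere 0 1) x \<partial>S2)"
      by (intro nn_integral_cong) (auto simp: indicator_def)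
    also have "\<dots> = emeasure S2 ((\<lambda>x. r *\<^sub>R x) -` N \<inter> sphere 0 1)"
      using measurable_sets[OF measurable_S2_scale[OF assms measurable_ident_sets[OF refl]] that]
      by (intro nn_integral_indicator) simp
    finally show ?thesis .
  qed
  have sm: "(\<lambda>x. r *\<^sub>R x) -` N \<inter> sphere 0 1 \<in> sets S2" if "N \<in> sets (sphere_measure r)" for N
    using measurable_sets[OF measurable_S2_scale[OF assms measurable_ident_sets[OF refl]] that] by simp
  show ?thesis
  proof
    assume "AE x in sphere_measure r. P x"
    then obtain N where N: "{x \<in> sphere 0 r. \<not> P x} \<subseteq> N" "emeasure (sphere_measure r) N = 0"
        "N \<in> sets (sphere_measure r)"
      by (auto elim: AE_E)
    from sc[OF N(3)] N(2) have "emeasure S2 ((\<lambda>x. r *\<^sub>R x) -` N \<inter> sphere 0 1) = 0"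
      using assms by (simp add: ennreal_eq_0_iff)
    then show "AE x in S2. P (r *\<^sub>R x)"
    proof (rule AE_I[rotated])
      show "{x \<in> space S2. \<not> P (r *\<^sub>R x)} \<subseteq> (\<lambda>x. r *\<^sub>R x) -` N \<inter> sphere 0 1"
        using N(1) assms by (auto intro!: subsetD[OF N(1)])
    qed (rule sm[OF N(3)])
  next
    assume "AE x in S2. P (r *\<^sub>R x)"
    then obtain N where N: "{x \<in> sphere 0 1. \<not> P (r *\<^sub>R x)} \<subseteq> N" "emeasure S2 N = 0" "N \<in> sets S2"
      by (auto elim: AE_E)
    define N' where "N' = (\<lambda>x. x /\<^sub>R norm x) -` N \<inter> sphere 0 r"
    have N': "N' \<in> sets (sphere_measure r)"
      using measurable_sets[OF measurable_sphere_unscale[OF assms measurable_ident_sets[OF refl]] N(3)]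
      by (simp add: N'_def)
    have "(\<lambda>x. r *\<^sub>R x) -` N' \<inter> sphere 0 1 = N"
      using assms sets.sets_into_space[OF N(3)] by (auto simp: N'_def)
    with sc[OF N'] N(2) have "emeasure (sphere_measure r) N' = 0"
      by simp
    moreover have "x \<in> N" if "x \<in> sphere 0 1" "\<not> P (r *\<^sub>R x)" for x
      using N(1) that by auto
    then have "{x \<in> sphere 0 r. \<not> P x} \<subseteq> N'"
      using assms by (force simp: N'_def)
    ultimately show "AE x in sphere_measure r. P x"
      using N' by (intro AE_I[of _ _ N']) auto
  qed
qed

lemma integral_S2_cong:
  "(\<And>x. norm x = 1 \<Longrightarrow> f x = g x) \<Longrightarrow> (LINT x|S2. f x) = (LINT x|S2. g x)"
  by (rule Bochner_Integration.integral_cong) auto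

lemma integrable_S2_bounded:
  fixes f :: "real^3 \<Rightarrow> 'b::{banach, second_countable_topology}"
  assumes "f \<in> borel_measurable S2" "\<And>x. norm x = 1 \<Longrightarrow> norm (f x) \<le> B"
  shows "integrable S2 f"
  using assms by (intro S2.integrable_const_bound[where B = B]) auto

lemma borel_measurable_S2_continuous:
  fixes f :: "real^3 \<Rightarrow> 'b::{topological_space}"
  assumes "continuous_on (sphere 0 1) f"
  shows "f \<in> borel_measurable S2"
  using borel_measurable_continuous_on_restrict[OF assms]
  by (simp add: measurable_cong_sets[OF sets_sphere_measure refl])

lemma continuous_on_sphere_bounded:
  fixes f :: "real^3 \<Rightarrow> 'b::real_normed_vector"
  assumes "continuous_on (sphere 0 1) f"
  obtains B where "0 < B" "\<And>x. norm x = 1 \<Longrightarrow> norm (f x) \<le> B"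
proof -
  have "bounded (f ` sphere 0 1)"
    using assms compact_continuous_image compact_imp_bounded compact_sphere by blast
  then obtain B where "0 < B" "\<forall>x\<in>sphere 0 1. norm (f x) \<le> B"
    unfolding bounded_pos by auto
  then show thesis
    by (intro that) auto
qed

lemma integrable_S2_continuous:
  fixes f :: "real^3 \<Rightarrow> 'b::{banach, second_countable_topology}"
  assumes "continuous_on (sphere 0 1) f"
  shows "integrable S2 f"
proof -
  obtain B where "\<And>x. norm x = 1 \<Longrightarrow> norm (f x) \<le> B"
    using continuous_on_sphere_bounded[OF assms] by blast
  then show ?thesis
    by (intro integrable_S2_bounded borel_measurable_S2_continuous assms)
qed

lemma integral_S2_angles:
  fixes f :: "real^3 \<Rightarrow> 'b::euclidean_space"
  assumes "continuous_on (sphere 0 1) f"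
  shows "(LINT x|S2. f x) =
    integral (cbox (0, 0) (pi, 2 * pi)) (\<lambda>p. sin (fst p) *\<^sub>R f (spherical_coords 1 p))"
proof -
  have m: "spherical_coords 1 \<in> angle_measure 1 \<rightarrow>\<^sub>M restrict_space borel (sphere 0 1)"
    using measurable_spherical_coords_sphere[of 1]
    by (simp add: measurable_cong_sets[OF sets_angle_measure refl])
  have mf: "f \<in> borel_measurable (restrict_space borel (sphere 0 1))"
    using borel_measurable_continuous_on_restrict[OF assms] .
  have c: "continuous_on UNIV (\<lambda>p. f (spherical_coords 1 p))"
    by (rule continuous_on_compose2[OF assms continuous_on_spherical_coords]) auto
  have "(LINT x|S2. f x) = (LINT p|angle_measure 1. f (spherical_coords 1 p))"
    unfolding sphere_measure_eq by (rule integral_distr[OF m mf])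
  also have "\<dots> = (LINT p|lborel. angle_density 1 p *\<^sub>R f (spherical_coords 1 p))"
    unfolding angle_measure_def
    by (rule integral_density) (simp_all add: borel_measurable_continuous_onI c angle_density_nonneg)
  also have "\<dots> = (LINT p:cbox (0, 0) (pi, 2 * pi)|lborel. sin (fst p) *\<^sub>R f (spherical_coords 1 p))"
    unfolding set_lebesgue_integral_def cbox_Pair_eq angle_density_def by (simp add: mult.commute)
  also have "\<dots> = integral (cbox (0, 0) (pi, 2 * pi)) (\<lambda>p. sin (fst p) *\<^sub>R f (spherical_coords 1 p))"
  proof (rule set_borel_integral_eq_integral)
    show "set_integrable lborel (cbox (0, 0) (pi, 2 * pi)) (\<lambda>p. sin (fst p) *\<^sub>R f (spherical_coords 1 p))"
      unfolding set_integrable_def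
      by (intro borel_integrable_compact continuous_intros continuous_on_subset[OF c]) auto
  qed
  finally show ?thesis .
qed

lemma S2_singleton_null: "AE y in S2. y \<noteq> x"
proof -
  have "AE p in lborel. p \<notin> {arccos (x $ 3)} \<times> (UNIV::real set)"
  proof (rule AE_not_in)
    have "emeasure (lborel \<Otimes>\<^sub>M lborel) ({arccos (x $ 3)} \<times> (UNIV::real set)) = 0"
      by (subst lborel.emeasure_pair_measure_Times) auto
    then show "{arccos (x $ 3)} \<times> (UNIV::real set) \<in> null_sets lborel"
      by (auto simp: lborel_prod null_sets_def intro!: borel_closed closed_Times)
  qed
  then have "AE p in angle_measure 1. spherical_coords 1 p \<noteq> x"
  proof -
    have "AE p in lborel. 0 < ennreal (angle_density 1 p) \<longrightarrow> spherical_coords 1 p \<noteq> x"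
      using \<open>AE p in lborel. p \<notin> {arccos (x $ 3)} \<times> UNIV\<close>
    proof eventually_elim
      case (elim p)
      then show ?case
        by (cases p) (auto simp: angle_density_def indicator_def spherical_coords_nth arccos_cos)
    qed
    then show ?thesis
      unfolding angle_measure_def by (subst AE_density) simp_all
  qed
  moreover have "{y \<in> space (restrict_space borel (sphere 0 1)). y \<noteq> x} \<in> sets (restrict_space borel (sphere 0 1))"
  proof -
    have "{y \<in> space (restrict_space borel (sphere 0 1)). y \<noteq> x} = sphere 0 1 \<inter> - {x}"
      by (auto simp: space_restrict_space)
    then show ?thesis
      by (simp add: sets_restrict_space)
  qed
  moreover have "spherical_coords 1 \<in> angle_measure 1 \<rightarrow>\<^sub>M restrict_space borel (sphere 0 1)"
    using measurable_spherical_coords_sphere[of 1]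
    by (simp add: measurable_cong_sets[OF sets_angle_measure refl])
  ultimately show ?thesis
    unfolding sphere_measure_eq by (simp add: AE_distr_iff)
qed


section \<open>Integrals of zonal functions\<close>

lemma unit_vector_spherical_coords:
  fixes x :: "real^3"
  assumes "norm x = 1"
  obtains \<alpha> \<beta> where "x = spherical_coords 1 (\<alpha>, \<beta>)"
proof -
  obtain s \<beta> where s: "x $ 1 = s * cos \<beta>" "x $ 2 = s * sin \<beta>"
    using polar_Ex by blast
  have "x \<bullet> x = 1"
    using assms by (simp add: norm_eq_1)
  then have "s * cos \<beta> * (s * cos \<beta>) + s * sin \<beta> * (s * sin \<beta>) + x $ 3 * x $ 3 = 1"
    by (simp add: inner_real3 s)
  then have "(x $ 3)\<^sup>2 + s\<^sup>2 = 1"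
    using sin_cos_squared_add[of \<beta>] by algebra
  then obtain \<alpha> where "x $ 3 = cos \<alpha>" "s = sin \<alpha>"
    using sincos_total_2pi by metis
  then have "x = spherical_coords 1 (\<alpha>, \<beta>)"
    by (simp add: vec_eq_iff forall_3 spherical_coords_nth s)
  then show thesis ..
qed

lemma inner_spherical_coords:
  "spherical_coords 1 (\<alpha>, \<beta>) \<bullet> spherical_coords 1 (\<theta>, \<phi>) =
     sin \<alpha> * sin \<theta> * cos (\<phi> - \<beta>) + cos \<alpha> * cos \<theta>"
  by (simp add: inner_real3 spherical_coords_nth cos_diff algebra_simps)

lemma inner_spherical_coords_bounds:
  "sin \<alpha> * sin \<theta> * cos (\<phi> - \<beta>) + cos \<alpha> * cos \<theta> \<in> {-1..1::real}"
  using Cauchy_Schwarz_ineq2[of "spherical_coords 1 (\<alpha>, \<beta>)" "spherical_coords 1 (\<theta>, \<phi>)"]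
  by (simp add: inner_spherical_coords abs_le_iff)

text \<open>
  Moving the pole along a meridian does not change the integral: the derivative in the polar
  angle of the pole is the integral over the angle box of a divergence, with vanishing flux through
  the poles and, by periodicity, through the two sides.
\<close>

lemma zonal_integral:
  fixes f f' F :: "real \<Rightarrow> real"
  assumes x: "norm x = 1"
    and F: "\<And>t. \<bar>t\<bar> \<le> 1 \<Longrightarrow> (F has_real_derivative f t) (at t)"
    and f: "\<And>t. \<bar>t\<bar> \<le> 1 \<Longrightarrow> (f has_real_derivative f' t) (at t)"
    and f': "continuous_on {-1..1} f'"
  shows "(LINT y|S2. f (x \<bullet> y)) = 2 * pi * (F 1 - F (-1))"
proof -
  obtain \<alpha>0 \<beta> where xc: "x = spherical_coords 1 (\<alpha>0, \<beta>)"
    using unit_vector_spherical_coords[OF x] .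
  define c where "c \<alpha> \<theta> \<phi> = sin \<alpha> * sin \<theta> * cos (\<phi> - \<beta>) + cos \<alpha> * cos \<theta>" for \<alpha> \<theta> \<phi>
  define B where "B = cbox (0::real, 0::real) (pi, 2 * pi)"
  have c1: "c \<alpha> \<theta> \<phi> \<in> {-1..1}" for \<alpha> \<theta> \<phi>
    unfolding c_def by (rule inner_spherical_coords_bounds)
  then have c1': "\<bar>c \<alpha> \<theta> \<phi>\<bar> \<le> 1" for \<alpha> \<theta> \<phi>
    by (simp add: abs_le_iff)
  have fc: "continuous_on {-1..1} f"
    by (intro continuous_at_imp_continuous_on ballI DERIV_isCont[OF f]) auto
  have cont_c: "continuous_on A (\<lambda>z. c (a z) (b z) (d z))"
    if "continuous_on A a" "continuous_on A b" "continuous_on A d"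
    for A :: "'z::metric_space set" and a b d
    unfolding c_def by (intro continuous_intros that)
  have cont_f: "continuous_on A (\<lambda>z. f (c (a z) (b z) (d z)))"
    if "continuous_on A a" "continuous_on A b" "continuous_on A d"
    for A :: "'z::metric_space set" and a b d
    by (rule continuous_on_compose2[OF fc cont_c[OF that]]) (use c1 in auto)
  have cont_f': "continuous_on A (\<lambda>z. f' (c (a z) (b z) (d z)))"
    if "continuous_on A a" "continuous_on A b" "continuous_on A d"
    for A :: "'z::metric_space set" and a b d
    by (rule continuous_on_compose2[OF f' cont_c[OF that]]) (use c1 in auto)
  have df: "((\<lambda>z. f (g z)) has_real_derivative f' (g z) * D) (at z)"
    if "(g has_real_derivative D) (at z)" "\<bar>g z\<bar> \<le> 1" for g D z
    using DERIV_chain2[of f _ g z, OF f] that by blast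
  define M where "M \<alpha> = integral B (\<lambda>p. sin (fst p) * f (c \<alpha> (fst p) (snd p)))" for \<alpha>
  define M' where "M' \<alpha> = (\<lambda>p. sin (fst p) * (f' (c \<alpha> (fst p) (snd p)) *
      (cos \<alpha> * sin (fst p) * cos (snd p - \<beta>) - sin \<alpha> * cos (fst p))))" for \<alpha>
  define P where "P \<alpha> \<theta> \<phi> = cos (\<phi> - \<beta>) * cos \<theta> * f (c \<alpha> \<theta> \<phi>) + cos (\<phi> - \<beta>) * sin \<theta> *
      (f' (c \<alpha> \<theta> \<phi>) * (sin \<alpha> * cos \<theta> * cos (\<phi> - \<beta>) - cos \<alpha> * sin \<theta>))" for \<alpha> \<theta> \<phi>
  define Q where "Q \<alpha> \<theta> \<phi> = cos \<theta> * cos (\<phi> - \<beta>) * f (c \<alpha> \<theta> \<phi>) + cos \<theta> * sin (\<phi> - \<beta>) *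
      (f' (c \<alpha> \<theta> \<phi>) * (- (sin \<alpha> * sin \<theta> * sin (\<phi> - \<beta>))))" for \<alpha> \<theta> \<phi>
  have dM: "(M has_real_derivative integral B (M' \<alpha>)) (at \<alpha>)" for \<alpha>
    unfolding M_def B_def
  proof (rule leibniz_rule_field_derivative[where U = UNIV, simplified])
    fix \<alpha> :: real and p :: "real \<times> real"
    show "((\<lambda>\<alpha>. sin (fst p) * f (c \<alpha> (fst p) (snd p))) has_real_derivative M' \<alpha> p) (at \<alpha>)"
      unfolding M'_def
      by (rule DERIV_cmult, rule df[of "\<lambda>\<alpha>. c \<alpha> (fst p) (snd p)", OF _ c1'], unfold c_def)
         (auto intro!: derivative_eq_intros simp: algebra_simps)
    show "(\<lambda>p. sin (fst p) * f (c \<alpha> (fst p) (snd p))) integrable_on cbox (0, 0) (pi, 2 * pi)"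
      by (intro integrable_continuous continuous_intros cont_f)
    show "continuous_on (UNIV \<times> cbox (0, 0) (pi, 2 * pi)) (\<lambda>(\<alpha>, p). M' \<alpha> p)"
      unfolding M'_def case_prod_beta by (intro continuous_intros cont_f')
  qed
  have int_P: "integral {0..pi} (\<lambda>\<theta>. P \<alpha> \<theta> \<phi>) = 0" for \<alpha> \<phi>
  proof -
    have "((\<lambda>\<theta>. P \<alpha> \<theta> \<phi>) has_integral
        (cos (\<phi> - \<beta>) * sin pi * f (c \<alpha> pi \<phi>) - cos (\<phi> - \<beta>) * sin 0 * f (c \<alpha> 0 \<phi>))) {0..pi}"
    proof (rule fundamental_theorem_of_calculus)
      fix \<theta> :: real
      have "((\<lambda>\<theta>. cos (\<phi> - \<beta>) * sin \<theta>) has_real_derivative cos (\<phi> - \<beta>) * cos \<theta>) (at \<theta>)"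
        by (auto intro!: derivative_eq_intros)
      moreover have "((\<lambda>\<theta>. f (c \<alpha> \<theta> \<phi>)) has_real_derivative
          f' (c \<alpha> \<theta> \<phi>) * (sin \<alpha> * cos \<theta> * cos (\<phi> - \<beta>) - cos \<alpha> * sin \<theta>)) (at \<theta>)"
        by (rule df[of "\<lambda>\<theta>. c \<alpha> \<theta> \<phi>", OF _ c1'], unfold c_def)
           (auto intro!: derivative_eq_intros simp: algebra_simps)
      ultimately have "((\<lambda>\<theta>. cos (\<phi> - \<beta>) * sin \<theta> * f (c \<alpha> \<theta> \<phi>)) has_real_derivative P \<alpha> \<theta> \<phi>) (at \<theta>)"
        unfolding P_def by (rule DERIV_mult[THEN DERIV_cong]) (simp add: algebra_simps)
      then show "((\<lambda>\<theta>. cos (\<phi> - \<beta>) * sin \<theta> * f (c \<alpha> \<theta> \<phi>)) has_vector_derivative P \<alpha> \<theta> \<phi>)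
          (at \<theta> within {0..pi})"
        by (simp add: has_real_derivative_iff_has_vector_derivative has_vector_derivative_at_within)
    qed simp
    then show ?thesis
      by (simp add: integral_unique)
  qed
  have int_Q: "integral {0..2 * pi} (Q \<alpha> \<theta>) = 0" for \<alpha> \<theta>
  proof -
    have "(Q \<alpha> \<theta> has_integral
        (cos \<theta> * sin (2 * pi - \<beta>) * f (c \<alpha> \<theta> (2 * pi)) - cos \<theta> * sin (0 - \<beta>) * f (c \<alpha> \<theta> 0))) {0..2 * pi}"
    proof (rule fundamental_theorem_of_calculus)
      fix \<phi> :: real
      have "((\<lambda>\<phi>. cos \<theta> * sin (\<phi> - \<beta>)) has_real_derivative cos \<theta> * cos (\<phi> - \<beta>)) (at \<phi>)"
        by (auto intro!: derivative_eq_intros)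
      moreover have "((\<lambda>\<phi>. f (c \<alpha> \<theta> \<phi>)) has_real_derivative
          f' (c \<alpha> \<theta> \<phi>) * (- (sin \<alpha> * sin \<theta> * sin (\<phi> - \<beta>)))) (at \<phi>)"
        by (rule df[of "c \<alpha> \<theta>", OF _ c1'], unfold c_def)
           (auto intro!: derivative_eq_intros simp: algebra_simps)
      ultimately have "((\<lambda>\<phi>. cos \<theta> * sin (\<phi> - \<beta>) * f (c \<alpha> \<theta> \<phi>)) has_real_derivative Q \<alpha> \<theta> \<phi>) (at \<phi>)"
        unfolding Q_def by (rule DERIV_mult[THEN DERIV_cong]) (simp add: algebra_simps)
      then show "((\<lambda>\<phi>. cos \<theta> * sin (\<phi> - \<beta>) * f (c \<alpha> \<theta> \<phi>)) has_vector_derivative Q \<alpha> \<theta> \<phi>)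
          (at \<phi> within {0..2 * pi})"
        by (simp add: has_real_derivative_iff_has_vector_derivative has_vector_derivative_at_within)
    qed simp
    then show ?thesis
      by (simp add: integral_unique c_def sin_diff cos_diff)
  qed
  have cont_P: "continuous_on A (\<lambda>p. P \<alpha> (fst p) (snd p))" for A \<alpha>
    unfolding P_def by (intro continuous_intros cont_f cont_f')
  have cont_Q: "continuous_on A (\<lambda>p. Q \<alpha> (fst p) (snd p))" for A \<alpha>
    unfolding Q_def by (intro continuous_intros cont_f cont_f')
  have zero_P: "integral B (\<lambda>p. P \<alpha> (fst p) (snd p)) = 0" for \<alpha>
  proof -
    have "integral B (\<lambda>p. P \<alpha> (fst p) (snd p)) =
        integral (cbox 0 pi) (\<lambda>\<theta>. integral (cbox 0 (2 * pi)) (\<lambda>\<phi>. P \<alpha> \<theta> \<phi>))"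
      unfolding B_def using integral_prod_continuous[OF cont_P, of 0 0 pi "2 * pi" \<alpha>] by simp
    also have "\<dots> = integral (cbox 0 (2 * pi)) (\<lambda>\<phi>. integral (cbox 0 pi) (\<lambda>\<theta>. P \<alpha> \<theta> \<phi>))"
      by (rule integral_swap_continuous) (use cont_P in \<open>simp add: case_prod_beta\<close>)
    finally show ?thesis
      by (simp add: int_P)
  qed
  have zero_Q: "integral B (\<lambda>p. Q \<alpha> (fst p) (snd p)) = 0" for \<alpha>
    unfolding B_def using integral_prod_continuous[OF cont_Q, of 0 0 pi "2 * pi" \<alpha>] by (simp add: int_Q)
  have "M' \<alpha> p = Q \<alpha> (fst p) (snd p) - P \<alpha> (fst p) (snd p)" for \<alpha> p
  proof -
    have s: "(sin (snd p - \<beta>))\<^sup>2 = 1 - (cos (snd p - \<beta>))\<^sup>2"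
      by (rule sin_squared_eq)
    show ?thesis
      unfolding M'_def P_def Q_def using s by algebra
  qed
  then have "integral B (M' \<alpha>) = integral B (\<lambda>p. Q \<alpha> (fst p) (snd p) - P \<alpha> (fst p) (snd p))" for \<alpha>
    by presburger
  also have "\<dots> \<alpha> = 0" for \<alpha>
    unfolding B_def
    by (subst integral_diff) (use zero_P zero_Q in \<open>auto simp: B_def intro!: integrable_continuous cont_P cont_Q\<close>)
  finally have "(M has_real_derivative 0) (at \<alpha>)" for \<alpha>
    using dM[of \<alpha>] by simp
  then have "M \<alpha>0 = M 0"
    by (intro DERIV_isconst_all) auto
  also have "M 0 = integral (cbox 0 pi) (\<lambda>\<theta>. integral (cbox 0 (2 * pi)) (\<lambda>\<phi>. sin \<theta> * f (cos \<theta>)))"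
  proof -
    have "continuous_on (cbox (0, 0) (pi, 2 * pi)) (\<lambda>p. sin (fst p) * f (c 0 (fst p) (snd p)))"
      by (intro continuous_intros cont_f)
    from integral_prod_continuous[OF this] show ?thesis
      unfolding M_def B_def by (simp add: c_def)
  qed
  also have "\<dots> = 2 * pi * integral {0..pi} (\<lambda>\<theta>. sin \<theta> * f (cos \<theta>))"
  proof -
    have "integral (cbox 0 (2 * pi)) (\<lambda>\<phi>. z) = 2 * pi * z" for z :: real
      by simp
    then show ?thesis
      unfolding box_real by (simp only: flip: Henstock_Kurzweil_Integration.integral_mult_right)
  qed
  also have "integral {0..pi} (\<lambda>\<theta>. sin \<theta> * f (cos \<theta>)) = - F (cos pi) - (- F (cos 0))"
  proof (rule integral_unique, rule fundamental_theorem_of_calculus)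
    fix \<theta> :: real
    have "((\<lambda>\<theta>. F (cos \<theta>)) has_real_derivative f (cos \<theta>) * (- sin \<theta>)) (at \<theta>)"
      by (rule DERIV_chain2[of F _ cos, OF F]) (auto intro!: derivative_eq_intros)
    then have "((\<lambda>\<theta>. - F (cos \<theta>)) has_real_derivative sin \<theta> * f (cos \<theta>)) (at \<theta>)"
      by (rule DERIV_minus[THEN DERIV_cong]) simp
    then show "((\<lambda>\<theta>. - F (cos \<theta>)) has_vector_derivative sin \<theta> * f (cos \<theta>)) (at \<theta> within {0..pi})"
      by (simp add: has_real_derivative_iff_has_vector_derivative has_vector_derivative_at_within)
  qed simp
  finally have "M \<alpha>0 = 2 * pi * (F 1 - F (-1))"
    by simp
  moreover have "(LINT y|S2. f (x \<bullet> y)) = M \<alpha>0"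
  proof -
    have "continuous_on (sphere 0 1) (\<lambda>y. f (x \<bullet> y))"
    proof (rule continuous_on_compose2[OF fc])
      have "\<bar>x \<bullet> y\<bar> \<le> 1" if "norm y = 1" for y
        using Cauchy_Schwarz_ineq2[of x y] x that by simp
      then show "(\<lambda>y. x \<bullet> y) ` sphere 0 1 \<subseteq> {-1..1}"
        by (auto simp: abs_le_iff)
    qed (intro continuous_intros)
    from integral_S2_angles[OF this] show ?thesis
      unfolding M_def B_def xc
      using inner_spherical_coords[of \<alpha>0 \<beta> "fst p" "snd p" for p] by (simp add: c_def)
  qed
  ultimately show ?thesis
    by simp
qed


section \<open>The Poisson kernel\<close>

lemma norm_scaled_diff_sq:
  fixes x y :: "'a::real_inner"
  assumes "norm x = 1" "norm y = 1"
  shows "(norm (r *\<^sub>R x - y))\<^sup>2 = 1 + r\<^sup>2 - 2 * r * (x \<bullet> y)"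
  using assms unfolding power2_norm_eq_inner norm_eq_1
  by (simp add: inner_diff_left inner_diff_right inner_commute algebra_simps power2_eq_square)

lemma norm_scaled_diff_commute:
  fixes x y :: "'a::real_inner"
  assumes "norm x = 1" "norm y = 1"
  shows "norm (r *\<^sub>R x - y) = norm (r *\<^sub>R y - x)"
proof -
  have "(norm (r *\<^sub>R x - y))\<^sup>2 = (norm (r *\<^sub>R y - x))\<^sup>2"
    using assms by (simp add: norm_scaled_diff_sq inner_commute)
  then show ?thesis
    by (rule power2_eq_imp_eq) auto
qed

lemma norm_scaled_diff_pos:
  fixes x y :: "'a::real_normed_vector"
  assumes "norm x = 1" "norm y = 1" "0 < r" "r \<noteq> 1"
  shows "0 < norm (r *\<^sub>R x - y)"
proof -
  have "norm (r *\<^sub>R x) \<noteq> norm y"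
    using assms by simp
  then show ?thesis by auto
qed

lemma integral_distance_powr:
  assumes r: "0 < r" "r < 1" and x: "norm x = 1" and p: "p \<noteq> -2"
  shows "(LINT y|S2. norm (r *\<^sub>R x - y) powr p) =
    2 * pi / (r * (p + 2)) * ((1 + r) powr (p + 2) - (1 - r) powr (p + 2))"
proof -
  define q where "q t = 1 + r\<^sup>2 - 2 * r * t" for t
  have q_pos: "0 < q t" if "\<bar>t\<bar> \<le> 1" for t
  proof -
    have "r * t \<le> r * 1"
      using that r by (intro mult_left_mono) auto
    moreover have "0 < (1 - r)\<^sup>2"
      using r by simp
    ultimately show ?thesis
      by (simp add: q_def power2_eq_square algebra_simps)
  qed
  have dq: "((\<lambda>t. q t powr a) has_real_derivative (- 2 * r * a) * q t powr (a - 1)) (at t)"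
    if "\<bar>t\<bar> \<le> 1" for a t
  proof -
    have "((\<lambda>t. q t powr a) has_real_derivative a * q t powr (a - of_nat 1) * (- 2 * r)) (at t)"
      by (rule DERIV_fun_powr[of q _ t, OF _ q_pos[OF that]]) (auto simp: q_def[abs_def] intro!: derivative_eq_intros)
    then show ?thesis
      by (rule DERIV_cong) simp
  qed
  define F where "F t = - 1 / (r * (p + 2)) * q t powr ((p + 2) / 2)" for t
  have "(LINT y|S2. norm (r *\<^sub>R x - y) powr p) = (LINT y|S2. q (x \<bullet> y) powr (p / 2))"
  proof (rule integral_S2_cong)
    fix y :: "real^3" assume y: "norm y = 1"
    have "q (x \<bullet> y) powr (p / 2) = ((norm (r *\<^sub>R x - y)) powr 2) powr (p / 2)"
      using norm_scaled_diff_sq[OF x y, of r] norm_scaled_diff_pos[OF x y, of r] r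
      by (simp add: q_def powr_realpow)
    then show "norm (r *\<^sub>R x - y) powr p = q (x \<bullet> y) powr (p / 2)"
      by (simp only: powr_powr) simp
  qed
  also have "\<dots> = 2 * pi * (F 1 - F (- 1))"
  proof (rule zonal_integral[OF x])
    fix t :: real assume t: "\<bar>t\<bar> \<le> 1"
    show "((\<lambda>t. q t powr (p / 2)) has_real_derivative (- 2 * r * (p / 2)) * q t powr (p / 2 - 1)) (at t)"
      by (rule dq[OF t])
    have "(F has_real_derivative - 1 / (r * (p + 2)) * ((- 2 * r * ((p + 2) / 2)) * q t powr ((p + 2) / 2 - 1))) (at t)"
      unfolding F_def by (rule DERIV_cmult[OF dq[OF t]])
    moreover have "(p + 2) / 2 - 1 = p / 2"
      by (simp add: field_simps)
    moreover have "- 1 / (r * (p + 2)) * ((- 2 * r * ((p + 2) / 2)) * z) = z" for z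
    proof -
      have "- 1 / (r * s) * ((- 2 * r * (s / 2)) * z) = z" if "s \<noteq> 0" for s
        using r that by simp
      from this[of "p + 2"] p show ?thesis
        by (simp add: add_eq_0_iff)
    qed
    ultimately show "(F has_real_derivative q t powr (p / 2)) (at t)"
      by simp
  next
    have "q t \<noteq> 0" if "t \<in> {-1..1}" for t
      using q_pos[of t] that by (simp add: abs_le_iff)
    then show "continuous_on {- 1..1} (\<lambda>t. - 2 * r * (p / 2) * q t powr (p / 2 - 1))"
      unfolding q_def by (intro continuous_intros) (auto simp: q_def)
  qed
  also have "F 1 - F (- 1) = 1 / (r * (p + 2)) * ((1 + r) powr (p + 2) - (1 - r) powr (p + 2))"
  proof -
    have "q 1 = (1 - r) powr 2" "q (- 1) = (1 + r) powr 2"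
      using r by (simp_all add: q_def powr_realpow power2_eq_square algebra_simps)
    moreover have "2 * ((p + 2) / 2) = p + 2"
      by simp
    ultimately show ?thesis
      unfolding F_def by (simp only: powr_powr) (simp add: right_diff_distrib)
  qed
  finally show ?thesis by simp
qed

lemma measure_S2: "measure S2 (sphere 0 1) = 4 * pi"
proof -
  define x where "x = (axis 1 1 :: real^3)"
  have x: "norm x = 1" by (simp add: x_def)
  have "measure S2 (sphere 0 1) = (LINT y|S2. 1)"
    by simp
  also have "\<dots> = (LINT y|S2. norm ((1/2) *\<^sub>R x - y) powr 0)"
  proof (rule integral_S2_cong)
    fix y :: "real^3" assume "norm y = 1"
    then show "1 = norm ((1/2) *\<^sub>R x - y) powr 0"
      using norm_scaled_diff_pos[OF x, of y "1/2"] by simp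
  qed
  also have "\<dots> = 4 * pi"
    using integral_distance_powr[of "1/2" x 0] x by (simp add: power2_eq_square)
  finally show ?thesis .
qed

definition poisson :: "real \<Rightarrow> real^3 \<Rightarrow> real^3 \<Rightarrow> real" where
  "poisson r x y = (1 - r\<^sup>2) / (4 * pi * norm (r *\<^sub>R x - y) ^ 3)"

lemma poisson_nonneg: "0 < r \<Longrightarrow> r < 1 \<Longrightarrow> 0 \<le> poisson r x y"
  by (simp add: poisson_def power_le_one_iff abs_square_le_1)

lemma poisson_commute:
  "norm x = 1 \<Longrightarrow> norm y = 1 \<Longrightarrow> poisson r x y = poisson r y x"
  by (simp add: poisson_def norm_scaled_diff_commute)

lemma continuous_on_poisson:
  assumes "0 < r" "r < 1"
  shows "continuous_on (sphere 0 1 \<times> sphere 0 1) (\<lambda>(x, y). poisson r x y)"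
  unfolding poisson_def case_prod_beta using norm_scaled_diff_pos[where r = r] assms
  by (intro continuous_intros) fastforce

lemma continuous_on_poisson_snd:
  assumes "0 < r" "r < 1" "norm x = 1"
  shows "continuous_on (sphere 0 1) (poisson r x)"
proof -
  have "continuous_on (sphere 0 1) (\<lambda>y. (\<lambda>(x, y). poisson r x y) (x, y))"
    by (rule continuous_on_compose2[OF continuous_on_poisson[OF assms(1,2)]])
       (use assms in \<open>auto intro!: continuous_intros\<close>)
  then show ?thesis by simp
qed

lemma poisson_powr:
  assumes "0 < r" "r < 1" "norm x = 1" "norm y = 1"
  shows "poisson r x y = (1 - r\<^sup>2) / (4 * pi) * norm (r *\<^sub>R x - y) powr (-3)"
  using norm_scaled_diff_pos[of x y r] assms by (simp add: poisson_def powr_minus_divide powr_realpow)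

lemma integral_poisson:
  assumes r: "0 < r" "r < 1" and x: "norm x = 1"
  shows "(LINT y|S2. poisson r x y) = 1"
proof -
  have "(LINT y|S2. poisson r x y) = (LINT y|S2. (1 - r\<^sup>2) / (4 * pi) * norm (r *\<^sub>R x - y) powr (-3))"
    using r x by (intro Bochner_Integration.integral_cong) (auto simp: poisson_powr)
  also have "\<dots> = (1 - r\<^sup>2) / (4 * pi) * (2 * pi / (r * (-3 + 2)) * ((1 + r) powr (-3 + 2) - (1 - r) powr (-3 + 2)))"
    by (subst integral_mult_right_zero, subst integral_distance_powr) (use r x in auto)
  also have "\<dots> = (1 - r\<^sup>2) / (2 * r) * (1 / (1 - r) - 1 / (1 + r))"
  proof -
    have "c / (4 * pi) * (2 * pi / (r * (-3 + 2)) * (b - a)) = c / (2 * r) * (a - b)" for a b c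
      using r by (simp add: field_simps)
    moreover have "(1 + r) powr (-3 + 2) = 1 / (1 + r)" "(1 - r) powr (-3 + 2) = 1 / (1 - r)"
      using r by (simp_all add: powr_minus_divide)
    ultimately show ?thesis by presburger
  qed
  also have "\<dots> = 1"
  proof -
    have "1 - r\<^sup>2 = (1 - r) * (1 + r)"
      by (simp add: power2_eq_square algebra_simps)
    then have "1 / (1 - r) - 1 / (1 + r) = 2 * r / (1 - r\<^sup>2)"
      using r by (simp add: diff_frac_eq)
    moreover have "1 - r\<^sup>2 \<noteq> 0"
      using r by (simp add: power2_eq_1_iff)
    ultimately show ?thesis
      using r by simp
  qed
  finally show ?thesis .
qed

lemma integral_poisson_sq:
  assumes r: "0 < r" "r < 1" and x: "norm x = 1"
  shows "(LINT y|S2. (poisson r x y)\<^sup>2) = (1 + r\<^sup>2) / (4 * pi * (1 - r\<^sup>2)\<^sup>2)"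
proof -
  have nz: "1 - r\<^sup>2 \<noteq> 0" "1 - r \<noteq> 0" "1 + r \<noteq> 0"
    using r by (auto simp: power2_eq_1_iff)
  have "(LINT y|S2. (poisson r x y)\<^sup>2) = (LINT y|S2. ((1 - r\<^sup>2) / (4 * pi))\<^sup>2 * norm (r *\<^sub>R x - y) powr (-6))"
  proof (rule integral_S2_cong)
    fix y :: "real^3" assume "norm y = 1"
    moreover have "(norm (r *\<^sub>R x - y) powr (-3))\<^sup>2 = norm (r *\<^sub>R x - y) powr (-6)"
      by (simp add: power2_eq_square flip: powr_add)
    ultimately show "(poisson r x y)\<^sup>2 = ((1 - r\<^sup>2) / (4 * pi))\<^sup>2 * norm (r *\<^sub>R x - y) powr (-6)"
      using r x by (simp only: poisson_powr power_mult_distrib space_sphere_measure mem_sphere_0)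
  qed
  also have "\<dots> = ((1 - r\<^sup>2) / (4 * pi))\<^sup>2 * (2 * pi / (r * (-6 + 2)) * ((1 + r) powr (-6 + 2) - (1 - r) powr (-6 + 2)))"
    by (subst integral_mult_right_zero, subst integral_distance_powr) (use r x in auto)
  also have "\<dots> = ((1 - r\<^sup>2) / (4 * pi))\<^sup>2 * (pi / (2 * r) * (1 / (1 - r) ^ 4 - 1 / (1 + r) ^ 4))"
  proof -
    have "c * (2 * pi / (r * (-6 + 2)) * (b - a)) = c * (pi / (2 * r) * (a - b))" for a b c
      using r by (simp add: field_simps)
    moreover have "(1 + r) powr (-6 + 2) = 1 / (1 + r) ^ 4" "(1 - r) powr (-6 + 2) = 1 / (1 - r) ^ 4"
      using r by (simp_all add: powr_minus_divide powr_realpow)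
    ultimately show ?thesis by presburger
  qed
  also have "1 / (1 - r) ^ 4 - 1 / (1 + r) ^ 4 = 8 * r * (1 + r\<^sup>2) / (1 - r\<^sup>2) ^ 4"
  proof -
    have "1 - r\<^sup>2 = (1 - r) * (1 + r)"
      by (simp add: power2_eq_square algebra_simps)
    then have "(1 - r\<^sup>2) ^ 4 = (1 - r) ^ 4 * (1 + r) ^ 4"
      by (simp add: power_mult_distrib)
    moreover have "1 / (1 - r) ^ 4 - 1 / (1 + r) ^ 4 = ((1 + r) ^ 4 - (1 - r) ^ 4) / ((1 - r) ^ 4 * (1 + r) ^ 4)"
      using nz by (simp add: field_simps)
    moreover have "(1 + r) ^ 4 - (1 - r) ^ 4 = 8 * r * (1 + r\<^sup>2)"
      by algebra
    ultimately show ?thesis by simp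
  qed
  also have "((1 - r\<^sup>2) / (4 * pi))\<^sup>2 * (pi / (2 * r) * (8 * r * (1 + r\<^sup>2) / (1 - r\<^sup>2) ^ 4)) =
      (1 + r\<^sup>2) / (4 * pi * (1 - r\<^sup>2)\<^sup>2)"
  proof -
    define s where "s = 1 - r\<^sup>2"
    have "s \<noteq> 0" using nz by (simp add: s_def)
    then show ?thesis
      unfolding s_def[symmetric] using r
      by (simp add: field_simps power2_eq_square power4_eq_xxxx)
  qed
  finally show ?thesis .
qed

lemma poisson_approximate_identity:
  fixes g :: "real^3 \<Rightarrow> 'b::{banach, second_countable_topology}"
  assumes g: "continuous_on (sphere 0 1) g" and "0 < e"
  obtains r0 where "0 < r0" "r0 < 1"
    "\<And>r x. r0 < r \<Longrightarrow> r < 1 \<Longrightarrow> norm x = 1 \<Longrightarrow> norm ((LINT y|S2. poisson r x y *\<^sub>R g y) - g x) \<le> e"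
proof -
  obtain B where "0 < B" and B: "\<And>x. norm x = 1 \<Longrightarrow> norm (g x) \<le> B"
    using continuous_on_sphere_bounded[OF g] by blast
  have "uniformly_continuous_on (sphere 0 1) g"
    by (rule compact_uniformly_continuous[OF g]) simp
  then obtain \<delta> where \<delta>: "0 < \<delta>" and
    close: "\<And>x y. norm x = 1 \<Longrightarrow> norm y = 1 \<Longrightarrow> norm (y - x) < \<delta> \<Longrightarrow> norm (g y - g x) < e / 2"
    unfolding uniformly_continuous_on_def dist_norm using \<open>0 < e\<close>
    by (metis half_gt_zero mem_sphere_0)
  define r0 where "r0 = Max {1/2, 1 - \<delta> / 2, 1 - e * \<delta> ^ 3 / (64 * B)}"
  have r0: "0 < r0" "r0 < 1"
    using \<delta> \<open>0 < e\<close> \<open>0 < B\<close> by (auto simp: r0_def)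
  show thesis
  proof (rule that[OF r0])
    fix r :: real and x :: "real^3" assume r: "r0 < r" "r < 1" and x: "norm x = 1"
    have r_pos: "0 < r"
      using r r0 by simp
    have r1: "1 - r < \<delta> / 2" and r2: "1 - r < e * \<delta> ^ 3 / (64 * B)"
      using r by (auto simp: r0_def)
    define K where "K = 2 * (1 - r\<^sup>2) / (pi * \<delta> ^ 3)"
    have "r\<^sup>2 < 1"
      using r r_pos by (simp add: power2_less_1_iff)
    then have K: "0 \<le> K"
      using \<delta> by (simp add: K_def)
    have pt: "norm (poisson r x y *\<^sub>R (g y - g x)) \<le> e / 2 * poisson r x y + 2 * B * K"
      if y: "norm y = 1" for y
    proof (cases "norm (y - x) < \<delta>")
      case True
      have "norm (poisson r x y *\<^sub>R (g y - g x)) = poisson r x y * norm (g y - g x)"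
        using poisson_nonneg[OF r_pos r(2)] by simp
      also have "\<dots> \<le> poisson r x y * (e / 2)"
        using close[OF x y True] poisson_nonneg[OF r_pos r(2)] by (intro mult_left_mono) auto
      finally show ?thesis
        using K \<open>0 < B\<close> by (simp add: mult.commute add_increasing2)
    next
      case False
      have "norm (x - y) \<le> norm (r *\<^sub>R x - y) + norm ((1 - r) *\<^sub>R x)"
        using norm_triangle_ineq[of "r *\<^sub>R x - y" "(1 - r) *\<^sub>R x"] by (simp add: algebra_simps)
      then have d: "\<delta> / 2 \<le> norm (r *\<^sub>R x - y)"
        using False r r1 x by (simp add: norm_minus_commute)
      have "poisson r x y \<le> (1 - r\<^sup>2) / (4 * pi * (\<delta> / 2) ^ 3)"
        unfolding poisson_def using d \<delta> \<open>r\<^sup>2 < 1\<close>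
        by (intro divide_left_mono mult_left_mono power_mono mult_pos_pos zero_less_power) auto
      also have "\<dots> = K"
        by (simp add: K_def power_divide field_simps)
      finally have "poisson r x y \<le> K" .
      moreover have "norm (g y - g x) \<le> 2 * B"
        using norm_triangle_ineq4[of "g y" "g x"] B[OF x] B[OF y] by simp
      ultimately have "poisson r x y * norm (g y - g x) \<le> K * (2 * B)"
        using poisson_nonneg[OF r_pos r(2)] K by (intro mult_mono) auto
      then show ?thesis
        using poisson_nonneg[OF r_pos r(2), of x y] \<open>0 < e\<close> by (simp add: mult.commute add_increasing)
    qed
    note cp = continuous_on_poisson_snd[OF r_pos r(2) x]
    have int1: "integrable S2 (\<lambda>y. poisson r x y *\<^sub>R g y)" "integrable S2 (\<lambda>y. poisson r x y *\<^sub>R g x)"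
      by (intro integrable_S2_continuous continuous_intros cp g)+
    have "(LINT y|S2. poisson r x y *\<^sub>R g y) - g x =
        (LINT y|S2. poisson r x y *\<^sub>R g y) - (LINT y|S2. poisson r x y *\<^sub>R g x)"
      using integral_poisson[OF r_pos r(2) x] integrable_S2_continuous[OF cp] by simp
    also have "\<dots> = (LINT y|S2. poisson r x y *\<^sub>R (g y - g x))"
      using int1 by (simp add: scaleR_diff_right)
    also have "norm \<dots> \<le> (LINT y|S2. norm (poisson r x y *\<^sub>R (g y - g x)))"
      by (rule integral_norm_bound)
    also have "\<dots> \<le> (LINT y|S2. e / 2 * poisson r x y + 2 * B * K)"
      by (rule integral_mono, (intro integrable_S2_continuous continuous_intros cp g)+) (use pt in simp)
    also have "\<dots> = e / 2 + 2 * B * K * (4 * pi)"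
      using integral_poisson[OF r_pos r(2) x] integrable_S2_continuous[OF cp] measure_S2
      by (subst Bochner_Integration.integral_add) auto
    also have "2 * B * K * (4 * pi) \<le> e / 2"
    proof -
      have "1 - r\<^sup>2 = (1 - r) * (1 + r)"
        by (simp add: power2_eq_square algebra_simps)
      also have "\<dots> \<le> (e * \<delta> ^ 3 / (64 * B)) * 2"
        using r r2 r_pos by (intro mult_mono) auto
      finally have "1 - r\<^sup>2 \<le> e * \<delta> ^ 3 / (32 * B)" by simp
      then have "16 * B / \<delta> ^ 3 * (1 - r\<^sup>2) \<le> 16 * B / \<delta> ^ 3 * (e * \<delta> ^ 3 / (32 * B))"
        using \<open>0 < B\<close> \<delta> by (intro mult_left_mono) auto
      also have "\<dots> = e / 2"
        using \<open>0 < B\<close> \<delta> by simp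
      finally have "16 * B / \<delta> ^ 3 * (1 - r\<^sup>2) \<le> e / 2" .
      moreover have "2 * B * (2 * u / (pi * d)) * (4 * pi) = 16 * B / d * u" for u d
        by simp
      ultimately show ?thesis
        unfolding K_def by presburger
    qed
    finally show "norm ((LINT y|S2. poisson r x y *\<^sub>R g y) - g x) \<le> e"
      by simp
  qed
qed


section \<open>Differentiation under the integral and the maximum principle\<close>

lemma integrable_S2_scaleR_continuous:
  fixes \<phi> :: "real^3 \<Rightarrow> 'b::{banach, second_countable_topology}"
  assumes k: "continuous_on (sphere 0 1) k" and \<phi>: "integrable S2 \<phi>"
  shows "integrable S2 (\<lambda>y. k y *\<^sub>R \<phi> y)"
proof -
  obtain B where B: "\<And>x. norm x = 1 \<Longrightarrow> norm (k x) \<le> B"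
    using continuous_on_sphere_bounded[OF k] by blast
  have [measurable]: "k \<in> borel_measurable S2" "\<phi> \<in> borel_measurable S2"
    using borel_measurable_S2_continuous[OF k] \<phi> by auto
  show ?thesis
  proof (rule Bochner_Integration.integrable_bound)
    show "integrable S2 (\<lambda>y. B * norm (\<phi> y))"
      using \<phi> by simp
    show "AE y in S2. norm (k y *\<^sub>R \<phi> y) \<le> norm (B * norm (\<phi> y))"
    proof (rule AE_I2)
      fix y assume "y \<in> space S2"
      then have "\<bar>k y\<bar> * norm (\<phi> y) \<le> \<bar>B\<bar> * norm (\<phi> y)"
        using B[of y] by (intro mult_right_mono) fastforce+
      then show "norm (k y *\<^sub>R \<phi> y) \<le> norm (B * norm (\<phi> y))"
        by (simp add: abs_mult)
    qed
  qed measurable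
qed

lemma has_derivative_sphere_integral:
  fixes \<phi> :: "real^3 \<Rightarrow> 'b::{banach, second_countable_topology}"
    and g :: "real^3 \<Rightarrow> real^3 \<Rightarrow> real^3"
  assumes U: "open U" "x \<in> U"
    and dk: "\<And>x y. x \<in> U \<Longrightarrow> norm y = 1 \<Longrightarrow> ((\<lambda>x. k x y) has_derivative (\<lambda>h. g x y \<bullet> h)) (at x)"
    and cg: "continuous_on (U \<times> sphere 0 1) (\<lambda>(x, y). g x y)"
    and ck: "\<And>x. x \<in> U \<Longrightarrow> continuous_on (sphere 0 1) (k x)"
    and \<phi>: "integrable S2 \<phi>"
  shows "((\<lambda>x. LINT y|S2. k x y *\<^sub>R \<phi> y) has_derivative (\<lambda>h. LINT y|S2. (g x y \<bullet> h) *\<^sub>R \<phi> y)) (at x)"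
proof -
  obtain d where d: "0 < d" "cball x d \<subseteq> U"
    using U open_contains_cball by blast
  have cgx: "continuous_on (sphere 0 1) (\<lambda>y. g x y \<bullet> h)" for h
  proof -
    have "continuous_on (sphere 0 1) (\<lambda>y. (\<lambda>(x, y). g x y) (x, y))"
      by (rule continuous_on_compose2[OF cg]) (use U in \<open>auto intro!: continuous_intros\<close>)
    then show ?thesis
      by (intro continuous_intros) simp
  qed
  have ig: "integrable S2 (\<lambda>y. (g x y \<bullet> h) *\<^sub>R \<phi> y)" for h
    by (rule integrable_S2_scaleR_continuous[OF cgx \<phi>])
  have ik: "integrable S2 (\<lambda>y. k z y *\<^sub>R \<phi> y)" if "z \<in> U" for z
    by (rule integrable_S2_scaleR_continuous[OF ck[OF that] \<phi>])
  define D where "D h = (LINT y|S2. (g x y \<bullet> h) *\<^sub>R \<phi> y)" for h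
  define C where "C = (LINT y|S2. norm (\<phi> y))"
  have C: "0 \<le> C"
    by (simp add: C_def)
  have "linear D"
    unfolding D_def
    by (rule linearI) (simp_all add: inner_add_right scaleR_add_left ig flip: scaleR_scaleR)
  then have "bounded_linear D"
    by (rule linear_conv_bounded_linear[THEN iffD1])
  moreover have "\<exists>\<delta>>0. \<forall>z. norm (z - x) < \<delta> \<longrightarrow>
      norm ((LINT y|S2. k z y *\<^sub>R \<phi> y) - (LINT y|S2. k x y *\<^sub>R \<phi> y) - D (z - x)) \<le> e * norm (z - x)"
    if e: "0 < e" for e
  proof -
    define e' where "e' = e / (C + 1)"
    have e': "0 < e'"
      using e C by (simp add: e'_def)
    have "uniformly_continuous_on (cball x d \<times> sphere 0 1) (\<lambda>(x, y). g x y)"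
      by (intro compact_uniformly_continuous continuous_on_subset[OF cg] compact_Times) (use d in auto)
    then obtain \<eta> where \<eta>: "0 < \<eta>" and
      close: "\<And>p q. p \<in> cball x d \<times> sphere 0 1 \<Longrightarrow> q \<in> cball x d \<times> sphere 0 1 \<Longrightarrow> dist q p < \<eta> \<Longrightarrow>
        dist ((\<lambda>(x, y). g x y) q) ((\<lambda>(x, y). g x y) p) < e'"
      unfolding uniformly_continuous_on_def using e' by metis
    have close': "norm (g z y - g x y) \<le> e'" if "norm (z - x) < min \<eta> d" "norm y = 1" for z y
      using close[of "(x, y)" "(z, y)"] that d
      by (simp add: dist_Pair_Pair dist_norm norm_minus_commute)
    show ?thesis
    proof (intro exI[of _ "min \<eta> d"] conjI allI impI)
      show "0 < min \<eta> d" using \<eta> d by simp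
      fix z assume z: "norm (z - x) < min \<eta> d"
      have zU: "z \<in> U"
        using z d by (auto simp: dist_norm norm_minus_commute)
      have pt: "\<bar>k z y - k x y - g x y \<bullet> (z - x)\<bar> \<le> e' * norm (z - x)" if y: "norm y = 1" for y
      proof -
        have "norm ((\<lambda>u. k u y - g x y \<bullet> u) z - (\<lambda>u. k u y - g x y \<bullet> u) x) \<le> e' * norm (z - x)"
        proof (rule differentiable_bound)
          show "convex (ball x (min \<eta> d))" by simp
          fix u assume u: "u \<in> ball x (min \<eta> d)"
          then have u': "norm (u - x) < min \<eta> d"
            by (simp add: dist_norm norm_minus_commute)
          then have "u \<in> U"
            using d by (auto simp: dist_norm norm_minus_commute)
          from dk[OF this y]
          show "((\<lambda>u. k u y - g x y \<bullet> u) has_derivative (\<lambda>h. g u y \<bullet> h - g x y \<bullet> h)) (at u within ball x (min \<eta> d))"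
            by (rule has_derivative_at_withinI[OF has_derivative_diff])
               (rule bounded_linear_imp_has_derivative[OF bounded_linear_inner_right])
          show "onorm (\<lambda>h. g u y \<bullet> h - g x y \<bullet> h) \<le> e'"
          proof (rule onorm_le)
            fix h
            have "\<bar>(g u y - g x y) \<bullet> h\<bar> \<le> norm (g u y - g x y) * norm h"
              by (rule Cauchy_Schwarz_ineq2)
            also have "\<dots> \<le> e' * norm h"
              by (intro mult_right_mono close'[OF u' y]) simp
            finally show "norm (g u y \<bullet> h - g x y \<bullet> h) \<le> e' * norm h"
              by (simp add: inner_diff_left)
          qed
        qed (use z \<eta> d in \<open>auto simp: dist_norm norm_minus_commute\<close>)
        then show ?thesis
          by (simp add: inner_diff_right algebra_simps)
      qed
      have "(LINT y|S2. k z y *\<^sub>R \<phi> y) - (LINT y|S2. k x y *\<^sub>R \<phi> y) - D (z - x) =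
          (LINT y|S2. (k z y - k x y - g x y \<bullet> (z - x)) *\<^sub>R \<phi> y)"
        using ik[OF zU] ik[OF U(2)] ig by (simp add: D_def scaleR_diff_left)
      also have "norm \<dots> \<le> (LINT y|S2. norm ((k z y - k x y - g x y \<bullet> (z - x)) *\<^sub>R \<phi> y))"
        by (rule integral_norm_bound)
      also have "\<dots> \<le> (LINT y|S2. e' * norm (z - x) * norm (\<phi> y))"
      proof (rule integral_mono)
        show "integrable S2 (\<lambda>y. norm ((k z y - k x y - g x y \<bullet> (z - x)) *\<^sub>R \<phi> y))"
          unfolding scaleR_diff_left using ik[OF zU] ik[OF U(2)] ig by simp
        show "integrable S2 (\<lambda>y. e' * norm (z - x) * norm (\<phi> y))"
          using \<phi> by simp
        fix y assume "y \<in> space S2"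
        then show "norm ((k z y - k x y - g x y \<bullet> (z - x)) *\<^sub>R \<phi> y) \<le> e' * norm (z - x) * norm (\<phi> y)"
          unfolding norm_scaleR using pt[of y] by (intro mult_right_mono) auto
      qed
      also have "\<dots> = e' * C * norm (z - x)"
        by (simp add: C_def)
      also have "\<dots> \<le> e * norm (z - x)"
      proof (rule mult_right_mono)
        have "e' * C \<le> e' * (C + 1)"
          using e' by (intro mult_left_mono) auto
        also have "\<dots> = e"
          using C by (simp add: e'_def)
        finally show "e' * C \<le> e" .
      qed simp
      finally show "norm ((LINT y|S2. k z y *\<^sub>R \<phi> y) - (LINT y|S2. k x y *\<^sub>R \<phi> y) - D (z - x)) \<le> e * norm (z - x)" .
    qed
  qed
  ultimately show ?thesis
    unfolding has_derivative_at_alt D_def by blast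
qed

definition harmonic_on :: "(real^3) set \<Rightarrow> (real^3 \<Rightarrow> real) \<Rightarrow> bool" where
  "harmonic_on U w \<longleftrightarrow> (\<exists>g H. \<forall>x\<in>U. (w has_derivative (\<lambda>h. g x \<bullet> h)) (at x) \<and>
     (\<forall>b\<in>Basis. ((\<lambda>x. g x \<bullet> b) has_derivative (\<lambda>h. H b x \<bullet> h)) (at x)) \<and>
     (\<Sum>b\<in>Basis. H b x \<bullet> b) = 0)"

lemma harmonic_on_diff:
  assumes "harmonic_on U v" "harmonic_on U w"
  shows "harmonic_on U (\<lambda>x. v x - w x)"
proof -
  obtain g H where 1: "\<forall>x\<in>U. (v has_derivative (\<lambda>h. g x \<bullet> h)) (at x) \<and>
     (\<forall>b\<in>Basis. ((\<lambda>x. g x \<bullet> b) has_derivative (\<lambda>h. H b x \<bullet> h)) (at x)) \<and>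
     (\<Sum>b\<in>Basis. H b x \<bullet> b) = 0"
    using assms(1) unfolding harmonic_on_def by blast
  obtain g' H' where 2: "\<forall>x\<in>U. (w has_derivative (\<lambda>h. g' x \<bullet> h)) (at x) \<and>
     (\<forall>b\<in>Basis. ((\<lambda>x. g' x \<bullet> b) has_derivative (\<lambda>h. H' b x \<bullet> h)) (at x)) \<and>
     (\<Sum>b\<in>Basis. H' b x \<bullet> b) = 0"
    using assms(2) unfolding harmonic_on_def by blast
  show ?thesis
    unfolding harmonic_on_def
  proof (intro exI ballI conjI)
    fix x assume x: "x \<in> U"
    show "((\<lambda>x. v x - w x) has_derivative (\<lambda>h. (g x - g' x) \<bullet> h)) (at x)"
      using 1 2 x by (auto simp: inner_diff_left intro!: has_derivative_diff)
    show "((\<lambda>x. (g x - g' x) \<bullet> b) has_derivative (\<lambda>h. (H b x - H' b x) \<bullet> h)) (at x)" if "b \<in> Basis" for b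
      using 1 2 x that by (auto simp: inner_diff_left intro!: has_derivative_diff)
    show "(\<Sum>b\<in>Basis. (H b x - H' b x) \<bullet> b) = 0"
      using 1 2 x by (simp add: inner_diff_left sum_subtractf)
  qed
qed

lemma second_derivative_local_max:
  fixes f f' :: "real \<Rightarrow> real"
  assumes "0 < d" and f: "\<And>s. \<bar>s\<bar> < d \<Longrightarrow> (f has_real_derivative f' s) (at s)"
    and f': "(f' has_real_derivative l) (at 0)"
    and max: "\<And>s. \<bar>s\<bar> < d \<Longrightarrow> f s \<le> f 0"
  shows "l \<le> 0"
proof (rule ccontr)
  assume "\<not> l \<le> 0"
  then obtain e where e: "0 < e" "\<And>h. 0 < h \<Longrightarrow> h < e \<Longrightarrow> f' 0 < f' h"
    using DERIV_pos_inc_right[OF f'] by auto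
  have "f' 0 = 0"
    by (rule DERIV_local_max[OF f[of 0] \<open>0 < d\<close>]) (use assms in auto)
  define s where "s = min d e / 2"
  have s: "0 < s" "s < d" "s < e"
    using \<open>0 < d\<close> \<open>0 < e\<close> by (auto simp: s_def)
  obtain z where z: "0 < z" "z < s" "f s - f 0 = (s - 0) * f' z"
    using MVT2[OF s(1), of f f'] f s by auto
  have "0 < f' z"
    using e(2)[of z] z s \<open>f' 0 = 0\<close> by simp
  then have "0 < s * f' z"
    using s by (intro mult_pos_pos)
  then have "f 0 < f s"
    using z by simp
  with max[of s] s show False by simp
qed

lemma has_real_derivative_along_line:
  fixes w :: "'a::real_inner \<Rightarrow> real"
  assumes "(w has_derivative (\<lambda>h. g \<bullet> h)) (at (z + s *\<^sub>R b))"
  shows "((\<lambda>s. w (z + s *\<^sub>R b)) has_real_derivative g \<bullet> b) (at s)"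
proof -
  have "((\<lambda>s. z + s *\<^sub>R b) has_derivative (\<lambda>h. h *\<^sub>R b)) (at s)"
    by (auto intro!: derivative_eq_intros)
  from has_derivative_compose[OF this assms] show ?thesis
    by (simp add: has_field_derivative_def mult_commute_abs)
qed

lemma harmonic_on_max_principle:
  assumes w: "harmonic_on (ball 0 1) w" and r: "0 < r" "r < 1"
    and bd: "\<And>x. norm x = r \<Longrightarrow> w x \<le> M" and x: "norm x \<le> r"
  shows "w x \<le> M"
proof -
  obtain g H where gH: "\<forall>x\<in>ball 0 1. (w has_derivative (\<lambda>h. g x \<bullet> h)) (at x) \<and>
     (\<forall>b\<in>Basis. ((\<lambda>x. g x \<bullet> b) has_derivative (\<lambda>h. H b x \<bullet> h)) (at x)) \<and>
     (\<Sum>b\<in>Basis. H b x \<bullet> b) = 0"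
    using w unfolding harmonic_on_def by blast
  then have w': "\<And>x. x \<in> ball 0 1 \<Longrightarrow> (w has_derivative (\<lambda>h. g x \<bullet> h)) (at x)"
     and g: "\<And>x b. x \<in> ball 0 1 \<Longrightarrow> b \<in> Basis \<Longrightarrow> ((\<lambda>x. g x \<bullet> b) has_derivative (\<lambda>h. H b x \<bullet> h)) (at x)"
     and tr: "\<And>x. x \<in> ball 0 1 \<Longrightarrow> (\<Sum>b\<in>Basis. H b x \<bullet> b) = 0"
    by blast+
  have "w x \<le> M + e" if "0 < e" for e
  proof -
    define v where "v x = w x + e * (x \<bullet> x)" for x
    have "continuous_on (cball 0 r) w"
      using r by (intro continuous_at_imp_continuous_on ballI has_derivative_continuous[OF w']) auto
    then have "continuous_on (cball 0 r) v"
      unfolding v_def by (intro continuous_intros)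
    then obtain z where z: "z \<in> cball 0 r" and max: "\<And>y. y \<in> cball 0 r \<Longrightarrow> v y \<le> v z"
      using continuous_attains_sup[of "cball 0 r" v] r by auto
    have "norm z = r"
    proof (rule ccontr)
      assume "norm z \<noteq> r"
      then have nz: "norm z < r"
        using z by simp
      have le: "H b z \<bullet> b + 2 * e \<le> 0" if b: "b \<in> Basis" for b
      proof (rule second_derivative_local_max[of "r - norm z" "\<lambda>s. v (z + s *\<^sub>R b)"
            "\<lambda>s. g (z + s *\<^sub>R b) \<bullet> b + 2 * e * ((z + s *\<^sub>R b) \<bullet> b)"])
        have inb: "norm (z + s *\<^sub>R b) < r" if "\<bar>s\<bar> < r - norm z" for s
          using norm_triangle_ineq[of z "s *\<^sub>R b"] that b by simp
        show "0 < r - norm z" using nz by simp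
        show "((\<lambda>s. v (z + s *\<^sub>R b)) has_real_derivative
            g (z + s *\<^sub>R b) \<bullet> b + 2 * e * ((z + s *\<^sub>R b) \<bullet> b)) (at s)" if "\<bar>s\<bar> < r - norm z" for s
        proof -
          have "z + s *\<^sub>R b \<in> ball 0 1"
            using inb[OF that] r by simp
          from has_real_derivative_along_line[OF w'[OF this]]
          have "((\<lambda>s. w (z + s *\<^sub>R b)) has_real_derivative g (z + s *\<^sub>R b) \<bullet> b) (at s)" .
          moreover have "((\<lambda>s. (z + s *\<^sub>R b) \<bullet> (z + s *\<^sub>R b)) has_real_derivative 2 * ((z + s *\<^sub>R b) \<bullet> b)) (at s)"
            unfolding has_field_derivative_def
            by (auto intro!: derivative_eq_intros simp: fun_eq_iff inner_commute algebra_simps)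
          ultimately show ?thesis
            unfolding v_def by (auto intro!: derivative_eq_intros)
        qed
        have "z \<in> ball 0 1"
          using nz r by simp
        then have "((\<lambda>x. g x \<bullet> b) has_derivative (\<lambda>h. H b z \<bullet> h)) (at (z + 0 *\<^sub>R b))"
          using g[of z b] b by simp
        from has_real_derivative_along_line[OF this]
        have "((\<lambda>s. g (z + s *\<^sub>R b) \<bullet> b) has_real_derivative H b z \<bullet> b) (at 0)" .
        moreover have "((\<lambda>s. (z + s *\<^sub>R b) \<bullet> b) has_real_derivative 1) (at 0)"
          unfolding has_field_derivative_def
          using b by (auto intro!: derivative_eq_intros simp: fun_eq_iff)
        ultimately show "((\<lambda>s. g (z + s *\<^sub>R b) \<bullet> b + 2 * e * ((z + s *\<^sub>R b) \<bullet> b)) has_real_derivative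
            H b z \<bullet> b + 2 * e) (at 0)"
          by (auto intro!: derivative_eq_intros)
        show "v (z + s *\<^sub>R b) \<le> v (z + 0 *\<^sub>R b)" if "\<bar>s\<bar> < r - norm z" for s
          using max[of "z + s *\<^sub>R b"] inb[OF that] by simp
      qed
      have "(\<Sum>b\<in>(Basis::(real^3) set). H b z \<bullet> b + 2 * e) \<le> 0"
        by (rule sum_nonpos) (rule le)
      moreover have "(\<Sum>b\<in>(Basis::(real^3) set). H b z \<bullet> b + 2 * e) = 6 * e"
        using tr[of z] nz r by (simp add: sum.distrib)
      ultimately show False
        using \<open>0 < e\<close> by simp
    qed
    have "w x \<le> v x"
      using \<open>0 < e\<close> by (simp add: v_def)
    also have "\<dots> \<le> v z"
      using max[of x] x by simp
    also have "\<dots> \<le> M + e * 1"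
      unfolding v_def using bd[OF \<open>norm z = r\<close>] \<open>norm z = r\<close> r \<open>0 < e\<close>
      by (intro add_mono mult_left_mono) (auto simp: dot_square_norm power_le_one)
    finally show ?thesis by simp
  qed
  then show ?thesis
    by (rule field_le_epsilon)
qed


section \<open>The Poisson formula\<close>

lemma has_derivative_inverse_norm_power:
  fixes x y :: "'a::real_inner"
  assumes "x \<noteq> y"
  shows "((\<lambda>x. inverse (norm (x - y) ^ k)) has_derivative
    (\<lambda>h. - real k * ((x - y) \<bullet> h) * inverse (norm (x - y) ^ (k + 2)))) (at x)"
proof -
  have D: "norm (x - y) \<noteq> 0"
    using assms by simp
  have 1: "((\<lambda>t. inverse (t ^ k)) has_real_derivative - real k * inverse (t ^ (k + 1))) (at t)" if "t \<noteq> 0" for t :: real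
  proof -
    have "((\<lambda>t. inverse (t ^ k)) has_real_derivative - (inverse (t ^ k) * (real k * t ^ (k - 1)) * inverse (t ^ k))) (at t)"
      using that by (auto intro!: derivative_eq_intros)
    then show ?thesis
      by (rule DERIV_cong) (use that in \<open>cases k; simp add: field_simps\<close>)
  qed
  have "((\<lambda>x. norm (x - y)) has_derivative (\<lambda>h. sgn (x - y) \<bullet> h)) (at x)"
  proof -
    have "((\<lambda>x. x - y) has_derivative (\<lambda>h. h)) (at x)"
      by (auto intro!: derivative_eq_intros)
    moreover have "(norm has_derivative (\<lambda>h. sgn (x - y) \<bullet> h)) (at (x - y))"
      using has_derivative_norm[of "x - y"] assms by (simp add: inner_commute)
    ultimately show ?thesis
      by (rule has_derivative_compose)
  qed
  moreover have "sgn (x - y) \<bullet> h = ((x - y) \<bullet> h) / norm (x - y)" for h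
    by (simp add: sgn_div_norm divide_inverse)
  ultimately have "((\<lambda>x. norm (x - y)) has_derivative (\<lambda>h. ((x - y) \<bullet> h) / norm (x - y))) (at x)"
    by simp
  from DERIV_compose_FDERIV[OF 1[OF D] this] show ?thesis
    by (rule has_derivative_eq_rhs) (use D in \<open>auto simp: fun_eq_iff field_simps\<close>)
qed

text \<open>
  For a unit vector y, the Poisson kernel in this form is a derivative of the fundamental solution
  plus a multiple of it.
\<close>

definition poisson_ext :: "real^3 \<Rightarrow> real^3 \<Rightarrow> real" where
  "poisson_ext x y = - 2 * (y \<bullet> (x - y)) * inverse (norm (x - y) ^ 3) - inverse (norm (x - y) ^ 1)"

lemma poisson_ext_eq:
  assumes "norm x = 1" "norm y = 1" "0 < r" "r < 1"
  shows "poisson_ext (r *\<^sub>R x) y = 4 * pi * poisson r x y"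
proof -
  define D where "D = norm (r *\<^sub>R x - y)"
  have D: "D \<noteq> 0"
    using norm_scaled_diff_pos[of x y r] assms by (simp add: D_def)
  have "D\<^sup>2 = 1 + r\<^sup>2 - 2 * r * (x \<bullet> y)"
    using norm_scaled_diff_sq assms by (simp add: D_def)
  moreover have "y \<bullet> (r *\<^sub>R x - y) = r * (x \<bullet> y) - 1"
    using assms by (simp add: inner_diff_right inner_commute dot_square_norm)
  ultimately have "- 2 * (y \<bullet> (r *\<^sub>R x - y)) - D\<^sup>2 = 1 - r\<^sup>2"
    by simp
  moreover have "poisson_ext (r *\<^sub>R x) y = (- 2 * (y \<bullet> (r *\<^sub>R x - y)) - D\<^sup>2) / D ^ 3"
    unfolding poisson_ext_def D_def[symmetric] using D
    by (simp add: field_simps power2_eq_square power3_eq_cube)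
  ultimately show ?thesis
    by (simp add: poisson_def D_def)
qed

definition poisson_grad :: "real^3 \<Rightarrow> real^3 \<Rightarrow> real^3" where
  "poisson_grad x y = (- 2 * inverse (norm (x - y) ^ 3)) *\<^sub>R y +
     (6 * (y \<bullet> (x - y)) * inverse (norm (x - y) ^ 5) + inverse (norm (x - y) ^ 3)) *\<^sub>R (x - y)"

definition poisson_hess :: "real^3 \<Rightarrow> real^3 \<Rightarrow> real^3 \<Rightarrow> real^3" where
  "poisson_hess b x y = (6 * ((x - y) \<bullet> b) * inverse (norm (x - y) ^ 5)) *\<^sub>R y +
     (6 * (y \<bullet> (x - y)) * inverse (norm (x - y) ^ 5) + inverse (norm (x - y) ^ 3)) *\<^sub>R b +
     (6 * (y \<bullet> b) * inverse (norm (x - y) ^ 5)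
      - 30 * (y \<bullet> (x - y)) * ((x - y) \<bullet> b) * inverse (norm (x - y) ^ 7)
      - 3 * ((x - y) \<bullet> b) * inverse (norm (x - y) ^ 5)) *\<^sub>R (x - y)"

lemma has_derivative_poisson_ext:
  assumes "x \<noteq> y"
  shows "((\<lambda>x. poisson_ext x y) has_derivative (\<lambda>h. poisson_grad x y \<bullet> h)) (at x)"
proof -
  note dI = has_derivative_inverse_norm_power[OF assms]
  have "((\<lambda>x. y \<bullet> (x - y)) has_derivative (\<lambda>h. y \<bullet> h)) (at x)"
    by (auto intro!: derivative_eq_intros)
  from has_derivative_diff[OF has_derivative_mult[OF has_derivative_mult_right[OF this, of "-2"] dI[of 3]] dI[of 1]]
  show ?thesis
    unfolding poisson_ext_def
    by (rule has_derivative_eq_rhs) (simp add: poisson_grad_def fun_eq_iff inner_simps power3_eq_cube algebra_simps)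
qed

lemma has_derivative_poisson_grad:
  assumes "x \<noteq> y"
  shows "((\<lambda>x. poisson_grad x y \<bullet> b) has_derivative (\<lambda>h. poisson_hess b x y \<bullet> h)) (at x)"
proof -
  note dI = has_derivative_inverse_norm_power[OF assms]
  have d1: "((\<lambda>x. y \<bullet> (x - y)) has_derivative (\<lambda>h. y \<bullet> h)) (at x)"
    by (auto intro!: derivative_eq_intros)
  have d2: "((\<lambda>x. (x - y) \<bullet> b) has_derivative (\<lambda>h. h \<bullet> b)) (at x)"
    by (auto intro!: derivative_eq_intros)
  have eq: "poisson_grad x y \<bullet> b = (- 2 * (y \<bullet> b)) * inverse (norm (x - y) ^ 3) +
     (6 * (y \<bullet> (x - y)) * inverse (norm (x - y) ^ 5) + inverse (norm (x - y) ^ 3)) * ((x - y) \<bullet> b)" for x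
    by (simp add: poisson_grad_def inner_simps)
  from has_derivative_add[OF has_derivative_mult_right[OF dI[of 3], of "- 2 * (y \<bullet> b)"]
      has_derivative_mult[OF has_derivative_add[OF has_derivative_mult[OF has_derivative_mult_right[OF d1, of 6] dI[of 5]] dI[of 3]] d2]]
  show ?thesis
    unfolding eq
    by (rule has_derivative_eq_rhs)
       (simp add: poisson_hess_def fun_eq_iff inner_add_left inner_commute[of b] algebra_simps)
qed

lemma trace_poisson_hess:
  assumes "x \<noteq> y"
  shows "(\<Sum>b\<in>Basis. poisson_hess b x y \<bullet> b) = 0"
proof -
  define d where "d = x - y"
  have d: "norm d \<noteq> 0"
    using assms by (simp add: d_def)
  have i: "(d \<bullet> d) * inverse (norm d ^ 7) = inverse (norm d ^ 5)"
          "(d \<bullet> d) * inverse (norm d ^ 5) = inverse (norm d ^ 3)"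
    using d by (simp_all add: dot_square_norm field_simps flip: power_add)
  have "poisson_hess b x y \<bullet> b = (12 * inverse (norm d ^ 5)) * ((y \<bullet> b) * (d \<bullet> b)) +
     (6 * (y \<bullet> d) * inverse (norm d ^ 5) + inverse (norm d ^ 3)) * (b \<bullet> b) +
     (- 30 * (y \<bullet> d) * inverse (norm d ^ 7) - 3 * inverse (norm d ^ 5)) * ((d \<bullet> b) * (d \<bullet> b))" for b
    unfolding poisson_hess_def d_def[symmetric] by (simp add: inner_add_left algebra_simps)
  then have "(\<Sum>b\<in>(Basis::(real^3) set). poisson_hess b x y \<bullet> b) = (12 * inverse (norm d ^ 5)) * (y \<bullet> d) +
     (6 * (y \<bullet> d) * inverse (norm d ^ 5) + inverse (norm d ^ 3)) * 3 +
     (- 30 * (y \<bullet> d) * inverse (norm d ^ 7) - 3 * inverse (norm d ^ 5)) * (d \<bullet> d)"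
    by (simp add: sum.distrib euclidean_inner[of y d] euclidean_inner[of d d] flip: sum_distrib_left)
  also have "\<dots> = 0"
    using i by algebra
  finally show ?thesis .
qed

lemma harmonic_on_poisson_integral:
  fixes q :: "real^3 \<Rightarrow> real"
  assumes q: "continuous_on (sphere 0 1) q"
  shows "harmonic_on (ball 0 1) (\<lambda>x. LINT y|S2. poisson_ext x y * q y)"
proof -
  have neq: "x \<noteq> y" if "norm x < 1" "norm y = 1" for x y :: "real^3"
    using that by auto
  define I where "I k z = inverse (norm (fst z - snd z) ^ k)" for k and z :: "(real^3) \<times> (real^3)"
  have cd: "continuous_on (ball 0 1 \<times> sphere 0 1) (I k)" for k
    unfolding I_def by (intro continuous_intros) (use neq in auto)
  have cg: "continuous_on (ball 0 1 \<times> sphere 0 1) (\<lambda>(x, y). poisson_grad x y)"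
    unfolding poisson_grad_def case_prod_beta I_def[symmetric] by (intro continuous_intros cd)
  have ch: "continuous_on (ball 0 1 \<times> sphere 0 1) (\<lambda>(x, y). poisson_hess b x y)" for b
    unfolding poisson_hess_def case_prod_beta I_def[symmetric] by (intro continuous_intros cd)
  have ck: "continuous_on (ball 0 1 \<times> sphere 0 1) (\<lambda>(x, y). poisson_ext x y)"
    unfolding poisson_ext_def case_prod_beta I_def[symmetric] by (intro continuous_intros cd)
  have slice: "continuous_on (sphere 0 1) (f x)"
    if "continuous_on (ball 0 1 \<times> sphere 0 1) (\<lambda>(x, y). f x y)" "x \<in> ball 0 1" for x and f :: "real^3 \<Rightarrow> real^3 \<Rightarrow> 'b::topological_space"
  proof -
    have "continuous_on (sphere 0 1) (\<lambda>y. (\<lambda>(x, y). f x y) (x, y))"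
      by (rule continuous_on_compose2[OF that(1)]) (use that(2) in \<open>auto intro!: continuous_intros\<close>)
    then show ?thesis by simp
  qed
  have ig: "integrable S2 (\<lambda>y. q y *\<^sub>R poisson_grad x y)" if "x \<in> ball 0 1" for x
    by (intro integrable_S2_continuous continuous_intros q slice[OF cg that])
  have ih: "integrable S2 (\<lambda>y. q y *\<^sub>R poisson_hess b x y)" if "x \<in> ball 0 1" for b x
    by (intro integrable_S2_continuous continuous_intros q slice[OF ch that])
  show ?thesis
    unfolding harmonic_on_def
  proof (intro exI ballI conjI)
    fix x :: "real^3" assume x: "x \<in> ball 0 1"
    have "((\<lambda>x. LINT y|S2. poisson_ext x y *\<^sub>R q y) has_derivative
        (\<lambda>h. LINT y|S2. (poisson_grad x y \<bullet> h) *\<^sub>R q y)) (at x)"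
      by (rule has_derivative_sphere_integral[OF open_ball x _ cg slice[OF ck] integrable_S2_continuous[OF q]])
         (use neq in \<open>auto intro!: has_derivative_poisson_ext\<close>)
    moreover have "(LINT y|S2. (poisson_grad x y \<bullet> h) *\<^sub>R q y) = (LINT y|S2. q y *\<^sub>R poisson_grad x y) \<bullet> h" for h
      using ig[OF x] by (subst integral_inner_left[symmetric]) (auto simp: mult.commute)
    ultimately show "((\<lambda>x. LINT y|S2. poisson_ext x y * q y) has_derivative
        (\<lambda>h. (LINT y|S2. q y *\<^sub>R poisson_grad x y) \<bullet> h)) (at x)"
      by simp
    show "((\<lambda>x. (LINT y|S2. q y *\<^sub>R poisson_grad x y) \<bullet> b) has_derivative
        (\<lambda>h. (LINT y|S2. q y *\<^sub>R poisson_hess b x y) \<bullet> h)) (at x)" if "b \<in> Basis" for b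
    proof -
      have "((\<lambda>x. LINT y|S2. (poisson_grad x y \<bullet> b) *\<^sub>R q y) has_derivative
          (\<lambda>h. LINT y|S2. (poisson_hess b x y \<bullet> h) *\<^sub>R q y)) (at x)"
        by (rule has_derivative_sphere_integral[OF open_ball x _ ch _ integrable_S2_continuous[OF q]])
           (use neq in \<open>auto intro!: has_derivative_poisson_grad continuous_intros slice[OF cg]\<close>)
      moreover have "(LINT y|S2. (poisson_hess b x y \<bullet> h) *\<^sub>R q y) = (LINT y|S2. q y *\<^sub>R poisson_hess b x y) \<bullet> h" for h
        using ih[OF x] by (subst integral_inner_left[symmetric]) (auto simp: mult.commute)
      moreover have "(LINT y|S2. (poisson_grad z y \<bullet> b) *\<^sub>R q y) = (LINT y|S2. q y *\<^sub>R poisson_grad z y) \<bullet> b"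
        if "z \<in> ball 0 1" for z
        using ig[OF that] by (subst integral_inner_left[symmetric]) (auto simp: mult.commute)
      ultimately show ?thesis
        using has_derivative_transform_within_open[OF _ open_ball x] by fastforce
    qed
    have "(\<Sum>b\<in>Basis. (LINT y|S2. q y *\<^sub>R poisson_hess b x y) \<bullet> b) =
        (\<Sum>b\<in>Basis. LINT y|S2. (q y *\<^sub>R poisson_hess b x y) \<bullet> b)"
      using ih[OF x] by (intro sum.cong refl integral_inner_left[symmetric]) auto
    also have "\<dots> = (LINT y|S2. (\<Sum>b\<in>Basis. (q y *\<^sub>R poisson_hess b x y) \<bullet> b))"
      by (intro Bochner_Integration.integral_sum[symmetric] integrable_inner_left ih x)
    also have "\<dots> = (LINT y|S2. 0)"
    proof (rule integral_S2_cong)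
      fix y :: "real^3" assume "norm y = 1"
      then have "(\<Sum>b\<in>Basis. poisson_hess b x y \<bullet> b) = 0"
        using x by (intro trace_poisson_hess neq) auto
      then show "(\<Sum>b\<in>Basis. (q y *\<^sub>R poisson_hess b x y) \<bullet> b) = 0"
        by (simp flip: sum_distrib_left)
    qed
    finally show "(\<Sum>b\<in>Basis. (LINT y|S2. q y *\<^sub>R poisson_hess b x y) \<bullet> b) = 0"
      by simp
  qed
qed

lemma poisson_formula_harmonic:
  fixes p :: "real^3 \<Rightarrow> real"
  assumes p: "harmonic_on (ball 0 1) p" and cp: "continuous_on (cball 0 1) p"
    and x: "norm x = 1" and r: "0 < r" "r < 1"
  shows "(LINT y|S2. poisson r x y * p y) = p (r *\<^sub>R x)"
proof -
  have cps: "continuous_on (sphere 0 1) p"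
    by (rule continuous_on_subset[OF cp]) auto
  define u where "u z = (LINT y|S2. poisson_ext z y * (p y / (4 * pi)))" for z
  have u_eq: "u (s *\<^sub>R z) = (LINT y|S2. poisson s z y *\<^sub>R p y)" if "norm z = 1" "0 < s" "s < 1" for s z
    unfolding u_def using that
    by (intro Bochner_Integration.integral_cong) (auto simp: poisson_ext_eq)
  have "harmonic_on (ball 0 1) u"
    unfolding u_def by (intro harmonic_on_poisson_integral continuous_intros cps) auto
  then have h: "harmonic_on (ball 0 1) (\<lambda>z. u z - p z)" "harmonic_on (ball 0 1) (\<lambda>z. p z - u z)"
    using p by (auto intro: harmonic_on_diff)
  have "\<bar>u (r *\<^sub>R x) - p (r *\<^sub>R x)\<bar> \<le> 0 + e" if "0 < e" for e
  proof -
    obtain r0 where r0: "0 < r0" "r0 < 1"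
      and close: "\<And>s z. r0 < s \<Longrightarrow> s < 1 \<Longrightarrow> norm z = 1 \<Longrightarrow>
         norm ((LINT y|S2. poisson s z y *\<^sub>R p y) - p z) \<le> e / 2"
      using poisson_approximate_identity[OF cps, of "e / 2"] \<open>0 < e\<close> by auto
    have "uniformly_continuous_on (cball 0 1) p"
      by (rule compact_uniformly_continuous[OF cp]) simp
    then have "\<exists>\<eta>>0. \<forall>a\<in>cball 0 1. \<forall>b\<in>cball 0 1. norm (b - a) < \<eta> \<longrightarrow> \<bar>p b - p a\<bar> < e / 2"
      unfolding uniformly_continuous_on_def dist_norm real_norm_def using \<open>0 < e\<close> half_gt_zero by blast
    then obtain \<eta> where \<eta>: "0 < \<eta>" and
      pc: "\<And>a b. norm a \<le> 1 \<Longrightarrow> norm b \<le> 1 \<Longrightarrow> norm (b - a) < \<eta> \<Longrightarrow> \<bar>p b - p a\<bar> < e / 2"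
      by auto
    define m where "m = Max {r0, r, 1 - \<eta>}"
    have m: "r0 \<le> m" "r \<le> m" "1 - \<eta> \<le> m" "m < 1"
      using r0 r \<eta> by (auto simp: m_def)
    define s where "s = (1 + m) / 2"
    have s: "r0 < s" "r < s" "1 - s < \<eta>" "s < 1" "0 < s"
      using r0 r \<eta> m by (auto simp: s_def field_simps)
    have bd: "\<bar>u z - p z\<bar> \<le> e" if z: "norm z = s" for z
    proof -
      define z1 where "z1 = z /\<^sub>R s"
      have z1: "norm z1 = 1" "z = s *\<^sub>R z1"
        using z s by (simp_all add: z1_def)
      have "\<bar>u z - p z1\<bar> \<le> e / 2"
        using close[OF s(1,4) z1(1)] u_eq[OF z1(1) s(5,4)] z1 by simp
      moreover have "norm (z1 - z) = 1 - s"
        using z1 s by (simp add: z1 flip: scaleR_left_diff_distrib[of 1 s z1, simplified])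
      then have "\<bar>p z1 - p z\<bar> < e / 2"
        using pc[of z z1] z1 z s by simp
      ultimately show ?thesis by linarith
    qed
    have "norm (r *\<^sub>R x) \<le> s"
      using r s x by simp
    then have "u (r *\<^sub>R x) - p (r *\<^sub>R x) \<le> e" "p (r *\<^sub>R x) - u (r *\<^sub>R x) \<le> e"
      using harmonic_on_max_principle[OF h(1) s(5,4), of e] harmonic_on_max_principle[OF h(2) s(5,4), of e] bd
      by (auto simp: abs_le_iff)
    then show ?thesis by simp
  qed
  then have "\<bar>u (r *\<^sub>R x) - p (r *\<^sub>R x)\<bar> \<le> 0"
    by (rule field_le_epsilon)
  then show ?thesis
    using u_eq[OF x r] by simp
qed

lemma real_polynomial_function_gradient:
  fixes p :: "'a::euclidean_space \<Rightarrow> real"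
  assumes "real_polynomial_function p"
  shows "\<exists>g. (\<forall>x. (p has_derivative (\<lambda>h. g x \<bullet> h)) (at x)) \<and> (\<forall>b. real_polynomial_function (\<lambda>x. g x \<bullet> b))"
  using assms
proof induction
  case (linear f)
  have "adjoint f 1 \<bullet> h = f h" for h
    using adjoint_works[OF bounded_linear.linear[OF linear], of h 1] by (simp add: inner_commute)
  then show ?case
    using bounded_linear_imp_has_derivative[OF linear]
    by (intro exI[of _ "\<lambda>_. adjoint f 1"]) (auto intro: real_polynomial_function.intros(2))
next
  case (const c)
  then show ?case
    by (intro exI[of _ "\<lambda>_. 0"]) (auto intro: real_polynomial_function.intros(2))
next
  case (add f1 f2)
  then obtain g1 g2 where "\<forall>x. (f1 has_derivative (\<lambda>h. g1 x \<bullet> h)) (at x)" "\<forall>b. real_polynomial_function (\<lambda>x. g1 x \<bullet> b)"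
    "\<forall>x. (f2 has_derivative (\<lambda>h. g2 x \<bullet> h)) (at x)" "\<forall>b. real_polynomial_function (\<lambda>x. g2 x \<bullet> b)"
    by blast
  then show ?case
    by (intro exI[of _ "\<lambda>x. g1 x + g2 x"])
       (auto simp: inner_add_left intro!: real_polynomial_function.intros(3) has_derivative_add)
next
  case (mult f1 f2)
  then obtain g1 g2 where g: "\<And>x. (f1 has_derivative (\<lambda>h. g1 x \<bullet> h)) (at x)" "\<And>b. real_polynomial_function (\<lambda>x. g1 x \<bullet> b)"
    "\<And>x. (f2 has_derivative (\<lambda>h. g2 x \<bullet> h)) (at x)" "\<And>b. real_polynomial_function (\<lambda>x. g2 x \<bullet> b)"
    by blast
  have "((\<lambda>x. f1 x * f2 x) has_derivative (\<lambda>h. (f1 x *\<^sub>R g2 x + f2 x *\<^sub>R g1 x) \<bullet> h)) (at x)" for x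
    using has_derivative_mult[OF g(1)[of x] g(3)[of x]]
    by (rule has_derivative_eq_rhs) (simp add: fun_eq_iff inner_add_left algebra_simps)
  moreover have "real_polynomial_function (\<lambda>x. (f1 x *\<^sub>R g2 x + f2 x *\<^sub>R g1 x) \<bullet> b)" for b
    using g mult.hyps
    by (auto simp: inner_add_left intro!: real_polynomial_function.intros(3) real_polynomial_function.intros(4))
  ultimately show ?case
    by (intro exI[of _ "\<lambda>x. f1 x *\<^sub>R g2 x + f2 x *\<^sub>R g1 x"]) auto
qed

lemma harmonic_on_compose_polynomial:
  fixes p :: "real^3 \<Rightarrow> complex" and L :: "complex \<Rightarrow> real"
  assumes p: "polynomial_function p" and lap: "\<And>x. laplacian p x = 0" and L: "bounded_linear L"
  shows "harmonic_on U (\<lambda>x. L (p x))"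
proof -
  have poly: "real_polynomial_function (\<lambda>x. L' (p x))" if "bounded_linear L'" for L'
    using p that by (simp add: polynomial_function_def o_def)
  have dp: "(p has_derivative frechet_derivative p (at x)) (at x)" for x
    using differentiable_at_polynomial_function[OF p] frechet_derivative_works by blast
  have grad: "\<exists>g. (\<forall>x h. L' (frechet_derivative p (at x) h) = g x \<bullet> h) \<and>
      (\<forall>b. real_polynomial_function (\<lambda>x. g x \<bullet> b))" if L': "bounded_linear L'" for L'
  proof -
    obtain g where g: "\<And>x. ((\<lambda>x. L' (p x)) has_derivative (\<lambda>h. g x \<bullet> h)) (at x)"
      "\<And>b. real_polynomial_function (\<lambda>x. g x \<bullet> b)"
      using real_polynomial_function_gradient[OF poly[OF L']] by blast
    have "(\<lambda>h. L' (frechet_derivative p (at x) h)) = (\<lambda>h. g x \<bullet> h)" for x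
      by (rule has_derivative_unique[OF bounded_linear.has_derivative[OF L' dp] g(1)])
    with g(2) show ?thesis by metis
  qed
  have poly2: "polynomial_function (\<lambda>x. frechet_derivative p (at x) b)" for b
    unfolding polynomial_function_def o_def
  proof (intro allI impI)
    fix L' :: "complex \<Rightarrow> real" assume "bounded_linear L'"
    then obtain g where "\<forall>x h. L' (frechet_derivative p (at x) h) = g x \<bullet> h"
      "\<forall>b. real_polynomial_function (\<lambda>x. g x \<bullet> b)"
      using grad by blast
    then show "real_polynomial_function (\<lambda>x. L' (frechet_derivative p (at x) b))"
      by simp
  qed
  obtain g where g: "\<And>x h. L (frechet_derivative p (at x) h) = g x \<bullet> h"
    "\<And>b. real_polynomial_function (\<lambda>x. g x \<bullet> b)"
    using grad[OF L] by blast
  have "\<exists>H. \<forall>x. ((\<lambda>x. g x \<bullet> b) has_derivative (\<lambda>h. H x \<bullet> h)) (at x)" for b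
    using real_polynomial_function_gradient[OF g(2)] by blast
  then obtain H where H: "\<And>b x. ((\<lambda>x. g x \<bullet> b) has_derivative (\<lambda>h. H b x \<bullet> h)) (at x)"
    by metis
  show ?thesis
    unfolding harmonic_on_def
  proof (intro exI ballI conjI)
    fix x
    show "((\<lambda>x. L (p x)) has_derivative (\<lambda>h. g x \<bullet> h)) (at x)"
      using bounded_linear.has_derivative[OF L dp[of x]] by (simp add: g)
    show "((\<lambda>x. g x \<bullet> b) has_derivative (\<lambda>h. H b x \<bullet> h)) (at x)" for b
      by (rule H)
    have "L (frechet_derivative (\<lambda>y. frechet_derivative p (at y) b) (at x) b) = H b x \<bullet> b" for b
    proof -
      have "((\<lambda>y. frechet_derivative p (at y) b) has_derivative
          frechet_derivative (\<lambda>y. frechet_derivative p (at y) b) (at x)) (at x)"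
        using differentiable_at_polynomial_function[OF poly2] frechet_derivative_works by blast
      from bounded_linear.has_derivative[OF L this]
      have "((\<lambda>y. g y \<bullet> b) has_derivative
          (\<lambda>h. L (frechet_derivative (\<lambda>y. frechet_derivative p (at y) b) (at x) h))) (at x)"
        by (simp add: g)
      from fun_cong[OF has_derivative_unique[OF this H]] show ?thesis .
    qed
    then have "(\<Sum>b\<in>Basis. H b x \<bullet> b) = L (laplacian p x)"
      unfolding laplacian_def by (simp add: linear_sum[OF bounded_linear.linear[OF L]])
    then show "(\<Sum>b\<in>Basis. H b x \<bullet> b) = 0"
      using lap linear_0[OF bounded_linear.linear[OF L]] by simp
  qed
qed

text \<open>
  The only consequence of harmonicity and homogeneity used from here on.
\<close>

definition poisson_eigenfunction :: "nat \<Rightarrow> (real^3 \<Rightarrow> complex) \<Rightarrow> bool" where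
  "poisson_eigenfunction n f \<longleftrightarrow> continuous_on (sphere 0 1) f \<and>
     (\<forall>r x. 0 < r \<longrightarrow> r < 1 \<longrightarrow> norm x = 1 \<longrightarrow> (LINT y|S2. poisson r x y *\<^sub>R f y) = r ^ n *\<^sub>R f x)"

lemma spherical_harmonic_poisson:
  assumes "spherical_harmonic n f"
  shows "poisson_eigenfunction n f"
proof -
  obtain p where p: "polynomial_function p" "\<And>c x. p (c *\<^sub>R x) = c ^ n *\<^sub>R p x"
    "\<And>x. laplacian p x = 0" and fp: "\<And>x. norm x = 1 \<Longrightarrow> f x = p x"
    using assms unfolding spherical_harmonic_def by auto
  have cp: "continuous_on A p" for A
    by (rule continuous_on_polymonial_function[OF p(1)])
  then have cf: "continuous_on (sphere 0 1) f"
    using fp by (subst continuous_on_cong[OF refl, of _ f p]) auto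
  have "(LINT y|S2. poisson r x y *\<^sub>R f y) = r ^ n *\<^sub>R f x" if r: "0 < r" "r < 1" and x: "norm x = 1" for r x
  proof -
    have int: "integrable S2 (\<lambda>y. poisson r x y *\<^sub>R f y)"
      by (intro integrable_S2_continuous continuous_intros cf continuous_on_poisson_snd r x)
    have *: "L (LINT y|S2. poisson r x y *\<^sub>R f y) = L (r ^ n *\<^sub>R f x)" if L: "bounded_linear L" for L :: "complex \<Rightarrow> real"
    proof -
      have "L (LINT y|S2. poisson r x y *\<^sub>R f y) = (LINT y|S2. L (poisson r x y *\<^sub>R f y))"
        by (rule integral_bounded_linear[OF L int, symmetric])
      also have "\<dots> = (LINT y|S2. poisson r x y * L (p y))"
        using fp by (intro Bochner_Integration.integral_cong)
          (auto simp: linear_cmul[OF bounded_linear.linear[OF L]])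
      also have "\<dots> = L (p (r *\<^sub>R x))"
        by (rule poisson_formula_harmonic[OF harmonic_on_compose_polynomial[OF p(1,3) L] _ x r])
           (rule continuous_on_compose2[OF linear_continuous_on[OF L] cp], auto)
      finally show ?thesis
        by (simp add: p(2) fp x)
    qed
    show ?thesis
      by (rule complex_eqI) (use *[OF bounded_linear_Re] *[OF bounded_linear_Im] in auto)
  qed
  with cf show ?thesis
    by (simp add: poisson_eigenfunction_def)
qed

lemma poisson_eigenfunction_cnj:
  assumes "poisson_eigenfunction n f"
  shows "poisson_eigenfunction n (\<lambda>x. cnj (f x))"
proof -
  have cf: "continuous_on (sphere 0 1) f"
    using assms by (simp add: poisson_eigenfunction_def)
  have "(LINT y|S2. poisson r x y *\<^sub>R cnj (f y)) = cnj (LINT y|S2. poisson r x y *\<^sub>R f y)" for r x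
  proof -
    have "poisson r x y *\<^sub>R cnj (f y) = cnj (poisson r x y *\<^sub>R f y)" for y
      by simp
    then show ?thesis
      by (simp only: Bochner_Integration.integral_cnj)
  qed
  then show ?thesis
    using assms by (auto simp: poisson_eigenfunction_def intro!: continuous_intros)
qed

lemma poisson_eigenfunction_1: "poisson_eigenfunction 0 (\<lambda>_. 1)"
proof -
  have "(LINT y|S2. poisson r x y *\<^sub>R (1::complex)) = 1" if "0 < r" "r < 1" "norm x = 1" for r x
    using integral_poisson[OF that] integrable_S2_continuous[OF continuous_on_poisson_snd[OF that]]
    by simp
  then show ?thesis
    by (simp add: poisson_eigenfunction_def)
qed


section \<open>Newton potentials of spherical harmonics\<close>

lemma Newton_potential_inside:
  assumes f: "poisson_eigenfunction n f" and x: "norm x = 1" and t: "0 < t" "t < 1"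
  shows "(LINT y|S2. (1 / norm (t *\<^sub>R x - y)) *\<^sub>R f y) = (4 * pi * t ^ n / (2 * real n + 1)) *\<^sub>R f x"
proof -
  have cf: "continuous_on (sphere 0 1) f"
    using f by (simp add: poisson_eigenfunction_def)
  have neq: "z \<noteq> y" if "norm z < 1" "norm y = 1" for z y :: "real^3"
    using that by auto
  define V where "V z = (LINT y|S2. inverse (norm (z - y) ^ 1) *\<^sub>R f y)" for z
  define V' where "V' z h = (LINT y|S2. ((- inverse (norm (z - y) ^ 3)) *\<^sub>R (z - y) \<bullet> h) *\<^sub>R f y)" for z h
  have dV: "(V has_derivative V' z) (at z)" if "z \<in> ball 0 1" for z
    unfolding V_def V'_def
  proof (rule has_derivative_sphere_integral[OF open_ball that _ _ _ integrable_S2_continuous[OF cf]])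
    fix z y :: "real^3" assume "z \<in> ball 0 1" "norm y = 1"
    then have "z \<noteq> y" using neq by auto
    from has_derivative_inverse_norm_power[OF this, of 1]
    show "((\<lambda>z. inverse (norm (z - y) ^ 1)) has_derivative (\<lambda>h. (- inverse (norm (z - y) ^ 3)) *\<^sub>R (z - y) \<bullet> h)) (at z)"
      by (rule has_derivative_eq_rhs) (simp add: fun_eq_iff power3_eq_cube)
  next
    show "continuous_on (ball 0 1 \<times> sphere 0 1) (\<lambda>(z, y). - inverse (norm (z - y) ^ 3) *\<^sub>R (z - y :: real^3))"
      unfolding case_prod_beta by (intro continuous_intros) (use neq in auto)
    show "continuous_on (sphere 0 1) (\<lambda>y. inverse (norm (z - y) ^ 1))" if "z \<in> ball 0 1" for z :: "real^3"
      using that by (intro continuous_intros) (use neq in auto)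
  qed
  define c where "c = 4 * pi / (2 * real n + 1)"
  define W where "W s = V (s *\<^sub>R x) - (c * s ^ n) *\<^sub>R f x" for s
  define W' where "W' s = V' (s *\<^sub>R x) x - (c * (real n * s ^ (n - 1))) *\<^sub>R f x" for s
  have dW: "(W has_vector_derivative W' s) (at s)" if "\<bar>s\<bar> < 1" for s
  proof -
    have "((\<lambda>s. s *\<^sub>R x) has_derivative (\<lambda>h. h *\<^sub>R x)) (at s)"
      by (auto intro!: derivative_eq_intros)
    from has_derivative_compose[OF this dV] that x
    have "((\<lambda>s. V (s *\<^sub>R x)) has_derivative (\<lambda>h. V' (s *\<^sub>R x) (h *\<^sub>R x))) (at s)"
      by simp
    moreover have "V' (s *\<^sub>R x) (h *\<^sub>R x) = h *\<^sub>R V' (s *\<^sub>R x) x" for h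
      unfolding V'_def inner_scaleR_right scaleR_scaleR[symmetric] by (rule integral_scaleR_right)
    ultimately have "((\<lambda>s. V (s *\<^sub>R x)) has_vector_derivative V' (s *\<^sub>R x) x) (at s)"
      by (simp add: has_vector_derivative_def)
    moreover have "((\<lambda>s. c * s ^ n) has_real_derivative c * (real n * s ^ (n - 1))) (at s)"
      by (auto intro!: derivative_eq_intros)
    then have "((\<lambda>s. (c * s ^ n) *\<^sub>R f x) has_vector_derivative (c * (real n * s ^ (n - 1))) *\<^sub>R f x) (at s)"
      by (rule has_vector_derivative_scaleR[OF _ has_vector_derivative_const, THEN has_vector_derivative_eq_rhs]) simp
    ultimately show ?thesis
      unfolding W_def W'_def by (rule has_vector_derivative_diff)
  qed
  text \<open>The Poisson kernel is, up to a constant, the image of the Newton kernel under 2 s d/ds + 1.\<close>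
  have ode: "(2 * s) *\<^sub>R W' s + W s = 0" if s: "0 < s" "s < 1" for s
  proof -
    have sx: "norm (s *\<^sub>R x) < 1"
      using s x by simp
    have int1: "integrable S2 (\<lambda>y. ((- inverse (norm (s *\<^sub>R x - y) ^ 3)) *\<^sub>R (s *\<^sub>R x - y) \<bullet> x) *\<^sub>R f y)"
      by (intro integrable_S2_continuous continuous_intros cf) (use neq[OF sx] in auto)
    have int2: "integrable S2 (\<lambda>y. inverse (norm (s *\<^sub>R x - y) ^ 1) *\<^sub>R f y)"
      by (intro integrable_S2_continuous continuous_intros cf) (use neq[OF sx] in auto)
    have "(2 * s) *\<^sub>R V' (s *\<^sub>R x) x + V (s *\<^sub>R x) =
      (LINT y|S2. (2 * s) *\<^sub>R (((- inverse (norm (s *\<^sub>R x - y) ^ 3)) *\<^sub>R (s *\<^sub>R x - y) \<bullet> x) *\<^sub>R f y) +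
         inverse (norm (s *\<^sub>R x - y) ^ 1) *\<^sub>R f y)"
      unfolding V'_def V_def
      by (subst Bochner_Integration.integral_add[OF integrable_scaleR_right[OF int1] int2])
         (simp only: Bochner_Integration.integral_scaleR_right)
    also have "\<dots> = (LINT y|S2. (4 * pi) *\<^sub>R (poisson s x y *\<^sub>R f y))"
    proof (rule integral_S2_cong)
      fix y :: "real^3" assume y: "norm y = 1"
      define D where "D = norm (s *\<^sub>R x - y)"
      have D: "0 < D"
        using norm_scaled_diff_pos[OF x y] s by (simp add: D_def)
      have D2: "D\<^sup>2 = 1 + s\<^sup>2 - 2 * s * (x \<bullet> y)"
        using norm_scaled_diff_sq[OF x y] by (simp add: D_def)
      have xx: "(s *\<^sub>R x - y) \<bullet> x = s - x \<bullet> y"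
        using x by (simp add: inner_diff_left inner_commute[of y x] dot_square_norm)
      have "2 * s * (- inverse (D ^ 3) * (s - x \<bullet> y)) + inverse (D ^ 1) = (D\<^sup>2 - 2 * s * (s - x \<bullet> y)) / D ^ 3"
        using D by (simp add: field_simps power2_eq_square power3_eq_cube)
      also have "D\<^sup>2 - 2 * s * (s - x \<bullet> y) = 1 - s\<^sup>2"
        unfolding D2 by (simp add: power2_eq_square algebra_simps)
      also have "(1 - s\<^sup>2) / D ^ 3 = 4 * pi * poisson s x y"
        by (simp add: poisson_def D_def)
      finally show "(2 * s) *\<^sub>R (((- inverse (norm (s *\<^sub>R x - y) ^ 3)) *\<^sub>R (s *\<^sub>R x - y) \<bullet> x) *\<^sub>R f y) +
         inverse (norm (s *\<^sub>R x - y) ^ 1) *\<^sub>R f y = (4 * pi) *\<^sub>R (poisson s x y *\<^sub>R f y)"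
        unfolding inner_scaleR_left xx D_def[symmetric] scaleR_scaleR scaleR_add_left[symmetric] by simp
    qed
    also have "\<dots> = (4 * pi) *\<^sub>R (s ^ n *\<^sub>R f x)"
      using f s x by (simp only: Bochner_Integration.integral_scaleR_right poisson_eigenfunction_def)
    finally have "(2 * s) *\<^sub>R V' (s *\<^sub>R x) x + V (s *\<^sub>R x) = (4 * pi * s ^ n) *\<^sub>R f x"
      by simp
    moreover have "2 * s * (c * (real n * s ^ (n - 1))) + c * s ^ n = 4 * pi * s ^ n"
    proof -
      have "s * (real n * s ^ (n - 1)) = real n * s ^ n"
        by (cases n) auto
      then have "2 * s * (c * (real n * s ^ (n - 1))) + c * s ^ n = (2 * real n + 1) * c * s ^ n"
        by (simp add: algebra_simps)
      then show ?thesis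
        by (simp add: c_def)
    qed
    moreover have "(2 * s) *\<^sub>R W' s + W s = ((2 * s) *\<^sub>R V' (s *\<^sub>R x) x + V (s *\<^sub>R x)) -
        (2 * s * (c * (real n * s ^ (n - 1))) + c * s ^ n) *\<^sub>R f x"
      by (simp add: W_def W'_def algebra_simps)
    ultimately show ?thesis by simp
  qed
  have "sqrt t *\<^sub>R W t = 0"
  proof (rule has_derivative_zero_unique_strong_interval[of "{0}" 0 t])
    show "continuous_on {0..t} (\<lambda>s. sqrt s *\<^sub>R W s)"
    proof (intro continuous_intros continuous_at_imp_continuous_on ballI)
      fix s assume "s \<in> {0..t}"
      then show "isCont W s"
        using dW[of s] t by (auto intro: has_vector_derivative_continuous)
    qed
    fix s assume s: "s \<in> {0..t} - {0}"
    then have s': "0 < s" "s < 1"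
      using t by auto
    have "((\<lambda>s. sqrt s *\<^sub>R W s) has_vector_derivative (sqrt s *\<^sub>R W' s + (inverse (sqrt s) / 2) *\<^sub>R W s)) (at s)"
      using s' by (intro has_vector_derivative_scaleR dW DERIV_real_sqrt) auto
    moreover have "sqrt s *\<^sub>R W' s + (inverse (sqrt s) / 2) *\<^sub>R W s = (inverse (sqrt s) / 2) *\<^sub>R ((2 * s) *\<^sub>R W' s + W s)"
      using s' by (simp add: scaleR_add_right field_simps)
    ultimately show "((\<lambda>s. sqrt s *\<^sub>R W s) has_derivative (\<lambda>h. 0)) (at s within {0..t})"
      using ode[OF s'] by (simp add: has_vector_derivative_def has_derivative_at_withinI)
  qed (use t in auto)
  then have "V (t *\<^sub>R x) = (c * t ^ n) *\<^sub>R f x"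
    using t by (simp add: W_def)
  then show ?thesis
    by (simp add: V_def c_def inverse_eq_divide)
qed

lemma integral_inverse_distance:
  assumes x: "norm x = 1" and t: "0 < t" "t < 1"
  shows "(LINT y|S2. 1 / norm (t *\<^sub>R x - y)) = 4 * pi"
proof -
  have "(LINT y|S2. 1 / norm (t *\<^sub>R x - y)) = (LINT y|S2. norm (t *\<^sub>R x - y) powr (-1))"
  proof (rule integral_S2_cong)
    fix y :: "real^3" assume "norm y = 1"
    then show "1 / norm (t *\<^sub>R x - y) = norm (t *\<^sub>R x - y) powr (-1)"
      using norm_scaled_diff_pos[OF x, of y t] t by (simp add: powr_minus_divide)
  qed
  also have "\<dots> = 4 * pi"
    using t x by (subst integral_distance_powr) auto
  finally show ?thesis .
qed

lemma continuous_on_inverse_distance: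
  assumes "norm x = 1" "0 < t" "t \<noteq> 1"
  shows "continuous_on (sphere 0 1) (\<lambda>y. 1 / norm (t *\<^sub>R x - y))"
  using norm_scaled_diff_pos[OF assms(1) _ assms(2,3)] by (intro continuous_intros) auto

definition boundary_radii :: "nat \<Rightarrow> real" where
  "boundary_radii k = 1 - inverse (real (Suc (Suc k)))"

lemma boundary_radii_bounds: "0 < boundary_radii k" "boundary_radii k < 1"
  by (auto simp: boundary_radii_def inverse_less_1_iff)

lemma boundary_radii_tendsto: "boundary_radii \<longlonglongrightarrow> 1"
proof -
  have "(\<lambda>k. 1 - inverse (real (Suc (Suc k)))) \<longlonglongrightarrow> 1 - 0"
    by (intro tendsto_intros LIMSEQ_Suc[OF LIMSEQ_inverse_real_of_nat])
  then show ?thesis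
    by (simp add: boundary_radii_def[abs_def])
qed

lemma inverse_distance_tendsto:
  assumes "y \<noteq> x"
  shows "(\<lambda>k. 1 / norm (boundary_radii k *\<^sub>R x - y)) \<longlonglongrightarrow> 1 / norm (x - y)"
proof -
  have "(\<lambda>k. 1 / norm (boundary_radii k *\<^sub>R x - y)) \<longlonglongrightarrow> 1 / norm (1 *\<^sub>R x - y)"
    using assms by (intro tendsto_intros boundary_radii_tendsto) auto
  then show ?thesis by simp
qed

lemma borel_measurable_id_S2 [measurable]: "(\<lambda>x. x) \<in> borel_measurable S2"
  by (rule measurable_sphere_measureI) simp

lemma integrable_inverse_distance:
  assumes x: "norm x = 1"
  shows "integrable S2 (\<lambda>y. 1 / norm (x - y))"
proof (rule integrableI_bounded)
  show "(\<lambda>y. 1 / norm (x - y)) \<in> borel_measurable S2"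
    by measurable
  have "(\<integral>\<^sup>+y. ennreal (norm (1 / norm (x - y))) \<partial>S2) =
      (\<integral>\<^sup>+y. liminf (\<lambda>k. ennreal (1 / norm (boundary_radii k *\<^sub>R x - y))) \<partial>S2)"
  proof (rule nn_integral_cong_AE)
    show "AE y in S2. ennreal (norm (1 / norm (x - y))) = liminf (\<lambda>k. ennreal (1 / norm (boundary_radii k *\<^sub>R x - y)))"
      using S2_singleton_null[of x]
    proof eventually_elim
      case (elim y)
      have "liminf (\<lambda>k. ennreal (1 / norm (boundary_radii k *\<^sub>R x - y))) = ennreal (1 / norm (x - y))"
        by (intro lim_imp_Liminf tendsto_ennrealI inverse_distance_tendsto elim) simp
      then show ?case by simp
    qed
  qed
  also have "\<dots> \<le> liminf (\<lambda>k. \<integral>\<^sup>+y. ennreal (1 / norm (boundary_radii k *\<^sub>R x - y)) \<partial>S2)"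
    by (rule nn_integral_liminf) measurable
  also have "(\<lambda>k. \<integral>\<^sup>+y. ennreal (1 / norm (boundary_radii k *\<^sub>R x - y)) \<partial>S2) = (\<lambda>k. ennreal (4 * pi))"
  proof
    fix k
    have "boundary_radii k \<noteq> 1" "0 < boundary_radii k"
      using boundary_radii_bounds[of k] by auto
    then have "integrable S2 (\<lambda>y. 1 / norm (boundary_radii k *\<^sub>R x - y))"
      by (intro integrable_S2_continuous continuous_on_inverse_distance x)
    then show "(\<integral>\<^sup>+y. ennreal (1 / norm (boundary_radii k *\<^sub>R x - y)) \<partial>S2) = ennreal (4 * pi)"
      by (subst nn_integral_eq_integral) (auto simp: integral_inverse_distance[OF x boundary_radii_bounds])
  qed
  also have "liminf (\<lambda>k::nat. ennreal (4 * pi)) < \<infinity>"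
    by (simp add: Liminf_const)
  finally show "(\<integral>\<^sup>+y. ennreal (norm (1 / norm (x - y))) \<partial>S2) < \<infinity>" .
qed

lemma Newton_potential_boundary:
  assumes f: "poisson_eigenfunction n f" and x: "norm x = 1"
  shows "(LINT y|S2. (1 / norm (x - y)) *\<^sub>R f y) = (4 * pi / (2 * real n + 1)) *\<^sub>R f x"
proof -
  have cf: "continuous_on (sphere 0 1) f"
    using f by (simp add: poisson_eigenfunction_def)
  have [measurable]: "f \<in> borel_measurable S2"
    by (rule borel_measurable_S2_continuous[OF cf])
  obtain B where B: "\<And>y. norm y = 1 \<Longrightarrow> norm (f y) \<le> B"
    using continuous_on_sphere_bounded[OF cf] by blast
  have "(\<lambda>k. LINT y|S2. (1 / norm (boundary_radii k *\<^sub>R x - y)) *\<^sub>R f y) \<longlonglongrightarrow> (LINT y|S2. (1 / norm (x - y)) *\<^sub>R f y)"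
  proof (rule integral_dominated_convergence)
    show "integrable S2 (\<lambda>y. 2 * B * (1 / norm (x - y)))"
      by (intro integrable_mult_right integrable_inverse_distance x)
    show "AE y in S2. (\<lambda>k. (1 / norm (boundary_radii k *\<^sub>R x - y)) *\<^sub>R f y) \<longlonglongrightarrow> (1 / norm (x - y)) *\<^sub>R f y"
      using S2_singleton_null[of x] by eventually_elim (intro tendsto_intros inverse_distance_tendsto)
    show "AE y in S2. norm ((1 / norm (boundary_radii k *\<^sub>R x - y)) *\<^sub>R f y) \<le> 2 * B * (1 / norm (x - y))" for k
      using S2_singleton_null[of x] AE_space
    proof eventually_elim
      case (elim y)
      then have y: "norm y = 1" by simp
      have "norm (x - y) \<le> norm (boundary_radii k *\<^sub>R x - y) + norm ((1 - boundary_radii k) *\<^sub>R x)"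
        using norm_triangle_ineq[of "boundary_radii k *\<^sub>R x - y" "(1 - boundary_radii k) *\<^sub>R x"] by (simp add: algebra_simps)
      moreover have "norm ((1 - boundary_radii k) *\<^sub>R x) = 1 - boundary_radii k"
        using boundary_radii_bounds[of k] x by simp
      moreover have "1 - boundary_radii k \<le> norm (boundary_radii k *\<^sub>R x - y)"
        using norm_triangle_ineq2[of y "boundary_radii k *\<^sub>R x"] boundary_radii_bounds[of k] x y by (simp add: norm_minus_commute)
      ultimately have "norm (x - y) \<le> 2 * norm (boundary_radii k *\<^sub>R x - y)"
        by simp
      moreover have "0 < norm (x - y)" "0 < norm (boundary_radii k *\<^sub>R x - y)"
        using elim norm_scaled_diff_pos[OF x y, of "boundary_radii k"] boundary_radii_bounds[of k] by auto
      ultimately have "1 / norm (boundary_radii k *\<^sub>R x - y) \<le> 2 * (1 / norm (x - y))"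
        by (simp add: field_simps)
      then have "1 / norm (boundary_radii k *\<^sub>R x - y) * norm (f y) \<le> 2 * (1 / norm (x - y)) * B"
        using B[OF y] by (intro mult_mono) auto
      then show ?case
        by (simp add: mult_ac)
    qed
  qed measurable
  moreover have "(\<lambda>k. LINT y|S2. (1 / norm (boundary_radii k *\<^sub>R x - y)) *\<^sub>R f y) \<longlonglongrightarrow> (4 * pi * 1 ^ n / (2 * real n + 1)) *\<^sub>R f x"
    unfolding Newton_potential_inside[OF f x boundary_radii_bounds] by (intro tendsto_intros boundary_radii_tendsto) auto
  ultimately show ?thesis
    using LIMSEQ_unique by fastforce
qed

definition radial_kernel :: "real \<Rightarrow> real^3 \<Rightarrow> real^3 \<Rightarrow> real" where
  "radial_kernel t x y = (t - x \<bullet> y) / (4 * pi * norm (t *\<^sub>R x - y) ^ 3)"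

lemma radial_kernel_commute:
  "norm x = 1 \<Longrightarrow> norm y = 1 \<Longrightarrow> radial_kernel t x y = radial_kernel t y x"
  by (simp add: radial_kernel_def norm_scaled_diff_commute inner_commute)

lemma radial_kernel_inside:
  assumes x: "norm x = 1" and y: "norm y = 1" and t: "0 < t" "t < 1"
  shows "radial_kernel t x y = 1 / (8 * pi * t) * (1 / norm (t *\<^sub>R x - y)) - 1 / (2 * t) * poisson t x y"
proof -
  define D where "D = norm (t *\<^sub>R x - y)"
  have D: "0 < D"
    using norm_scaled_diff_pos[OF x y] t by (simp add: D_def)
  have D2: "t - x \<bullet> y = (D\<^sup>2 - (1 - t\<^sup>2)) / (2 * t)"
    using norm_scaled_diff_sq[OF x y, of t] t by (simp add: D_def field_simps power2_eq_square)
  show ?thesis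
    unfolding radial_kernel_def poisson_def D_def[symmetric] D2 using D t
    by (simp add: field_simps power2_eq_square power3_eq_cube)
qed

lemma radial_kernel_boundary:
  assumes x: "norm x = 1" and y: "norm y = 1"
  shows "radial_kernel 1 x y = 1 / (8 * pi) * (1 / norm (x - y))"
proof (cases "x = y")
  case False
  define D where "D = norm (x - y)"
  have D: "0 < D"
    using False by (simp add: D_def)
  have D2: "1 - x \<bullet> y = D\<^sup>2 / 2"
    using norm_scaled_diff_sq[OF x y, of 1] by (simp add: D_def)
  show ?thesis
    unfolding radial_kernel_def D2 scaleR_one D_def[symmetric] using D
    by (simp add: field_simps power2_eq_square power3_eq_cube)
qed (simp add: radial_kernel_def)

lemma radial_kernel_outside:
  assumes x: "norm x = 1" and y: "norm y = 1" and s: "0 < s" "s < 1"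
  shows "radial_kernel (1 / s) x y = s\<^sup>2 * (1 / (4 * pi) * (1 / norm (s *\<^sub>R x - y)) - s * radial_kernel s x y)"
proof -
  define D where "D = norm (s *\<^sub>R x - y)"
  have D: "0 < D"
    using norm_scaled_diff_pos[OF x y] s by (simp add: D_def)
  have D2: "2 * s * (x \<bullet> y) = 1 + s\<^sup>2 - D\<^sup>2"
    using norm_scaled_diff_sq[OF x y, of s] by (simp add: D_def)
  have "(1 / s) *\<^sub>R x - y = (1 / s) *\<^sub>R (x - s *\<^sub>R y)"
    using s by (simp add: scaleR_diff_right)
  then have "norm ((1 / s) *\<^sub>R x - y) = norm (x - s *\<^sub>R y) / s"
    using s by simp
  also have "norm (x - s *\<^sub>R y) = D"
    using norm_scaled_diff_commute[OF x y, of s] by (simp add: D_def norm_minus_commute)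
  finally have D': "norm ((1 / s) *\<^sub>R x - y) = D / s" .
  have "radial_kernel (1 / s) x y = s\<^sup>2 * (1 - s * (x \<bullet> y)) / (4 * pi * D ^ 3)"
    unfolding radial_kernel_def D' using s D
    by (simp add: field_simps power2_eq_square power3_eq_cube)
  also have "1 - s * (x \<bullet> y) = D\<^sup>2 - s * (s - x \<bullet> y)"
    using D2 by (simp add: power2_eq_square algebra_simps)
  also have "s\<^sup>2 * (D\<^sup>2 - s * (s - x \<bullet> y)) / (4 * pi * D ^ 3) =
      s\<^sup>2 * (1 / (4 * pi) * (1 / D) - s * ((s - x \<bullet> y) / (4 * pi * D ^ 3)))"
    using D by (simp add: field_simps power2_eq_square power3_eq_cube)
  finally show ?thesis
    by (simp add: radial_kernel_def D_def)
qed

lemma continuous_on_radial_kernel: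
  assumes "0 < t" "t \<noteq> 1"
  shows "continuous_on (sphere 0 1 \<times> sphere 0 1) (\<lambda>(x, y). radial_kernel t x y)"
  unfolding radial_kernel_def case_prod_beta using norm_scaled_diff_pos[where r = t] assms
  by (intro continuous_intros) fastforce

lemma integrable_radial_kernel:
  assumes x: "norm x = 1" and t: "0 < t"
  shows "integrable S2 (radial_kernel t x)"
proof (cases "t = 1")
  case True
  have "integrable S2 (radial_kernel 1 x) \<longleftrightarrow> integrable S2 (\<lambda>y. 1 / (8 * pi) * (1 / norm (x - y)))"
    by (rule Bochner_Integration.integrable_cong) (auto simp: radial_kernel_boundary x)
  then show ?thesis
    using integrable_mult_right[OF integrable_inverse_distance[OF x], of "1 / (8 * pi)"] by (simp only: True)
next
  case False
  have "continuous_on (sphere 0 1) (\<lambda>y. (\<lambda>(x, y). radial_kernel t x y) (x, y))"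
    by (rule continuous_on_compose2[OF continuous_on_radial_kernel[OF t False]])
       (use x in \<open>auto intro!: continuous_intros\<close>)
  then show ?thesis
    by (intro integrable_S2_continuous) simp
qed

definition radial_eigenvalue :: "nat \<Rightarrow> real \<Rightarrow> real" where
  "radial_eigenvalue n t = (if t < 1 then - real n * t ^ n / (t * (2 * real n + 1))
     else if t = 1 then 1 / (2 * (2 * real n + 1))
     else (real n + 1) * (1 / t) ^ (n + 2) / (2 * real n + 1))"

lemma radial_kernel_eigenfunction:
  assumes f: "poisson_eigenfunction n f" and x: "norm x = 1" and t: "0 < t"
  shows "(LINT y|S2. radial_kernel t x y *\<^sub>R f y) = radial_eigenvalue n t *\<^sub>R f x"
proof -
  have cf: "continuous_on (sphere 0 1) f"
    using f by (simp add: poisson_eigenfunction_def)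
  have int1: "integrable S2 (\<lambda>y. (1 / norm (s *\<^sub>R x - y)) *\<^sub>R f y)" if "0 < s" "s < 1" for s
    using that by (intro integrable_S2_continuous continuous_on_scaleR continuous_on_inverse_distance cf x) auto
  have int2: "integrable S2 (\<lambda>y. poisson s x y *\<^sub>R f y)" if "0 < s" "s < 1" for s
    using that by (intro integrable_S2_continuous continuous_on_scaleR continuous_on_poisson_snd cf x)
  have int3: "integrable S2 (\<lambda>y. radial_kernel s x y *\<^sub>R f y)" if "0 < s" "s < 1" for s
  proof -
    have "integrable S2 (\<lambda>y. radial_kernel s x y *\<^sub>R f y) \<longleftrightarrow>
      integrable S2 (\<lambda>y. (1 / (8 * pi * s)) *\<^sub>R ((1 / norm (s *\<^sub>R x - y)) *\<^sub>R f y) - (1 / (2 * s)) *\<^sub>R (poisson s x y *\<^sub>R f y))"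
      by (rule Bochner_Integration.integrable_cong)
         (auto simp: radial_kernel_inside x that scaleR_diff_left)
    then show ?thesis
      using Bochner_Integration.integrable_diff[OF integrable_scaleR_right[OF int1[OF that]] integrable_scaleR_right[OF int2[OF that]]]
      by blast
  qed
  have inside: "(LINT y|S2. radial_kernel s x y *\<^sub>R f y) = (- real n * s ^ n / (s * (2 * real n + 1))) *\<^sub>R f x"
    if s: "0 < s" "s < 1" for s
  proof -
    have "(LINT y|S2. radial_kernel s x y *\<^sub>R f y) =
      (LINT y|S2. (1 / (8 * pi * s)) *\<^sub>R ((1 / norm (s *\<^sub>R x - y)) *\<^sub>R f y) - (1 / (2 * s)) *\<^sub>R (poisson s x y *\<^sub>R f y))"
      by (rule Bochner_Integration.integral_cong)
         (auto simp: radial_kernel_inside x s scaleR_diff_left)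
    also have "\<dots> = (1 / (8 * pi * s)) *\<^sub>R ((4 * pi * s ^ n / (2 * real n + 1)) *\<^sub>R f x) - (1 / (2 * s)) *\<^sub>R (s ^ n *\<^sub>R f x)"
      using int1[OF s] int2[OF s] f s x
      by (simp only: Bochner_Integration.integral_diff integrable_scaleR_right integral_scaleR_right
           Newton_potential_inside[OF f x s] poisson_eigenfunction_def)
    also have "\<dots> = (1 / (8 * pi * s) * (4 * pi * s ^ n / (2 * real n + 1)) - 1 / (2 * s) * s ^ n) *\<^sub>R f x"
      by (simp only: scaleR_scaleR scaleR_diff_left)
    also have "1 / (8 * pi * s) * (4 * pi * s ^ n / (2 * real n + 1)) - 1 / (2 * s) * s ^ n =
        - real n * s ^ n / (s * (2 * real n + 1))"
    proof -
      define N where "N = 2 * real n + 1"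
      have N: "0 < N" "real n = (N - 1) / 2" by (simp_all add: N_def)
      show ?thesis
        unfolding N_def[symmetric] N(2) using s N(1) by (simp add: field_simps)
    qed
    finally show ?thesis .
  qed
  consider "t < 1" | "t = 1" | "1 < t" by linarith
  then show ?thesis
  proof cases
    case 1
    then show ?thesis
      using inside[OF t] by (simp add: radial_eigenvalue_def)
  next
    case 2
    have "(LINT y|S2. radial_kernel 1 x y *\<^sub>R f y) = (LINT y|S2. (1 / (8 * pi)) *\<^sub>R ((1 / norm (x - y)) *\<^sub>R f y))"
      by (rule Bochner_Integration.integral_cong) (auto simp: radial_kernel_boundary x)
    also have "\<dots> = (1 / (8 * pi)) *\<^sub>R ((4 * pi / (2 * real n + 1)) *\<^sub>R f x)"
      by (simp only: integral_scaleR_right Newton_potential_boundary[OF f x])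
    also have "\<dots> = (1 / (2 * (2 * real n + 1))) *\<^sub>R f x"
      by (simp add: field_simps)
    finally show ?thesis
      using 2 by (simp add: radial_eigenvalue_def)
  next
    case 3
    define s where "s = 1 / t"
    have s: "0 < s" "s < 1"
      using 3 by (auto simp: s_def)
    have "(LINT y|S2. radial_kernel (1 / s) x y *\<^sub>R f y) = (LINT y|S2. (s\<^sup>2 / (4 * pi)) *\<^sub>R ((1 / norm (s *\<^sub>R x - y)) *\<^sub>R f y)
        - (s\<^sup>2 * s) *\<^sub>R (radial_kernel s x y *\<^sub>R f y))"
      by (rule Bochner_Integration.integral_cong)
         (auto simp: radial_kernel_outside x s algebra_simps)
    also have "\<dots> = (s\<^sup>2 / (4 * pi)) *\<^sub>R ((4 * pi * s ^ n / (2 * real n + 1)) *\<^sub>R f x) -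
        (s\<^sup>2 * s) *\<^sub>R ((- real n * s ^ n / (s * (2 * real n + 1))) *\<^sub>R f x)"
      using int1[OF s] int3[OF s]
      by (simp only: Bochner_Integration.integral_diff integrable_scaleR_right integral_scaleR_right
           Newton_potential_inside[OF f x s] inside[OF s])
    also have "\<dots> = (s\<^sup>2 / (4 * pi) * (4 * pi * s ^ n / (2 * real n + 1)) - s\<^sup>2 * s * (- real n * s ^ n / (s * (2 * real n + 1)))) *\<^sub>R f x"
      by (simp only: scaleR_scaleR scaleR_diff_left)
    also have "s\<^sup>2 / (4 * pi) * (4 * pi * s ^ n / (2 * real n + 1)) - s\<^sup>2 * s * (- real n * s ^ n / (s * (2 * real n + 1))) =
        (real n + 1) * s ^ (n + 2) / (2 * real n + 1)"
    proof -
      define N where "N = 2 * real n + 1"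
      have N: "0 < N" "real n = (N - 1) / 2" by (simp_all add: N_def)
      show ?thesis
        unfolding N_def[symmetric] N(2) using s N(1)
        by (simp add: field_simps power_add power2_eq_square)
    qed
    finally show ?thesis
      using 3 by (simp add: radial_eigenvalue_def s_def)
  qed
qed

lemma radial_kernel_bound:
  assumes t: "0 < t"
  obtains C where "\<And>x. norm x = 1 \<Longrightarrow> (LINT y|S2. \<bar>radial_kernel t x y\<bar>) \<le> C"
proof (cases "t = 1")
  case True
  have "(LINT y|S2. \<bar>radial_kernel 1 x y\<bar>) \<le> 1 / 2" if x: "norm x = 1" for x
  proof -
    have "(LINT y|S2. \<bar>radial_kernel 1 x y\<bar>) = (LINT y|S2. radial_kernel 1 x y)"
      by (rule Bochner_Integration.integral_cong) (auto simp: radial_kernel_boundary x)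
    moreover have "(LINT y|S2. radial_kernel 1 x y *\<^sub>R (1::complex)) = (1 / 2) *\<^sub>R 1"
      using radial_kernel_eigenfunction[OF poisson_eigenfunction_1 x, of 1] by (simp add: radial_eigenvalue_def)
    then have "(LINT y|S2. radial_kernel 1 x y) = 1 / 2"
      using integrable_radial_kernel[OF x, of 1] by (simp add: complex_eq_iff)
    ultimately show ?thesis by simp
  qed
  then show ?thesis
    using that True by blast
next
  case False
  have "compact ((\<lambda>(x, y). radial_kernel t x y) ` (sphere 0 1 \<times> sphere 0 1))"
    by (intro compact_continuous_image continuous_on_radial_kernel[OF t False] compact_Times compact_sphere)
  then obtain B where B: "\<forall>z\<in>(\<lambda>(x, y). radial_kernel t x y) ` (sphere 0 1 \<times> sphere 0 1). norm z \<le> B"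
    using compact_imp_bounded bounded_iff by blast
  have "(LINT y|S2. \<bar>radial_kernel t x y\<bar>) \<le> B * (4 * pi)" if x: "norm x = 1" for x
  proof -
    have "(LINT y|S2. \<bar>radial_kernel t x y\<bar>) \<le> (LINT y|S2. B)"
      using integrable_radial_kernel[OF x t] B x by (intro integral_mono) auto
    then show ?thesis
      by (simp add: measure_S2 mult.commute)
  qed
  then show ?thesis
    using that by blast
qed

lemma kernel_duality:
  fixes k :: "real^3 \<Rightarrow> real^3 \<Rightarrow> real" and \<phi> f :: "real^3 \<Rightarrow> complex"
  assumes km: "(\<lambda>(x, y). k x y) \<in> borel_measurable (S2 \<Otimes>\<^sub>M S2)"
    and sym: "\<And>x y. norm x = 1 \<Longrightarrow> norm y = 1 \<Longrightarrow> k x y = k y x"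
    and ki: "\<And>x. norm x = 1 \<Longrightarrow> integrable S2 (k x)"
    and kb: "\<And>x. norm x = 1 \<Longrightarrow> (LINT y|S2. \<bar>k x y\<bar>) \<le> C"
    and \<phi>: "integrable S2 \<phi>" and f: "continuous_on (sphere 0 1) f"
  shows "integrable S2 (\<lambda>x. (LINT y|S2. k x y *\<^sub>R \<phi> y) * f x)"
    and "(LINT x|S2. (LINT y|S2. k x y *\<^sub>R \<phi> y) * f x) = (LINT y|S2. \<phi> y * (LINT x|S2. k y x *\<^sub>R f x))"
proof -
  interpret pair_sigma_finite S2 S2 ..
  have [measurable]: "f \<in> borel_measurable S2" "\<phi> \<in> borel_measurable S2"
    using borel_measurable_S2_continuous[OF f] \<phi> by auto
  obtain B where "0 < B" and B: "\<And>x. norm x = 1 \<Longrightarrow> norm (f x) \<le> B"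
    using continuous_on_sphere_bounded[OF f] by blast
  have [measurable]: "(\<lambda>p. k (snd p) (fst p)) \<in> borel_measurable (S2 \<Otimes>\<^sub>M S2)"
    using measurable_compose[OF measurable_pair_swap' km] by (simp add: case_prod_beta)
  define h where "h y x = k x y *\<^sub>R \<phi> y * f x" for y x
  have hm [measurable]: "case_prod h \<in> borel_measurable (S2 \<Otimes>\<^sub>M S2)"
    unfolding h_def case_prod_beta by measurable
  have hy: "norm (h y x) \<le> norm (\<phi> y) * B * \<bar>k y x\<bar>" if "norm y = 1" "norm x = 1" for x y
  proof -
    have "norm (h y x) = (norm (\<phi> y) * \<bar>k y x\<bar>) * norm (f x)"
      by (simp add: h_def norm_mult sym that)
    also have "\<dots> \<le> (norm (\<phi> y) * \<bar>k y x\<bar>) * B"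
      by (intro mult_left_mono B that) auto
    finally show ?thesis by (simp add: mult_ac)
  qed
  have kmeas: "k y \<in> borel_measurable S2" if "norm y = 1" for y
    using ki[OF that] by auto
  have hi: "integrable S2 (h y)" if y: "norm y = 1" for y
  proof (rule Bochner_Integration.integrable_bound)
    show "integrable S2 (\<lambda>x. norm (\<phi> y) * B * \<bar>k y x\<bar>)"
      by (intro integrable_mult_right integrable_abs ki y)
    show "h y \<in> borel_measurable S2"
      using measurable_Pair2[OF hm, of y] y by simp
    show "AE x in S2. norm (h y x) \<le> norm (norm (\<phi> y) * B * \<bar>k y x\<bar>)"
      using hy[OF y] \<open>0 < B\<close> by (auto simp: abs_mult)
  qed
  have int: "integrable (S2 \<Otimes>\<^sub>M S2) (case_prod h)"
  proof (rule Fubini_integrable)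
    show "integrable S2 (\<lambda>y. LINT x|S2. norm (case_prod h (y, x)))"
    proof (rule Bochner_Integration.integrable_bound)
      show "integrable S2 (\<lambda>y. norm (\<phi> y) * (B * C))"
        by (intro integrable_mult_left integrable_norm \<phi>)
      show "AE y in S2. norm (LINT x|S2. norm (case_prod h (y, x))) \<le> norm (norm (\<phi> y) * (B * C))"
      proof (rule AE_I2)
        fix y assume "y \<in> space S2"
        then have y: "norm y = 1" by simp
        have "(LINT x|S2. norm (h y x)) \<le> (LINT x|S2. norm (\<phi> y) * B * \<bar>k y x\<bar>)"
          using hi[OF y] ki[OF y] hy[OF y] by (intro integral_mono) auto
        also have "\<dots> \<le> norm (\<phi> y) * B * C"
          using kb[OF y] \<open>0 < B\<close> by (simp add: mult_left_mono)
        finally show "norm (LINT x|S2. norm (case_prod h (y, x))) \<le> norm (norm (\<phi> y) * (B * C))"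
          by simp
      qed
    qed measurable
    show "AE y in S2. integrable S2 (\<lambda>x. case_prod h (y, x))"
      using hi by (intro AE_I2) simp
  qed measurable
  have eq: "(LINT y|S2. h y x) = (LINT y|S2. k x y *\<^sub>R \<phi> y) * f x" for x
    unfolding h_def by (rule integral_mult_left_zero)
  show "integrable S2 (\<lambda>x. (LINT y|S2. k x y *\<^sub>R \<phi> y) * f x)"
    using integrable_snd[OF int] by (simp only: eq)
  have "(LINT x|S2. (LINT y|S2. k x y *\<^sub>R \<phi> y) * f x) = (LINT y|S2. (LINT x|S2. h y x))"
    using Fubini_integral[OF int] by (simp only: eq)
  also have "\<dots> = (LINT y|S2. \<phi> y * (LINT x|S2. k y x *\<^sub>R f x))"
  proof (rule integral_S2_cong)
    fix y :: "real^3" assume y: "norm y = 1"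
    have "(LINT x|S2. h y x) = (LINT x|S2. \<phi> y * (k y x *\<^sub>R f x))"
      by (rule Bochner_Integration.integral_cong) (auto simp: h_def sym[OF y])
    also have "\<dots> = \<phi> y * (LINT x|S2. k y x *\<^sub>R f x)"
      by (rule integral_mult_right_zero)
    finally show "(LINT x|S2. h y x) = \<phi> y * (LINT x|S2. k y x *\<^sub>R f x)" .
  qed
  finally show "(LINT x|S2. (LINT y|S2. k x y *\<^sub>R \<phi> y) * f x) = (LINT y|S2. \<phi> y * (LINT x|S2. k y x *\<^sub>R f x))" .
qed

lemma radial_kernel_duality:
  assumes t: "0 < t" and \<phi>: "integrable S2 \<phi>" and f: "poisson_eigenfunction n f"
  shows "integrable S2 (\<lambda>x. (LINT y|S2. radial_kernel t x y *\<^sub>R \<phi> y) * f x)" (is ?thesis1)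
    and "(LINT x|S2. (LINT y|S2. radial_kernel t x y *\<^sub>R \<phi> y) * f x) =
      of_real (radial_eigenvalue n t) * (LINT y|S2. \<phi> y * f y)" (is ?thesis2)
proof -
  have cf: "continuous_on (sphere 0 1) f"
    using f by (simp add: poisson_eigenfunction_def)
  obtain C where C: "\<And>x. norm x = 1 \<Longrightarrow> (LINT y|S2. \<bar>radial_kernel t x y\<bar>) \<le> C"
    using radial_kernel_bound[OF t] by blast
  have m: "(\<lambda>(x, y). radial_kernel t x y) \<in> borel_measurable (S2 \<Otimes>\<^sub>M S2)"
    unfolding radial_kernel_def case_prod_beta by measurable
  note dual = kernel_duality[OF m radial_kernel_commute integrable_radial_kernel[OF _ t] C \<phi> cf]
  show ?thesis1
    by (rule dual(1))
  have "(LINT y|S2. \<phi> y * (LINT x|S2. radial_kernel t y x *\<^sub>R f x)) =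
      (LINT y|S2. of_real (radial_eigenvalue n t) * (\<phi> y * f y))"
    by (rule Bochner_Integration.integral_cong)
       (simp_all add: radial_kernel_eigenfunction[OF f _ t] del: scaleR_conv_of_real, simp add: scaleR_conv_of_real)
  then show ?thesis2
    by (subst dual(2)) simp_all
qed

lemma poisson_duality:
  fixes \<phi> f :: "real^3 \<Rightarrow> complex"
  assumes r: "0 < r" "r < 1" and \<phi>: "integrable S2 \<phi>" and f: "continuous_on (sphere 0 1) f"
  shows "(LINT x|S2. (LINT y|S2. poisson r x y *\<^sub>R \<phi> y) * f x) =
      (LINT y|S2. \<phi> y * (LINT x|S2. poisson r y x *\<^sub>R f x))"
proof -
  have m: "(\<lambda>(x, y). poisson r x y) \<in> borel_measurable (S2 \<Otimes>\<^sub>M S2)"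
    unfolding poisson_def case_prod_beta by measurable
  have "(LINT y|S2. \<bar>poisson r x y\<bar>) \<le> 1" if "norm x = 1" for x
    using poisson_nonneg[OF r] integral_poisson[OF r that] by simp
  then show ?thesis
    using kernel_duality(2)[OF m poisson_commute integrable_S2_continuous[OF continuous_on_poisson_snd[OF r]] _ \<phi> f]
    by blast
qed


section \<open>Completeness of the spherical harmonics\<close>

lemma poisson_eigenfunction_orthogonal:
  assumes f: "poisson_eigenfunction n f" and g: "poisson_eigenfunction m g" and "n \<noteq> m"
  shows "(LINT y|S2. f y * g y) = 0"
proof -
  have cf: "continuous_on (sphere 0 1) f" and cg: "continuous_on (sphere 0 1) g"
    using f g by (simp_all add: poisson_eigenfunction_def)
  define a where "a = (LINT y|S2. f y * g y)"
  have "(LINT x|S2. (LINT y|S2. poisson (1/2) x y *\<^sub>R f y) * g x) = (LINT x|S2. of_real ((1/2) ^ n) * (f x * g x))"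
    using f by (intro Bochner_Integration.integral_cong)
      (auto simp: poisson_eigenfunction_def scaleR_conv_of_real)
  moreover have "(LINT y|S2. f y * (LINT x|S2. poisson (1/2) y x *\<^sub>R g x)) = (LINT y|S2. of_real ((1/2) ^ m) * (f y * g y))"
    using g by (intro Bochner_Integration.integral_cong)
      (auto simp: poisson_eigenfunction_def scaleR_conv_of_real)
  moreover have "(LINT x|S2. (LINT y|S2. poisson (1/2) x y *\<^sub>R f y) * g x) =
      (LINT y|S2. f y * (LINT x|S2. poisson (1/2) y x *\<^sub>R g x))"
    by (rule poisson_duality[OF _ _ integrable_S2_continuous[OF cf] cg]) auto
  ultimately have "of_real ((1/2) ^ n) * a = of_real ((1/2) ^ m) * a"
    unfolding a_def by (simp only: integral_mult_right_zero)
  moreover have "(1/2::real) ^ n \<noteq> (1/2) ^ m"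
    using \<open>n \<noteq> m\<close> power_inject_exp'[of "1/2::real" n m] by simp
  then have "complex_of_real ((1/2) ^ n) \<noteq> of_real ((1/2) ^ m)"
    by (simp only: of_real_eq_iff not_False_eq_True)
  ultimately have "a = 0"
    by (metis mult_cancel_right)
  then show ?thesis by (simp add: a_def)
qed

lemma borel_measurable_poisson_integral:
  fixes \<phi> :: "real^3 \<Rightarrow> complex"
  assumes "\<phi> \<in> borel_measurable S2"
  shows "(\<lambda>x. LINT y|S2. poisson r x y *\<^sub>R \<phi> y) \<in> borel_measurable S2"
proof (rule S2.borel_measurable_lebesgue_integral)
  have "(\<lambda>p. poisson r (fst p) (snd p)) \<in> borel_measurable (S2 \<Otimes>\<^sub>M S2)"
    unfolding poisson_def by measurable
  then show "(\<lambda>(x, y). poisson r x y *\<^sub>R \<phi> y) \<in> borel_measurable (S2 \<Otimes>\<^sub>M S2)"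
    unfolding case_prod_beta
    by (intro borel_measurable_scaleR measurable_compose[OF measurable_snd assms])
qed

lemma L2_space_measurable: "f \<in> L2_space M \<Longrightarrow> f \<in> borel_measurable M"
  by (simp add: L2_space_def)

lemma L2_space_integrable_sq: "f \<in> L2_space M \<Longrightarrow> integrable M (\<lambda>x. (norm (f x))\<^sup>2)"
  by (simp add: L2_space_def)

lemma L2_space_mult_integrable:
  fixes f g :: "'a \<Rightarrow> complex"
  assumes "f \<in> L2_space M" "g \<in> L2_space M"
  shows "integrable M (\<lambda>x. f x * g x)"
proof (rule Bochner_Integration.integrable_bound)
  show "integrable M (\<lambda>x. (norm (f x))\<^sup>2 + (norm (g x))\<^sup>2)"
    using assms by (simp add: L2_space_def)
  show "(\<lambda>x. f x * g x) \<in> borel_measurable M"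
    using assms by (intro borel_measurable_times L2_space_measurable)
  show "AE x in M. norm (f x * g x) \<le> norm ((norm (f x))\<^sup>2 + (norm (g x))\<^sup>2)"
  proof (rule AE_I2)
    fix x
    have "2 * norm (f x) * norm (g x) \<le> (norm (f x))\<^sup>2 + (norm (g x))\<^sup>2"
      by (rule sum_squares_bound)
    moreover have "0 \<le> norm (f x) * norm (g x)"
      by simp
    ultimately show "norm (f x * g x) \<le> norm ((norm (f x))\<^sup>2 + (norm (g x))\<^sup>2)"
      unfolding norm_mult real_norm_def by linarith
  qed
qed

lemma L2_space_cnj: "f \<in> L2_space M \<Longrightarrow> (\<lambda>x. cnj (f x)) \<in> L2_space M"
  using measurable_compose[OF L2_space_measurable borel_measurable_continuous_onI[OF continuous_on_cnj[OF continuous_on_id]]]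
    L2_space_integrable_sq[of f M]
  by (auto simp: L2_space_def)

lemma L2_space_cmult:
  assumes "f \<in> L2_space M"
  shows "(\<lambda>x. c * f x) \<in> L2_space M"
  using L2_space_measurable[OF assms] L2_space_integrable_sq[OF assms]
  by (simp add: L2_space_def norm_mult power_mult_distrib)

lemma L2_space_diff:
  assumes "f \<in> L2_space M" "g \<in> L2_space M"
  shows "(\<lambda>x. f x - g x) \<in> L2_space M"
proof -
  have [measurable]: "f \<in> borel_measurable M" "g \<in> borel_measurable M"
    using assms by (auto simp: L2_space_def)
  have "integrable M (\<lambda>x. (norm (f x - g x))\<^sup>2)"
  proof (rule Bochner_Integration.integrable_bound)
    show "integrable M (\<lambda>x. 2 * (norm (f x))\<^sup>2 + 2 * (norm (g x))\<^sup>2)"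
      using assms by (simp add: L2_space_def)
    show "AE x in M. norm ((norm (f x - g x))\<^sup>2) \<le> norm (2 * (norm (f x))\<^sup>2 + 2 * (norm (g x))\<^sup>2)"
    proof (rule AE_I2)
      fix x
      have "(norm (f x - g x))\<^sup>2 \<le> (norm (f x) + norm (g x))\<^sup>2"
        by (intro power_mono norm_triangle_ineq4) simp
      also have "\<dots> \<le> 2 * (norm (f x))\<^sup>2 + 2 * (norm (g x))\<^sup>2"
        using sum_squares_bound[of "norm (f x)" "norm (g x)"] by (simp add: power2_sum)
      finally show "norm ((norm (f x - g x))\<^sup>2) \<le> norm (2 * (norm (f x))\<^sup>2 + 2 * (norm (g x))\<^sup>2)"
        by simp
    qed
  qed measurable
  then show ?thesis
    by (simp add: L2_space_def)
qed

lemma L2_space_sum: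
  assumes "finite I" "\<And>i. i \<in> I \<Longrightarrow> f i \<in> L2_space M"
  shows "(\<lambda>x. \<Sum>i\<in>I. f i x) \<in> L2_space M"
  using assms
proof (induction I)
  case empty
  then show ?case by (simp add: L2_space_def)
next
  case (insert i I)
  have "(\<lambda>x. f i x - (- 1) * (\<Sum>i\<in>I. f i x)) \<in> L2_space M"
    using insert by (intro L2_space_diff L2_space_cmult) auto
  then show ?case
    using insert by simp
qed

lemma L2_space_S2_continuous:
  assumes "continuous_on (sphere 0 1) f"
  shows "f \<in> L2_space S2"
  unfolding L2_space_def
  using borel_measurable_S2_continuous[OF assms] assms
  by (auto intro!: integrable_S2_continuous continuous_intros)

lemma L2_space_S2_integrable:
  assumes "f \<in> L2_space S2"
  shows "integrable S2 f"
  using L2_space_mult_integrable[OF assms L2_space_S2_continuous[of "\<lambda>_. 1"]] by simp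

lemma Bessel_inequality:
  fixes e :: "'i \<Rightarrow> 'a \<Rightarrow> complex"
  assumes "finite I" and e: "\<And>i. i \<in> I \<Longrightarrow> e i \<in> L2_space M"
    and orth: "\<And>i j. i \<in> I \<Longrightarrow> j \<in> I \<Longrightarrow> (LINT x|M. e i x * cnj (e j x)) = (if i = j then 1 else 0)"
    and k: "k \<in> L2_space M"
  shows "(\<Sum>i\<in>I. (norm (LINT x|M. k x * cnj (e i x)))\<^sup>2) \<le> (LINT x|M. (norm (k x))\<^sup>2)"
proof -
  define c where "c i = (LINT x|M. k x * cnj (e i x))" for i
  define s where "s x = (\<Sum>i\<in>I. c i * e i x)" for x
  have s: "s \<in> L2_space M"
    unfolding s_def by (intro L2_space_sum L2_space_cmult e \<open>finite I\<close>)
  note int = L2_space_mult_integrable[OF _ L2_space_cnj]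
  have se: "(LINT x|M. s x * cnj (e j x)) = c j" if "j \<in> I" for j
  proof -
    have "(LINT x|M. s x * cnj (e j x)) = (LINT x|M. (\<Sum>i\<in>I. c i * (e i x * cnj (e j x))))"
      by (simp add: s_def sum_distrib_right mult.assoc)
    also have "\<dots> = (\<Sum>i\<in>I. (LINT x|M. c i * (e i x * cnj (e j x))))"
      by (intro Bochner_Integration.integral_sum integrable_mult_right int e that)
    also have "\<dots> = (\<Sum>i\<in>I. if i = j then c i else 0)"
      using orth that by (intro sum.cong) auto
    finally show ?thesis
      using that \<open>finite I\<close> by simp
  qed
  have s_any: "(LINT x|M. u x * cnj (s x)) = (\<Sum>i\<in>I. cnj (c i) * (LINT x|M. u x * cnj (e i x)))"
    if "u \<in> L2_space M" for u
  proof -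
    have "(LINT x|M. u x * cnj (s x)) = (LINT x|M. (\<Sum>i\<in>I. cnj (c i) * (u x * cnj (e i x))))"
      by (simp add: s_def sum_distrib_left mult_ac)
    also have "\<dots> = (\<Sum>i\<in>I. (LINT x|M. cnj (c i) * (u x * cnj (e i x))))"
      by (intro Bochner_Integration.integral_sum integrable_mult_right int e that)
    finally show ?thesis by simp
  qed
  define d where "d = (\<Sum>i\<in>I. (norm (c i))\<^sup>2)"
  have ks: "(LINT x|M. k x * cnj (s x)) = of_real d"
    unfolding s_any[OF k] c_def[symmetric] d_def of_real_sum complex_norm_square by (simp add: mult.commute)
  have ss: "(LINT x|M. s x * cnj (s x)) = of_real d"
    unfolding s_any[OF s] d_def of_real_sum complex_norm_square
    by (intro sum.cong refl) (simp add: se mult.commute)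
  have "0 \<le> (LINT x|M. (norm (k x - s x))\<^sup>2)"
    by simp
  also have "\<dots> = (LINT x|M. (norm (k x))\<^sup>2 - 2 * Re (k x * cnj (s x)) + Re (s x * cnj (s x)))"
    unfolding cmod_power2
    by (intro Bochner_Integration.integral_cong refl) (simp add: power2_eq_square algebra_simps)
  also have "\<dots> = (LINT x|M. (norm (k x))\<^sup>2) - 2 * (LINT x|M. Re (k x * cnj (s x))) + (LINT x|M. Re (s x * cnj (s x)))"
    using integrable_Re[OF int[OF k s]] integrable_Re[OF int[OF s s]] L2_space_integrable_sq[OF k]
    by (simp only: Bochner_Integration.integral_add Bochner_Integration.integral_diff
        Bochner_Integration.integrable_diff integrable_mult_right integral_mult_right_zero)
  also have "\<dots> = (LINT x|M. (norm (k x))\<^sup>2) - d"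
    unfolding integral_bounded_linear[OF bounded_linear_Re int[OF k s]]
      integral_bounded_linear[OF bounded_linear_Re int[OF s s]] ks ss by simp
  finally show ?thesis
    by (simp add: d_def c_def)
qed

lemma S2_set_integral_zero:
  fixes w :: "real^3 \<Rightarrow> complex"
  assumes w: "integrable S2 w"
    and zero: "\<And>g. continuous_on (sphere 0 1) g \<Longrightarrow> (LINT y|S2. w y * g y) = 0"
    and A: "A \<in> sets S2"
  shows "(LINT y:A|S2. w y) = 0"
proof -
  define \<G> where "\<G> = (\<inter>) (sphere (0::real^3) 1) ` Collect closed"
  have [measurable]: "w \<in> borel_measurable S2"
    using w by auto
  have sets_eq: "sets S2 = sigma_sets (sphere 0 1) \<G>"
  proof -
    have "sphere (0::real^3) 1 \<in> sigma_sets UNIV (Collect closed)"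
      by (auto intro: sigma_sets.Basic)
    from sigma_sets_Int[OF this] show ?thesis
      unfolding sets_sphere_measure sets_restrict_space \<G>_def by (simp add: borel_eq_closed)
  qed
  have int: "set_integrable S2 B w" if "B \<in> sets S2" for B
    unfolding set_integrable_def by (intro integrable_mult_indicator that w)
  have "Int_stable \<G>"
  proof (rule Int_stableI)
    fix a b assume "a \<in> \<G>" "b \<in> \<G>"
    then obtain a' b' where "closed a'" "a = sphere 0 1 \<inter> a'" "closed b'" "b = sphere 0 1 \<inter> b'"
      by (auto simp: \<G>_def)
    then show "a \<inter> b \<in> \<G>"
      unfolding \<G>_def by (intro image_eqI[of _ _ "a' \<inter> b'"]) auto
  qed
  moreover have "\<G> \<subseteq> Pow (sphere 0 1)"
    by (auto simp: \<G>_def)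
  moreover have "A \<in> sigma_sets (sphere 0 1) \<G>"
    using A sets_eq by simp
  ultimately show ?thesis
  proof (induction rule: sigma_sets_induct_disjoint)
    case (basic B)
    then obtain C where C: "closed C" "B = sphere 0 1 \<inter> C"
      by (auto simp: \<G>_def)
    show ?case
    proof (cases "C = {}")
      case False
      define g where "g n y = max 0 (1 - real n * infdist y C)" for n y
      have "(\<lambda>n. LINT y|S2. w y * of_real (g n y)) \<longlonglongrightarrow> (LINT y|S2. indicator B y *\<^sub>R w y)"
      proof (rule integral_dominated_convergence[where w = "\<lambda>y. norm (w y)"])
        show "integrable S2 (\<lambda>y. norm (w y))" using w by simp
        have "g n \<in> borel_measurable S2" for n
          unfolding g_def by (intro borel_measurable_S2_continuous continuous_intros)
        then show "(\<lambda>y. w y * of_real (g n y)) \<in> borel_measurable S2" for n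
          by simp
        show "(\<lambda>y. indicator B y *\<^sub>R w y) \<in> borel_measurable S2"
          using int[of B] basic sets_eq by (auto simp: set_integrable_def intro: sigma_sets.Basic)
        show "AE y in S2. (\<lambda>n. w y * of_real (g n y)) \<longlonglongrightarrow> indicator B y *\<^sub>R w y"
        proof (rule AE_I2)
          fix y assume y: "y \<in> space S2"
          have "(\<lambda>n. g n y) \<longlonglongrightarrow> indicator B y"
          proof (cases "y \<in> C")
            case True
            then show ?thesis
              using y C by (simp add: g_def)
          next
            case yC: False
            then have pos: "0 < infdist y C"
              using C False infdist_pos_not_in_closed by blast
            then obtain N :: nat where N: "1 < real N * infdist y C"
              using reals_Archimedean3 by blast
            have "g n y = 0" if "N \<le> n" for n
            proof -
              have "real N * infdist y C \<le> real n * infdist y C"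
                using that pos by (intro mult_right_mono) auto
              then show ?thesis
                using N by (simp add: g_def)
            qed
            then have "eventually (\<lambda>n. g n y = 0) sequentially"
              by (auto simp: eventually_sequentially)
            then show ?thesis
              using C yC by (simp add: tendsto_eventually)
          qed
          then have "(\<lambda>n. w y * of_real (g n y)) \<longlonglongrightarrow> w y * of_real (indicator B y)"
            by (intro tendsto_intros)
          then show "(\<lambda>n. w y * of_real (g n y)) \<longlonglongrightarrow> indicator B y *\<^sub>R w y"
            by (simp add: scaleR_conv_of_real mult.commute)
        qed
        show "AE y in S2. norm (w y * of_real (g n y)) \<le> norm (w y)" for n
        proof (rule AE_I2)
          fix y
          have "0 \<le> real n * infdist y C"
            by (simp add: infdist_nonneg)
          then have "\<bar>g n y\<bar> \<le> 1"
            by (simp add: g_def)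
          then show "norm (w y * of_real (g n y)) \<le> norm (w y)"
            by (simp add: norm_mult mult_left_le)
        qed
      qed
      moreover have "(LINT y|S2. w y * of_real (g n y)) = 0" for n
        unfolding g_def by (intro zero continuous_intros)
      ultimately have "(\<lambda>n::nat. 0) \<longlonglongrightarrow> (LINT y|S2. indicator B y *\<^sub>R w y)"
        by simp
      then show ?thesis
        unfolding set_lebesgue_integral_def by (simp add: LIMSEQ_const_iff)
    qed (use C in \<open>simp add: set_lebesgue_integral_def\<close>)
  next
    case empty
    then show ?case by (simp add: set_lebesgue_integral_def)
  next
    case (compl B)
    then have B: "B \<in> sets S2"
      by (simp add: sets_eq)
    have "(LINT y:(B \<union> (space S2 - B))|S2. w y) = (LINT y:B|S2. w y) + (LINT y:(space S2 - B)|S2. w y)"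
      using B by (intro set_integral_Un int sets.compl_sets) auto
    moreover have "B \<union> (space S2 - B) = space S2"
      using sets.sets_into_space[OF B] by auto
    moreover have "(LINT y:space S2|S2. w y) = 0"
    proof -
      have "(LINT y:space S2|S2. w y) = (LINT y|S2. w y * 1)"
        unfolding set_lebesgue_integral_def by (intro Bochner_Integration.integral_cong) auto
      then show ?thesis
        using zero[of "\<lambda>_. 1"] by simp
    qed
    ultimately show ?case
      using compl by simp
  next
    case (union B)
    then have "B i \<in> sets S2" for i
      by (auto simp: sets_eq)
    then have "(LINT y:(\<Union>i. B i)|S2. w y) = (\<Sum>i. LINT y:B i|S2. w y)"
      using union(1) int[of "\<Union>i. B i"] by (intro lebesgue_integral_countable_add) (auto simp: disjoint_family_on_def)
    then show ?case
      using union(3) by simp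
  qed
qed

lemma AE_S2_zeroI:
  fixes w :: "real^3 \<Rightarrow> complex"
  assumes w: "integrable S2 w"
    and zero: "\<And>g. continuous_on (sphere 0 1) g \<Longrightarrow> (LINT y|S2. w y * g y) = 0"
  shows "AE y in S2. w y = 0"
  using S2.density_unique_banach[OF w, of "\<lambda>_. 0"] S2_set_integral_zero[OF w zero]
  by (simp add: set_lebesgue_integral_def)

lemma sums_odd_powers:
  fixes q :: real
  assumes "\<bar>q\<bar> < 1"
  shows "(\<lambda>n. (2 * real n + 1) * q ^ n) sums ((1 + q) / (1 - q)\<^sup>2)"
proof -
  have "(\<lambda>n. 2 * (of_nat (Suc n) * q ^ n) - q ^ n) sums (2 * (1 / (1 - q)\<^sup>2) - 1 / (1 - q))"
    using assms by (intro sums_diff sums_mult geometric_deriv_sums geometric_sums) auto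
  moreover have "2 * (1 / (1 - q)\<^sup>2) - 1 / (1 - q) = (1 + q) / (1 - q)\<^sup>2"
  proof -
    have "2 * (1 / u\<^sup>2) - 1 / u = (2 - u) / u\<^sup>2" if "u \<noteq> 0" for u :: real
      using that by (simp add: field_simps power2_eq_square)
    from this[of "1 - q"] show ?thesis
      using assms by auto
  qed
  moreover have "2 * (of_nat (Suc n) * q ^ n) - q ^ n = (2 * real n + 1) * q ^ n" for n
    by (simp add: algebra_simps)
  ultimately show ?thesis by simp
qed

lemma orthonormal_spherical_harmonics_poisson:
  assumes "orthonormal_spherical_harmonics Y" "m \<in> {- int n..int n}"
  shows "poisson_eigenfunction n (Y n m)"
  using assms by (auto simp: orthonormal_spherical_harmonics_def intro: spherical_harmonic_poisson)

lemma poisson_eigenfunction_L2: "poisson_eigenfunction n f \<Longrightarrow> f \<in> L2_space S2"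
  by (intro L2_space_S2_continuous) (simp add: poisson_eigenfunction_def)

lemma orthonormal_spherical_harmonics_inner:
  assumes Y: "orthonormal_spherical_harmonics Y" and m: "m \<in> {- int n..int n}" "m' \<in> {- int n'..int n'}"
  shows "(LINT x|S2. Y n m x * cnj (Y n' m' x)) = (if n = n' \<and> m = m' then 1 else 0)"
proof (cases "n = n'")
  case True
  then show ?thesis
    using Y m by (auto simp: orthonormal_spherical_harmonics_def)
next
  case False
  note harm = orthonormal_spherical_harmonics_poisson[OF Y]
  show ?thesis
    using poisson_eigenfunction_orthogonal[OF harm[OF m(1)] poisson_eigenfunction_cnj[OF harm[OF m(2)]]] False
    by simp
qed

text \<open>
  Bessel's inequality for the Poisson kernel and the family Y enlarged by a normalised function
  orthogonal to Y, integrated over the sphere: since there are 2 n + 1 members of degree n, the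
  harmonics alone already exhaust the integral of the squared kernel, so the Poisson integral of
  the additional function vanishes.
\<close>

lemma orthonormal_spherical_harmonics_complete:
  assumes Y: "orthonormal_spherical_harmonics Y" and \<phi>: "\<phi> \<in> L2_space S2"
    and orth: "\<And>n m. m \<in> {- int n..int n} \<Longrightarrow> (LINT x|S2. \<phi> x * cnj (Y n m x)) = 0"
  shows "AE x in S2. \<phi> x = 0"
proof (cases "(LINT x|S2. (norm (\<phi> x))\<^sup>2) = 0")
  case True
  then have "AE x in S2. (norm (\<phi> x))\<^sup>2 = 0"
    using \<phi> integral_nonneg_eq_0_iff_AE[of S2 "\<lambda>x. (norm (\<phi> x))\<^sup>2"] by (simp add: L2_space_def)
  then show ?thesis by simp
next
  case False
  define N where "N = (LINT x|S2. (norm (\<phi> x))\<^sup>2)"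
  have "0 \<le> N"
    by (simp add: N_def)
  then have N: "0 < N"
    using False by (simp add: N_def less_le)
  define \<psi> where "\<psi> x = of_real (1 / sqrt N) * \<phi> x" for x
  have \<psi>: "\<psi> \<in> L2_space S2"
    unfolding \<psi>_def by (intro L2_space_cmult \<phi>)
  have \<psi>\<psi>: "(LINT x|S2. \<psi> x * cnj (\<psi> x)) = 1"
  proof -
    have "(LINT x|S2. \<psi> x * cnj (\<psi> x)) = (LINT x|S2. of_real (1 / N * (norm (\<phi> x))\<^sup>2))"
    proof (intro Bochner_Integration.integral_cong refl)
      fix x
      have "\<psi> x * cnj (\<psi> x) = of_real ((norm (\<psi> x))\<^sup>2)"
        by (simp only: complex_norm_square)
      also have "(norm (\<psi> x))\<^sup>2 = 1 / N * (norm (\<phi> x))\<^sup>2"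
        using N by (simp add: \<psi>_def norm_mult norm_divide power_mult_distrib power_divide)
      finally show "\<psi> x * cnj (\<psi> x) = of_real (1 / N * (norm (\<phi> x))\<^sup>2)" .
    qed
    also have "\<dots> = of_real (LINT x|S2. 1 / N * (norm (\<phi> x))\<^sup>2)"
      by (rule integral_complex_of_real)
    also have "(LINT x|S2. 1 / N * (norm (\<phi> x))\<^sup>2) = 1 / N * N"
      unfolding N_def by (rule integral_mult_right_zero)
    finally show ?thesis
      using N by simp
  qed
  note YY = orthonormal_spherical_harmonics_inner[OF Y]
  note harm = orthonormal_spherical_harmonics_poisson[OF Y]
  note YL2 = poisson_eigenfunction_L2[OF harm]
  have Y\<psi>: "(LINT x|S2. \<psi> x * cnj (Y n m x)) = 0" "(LINT x|S2. Y n m x * cnj (\<psi> x)) = 0"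
    if "m \<in> {- int n..int n}" for n m
  proof -
    show *: "(LINT x|S2. \<psi> x * cnj (Y n m x)) = 0"
      using orth[OF that] by (simp add: \<psi>_def mult.assoc)
    have "(LINT x|S2. Y n m x * cnj (\<psi> x)) = (LINT x|S2. cnj (\<psi> x * cnj (Y n m x)))"
      by (simp add: mult.commute)
    also have "\<dots> = cnj (LINT x|S2. \<psi> x * cnj (Y n m x))"
      by (rule Bochner_Integration.integral_cnj)
    finally show "(LINT x|S2. Y n m x * cnj (\<psi> x)) = 0"
      using * by simp
  qed
  define e where "e i = (case i of None \<Rightarrow> \<psi> | Some (n, m) \<Rightarrow> Y n m)" for i
  define J where "J L = (SIGMA n:{..L}. {- int n..int n})" for L :: nat
  have P0: "AE x in S2. (LINT y|S2. poisson r x y *\<^sub>R cnj (\<psi> y)) = 0" if r: "0 < r" "r < 1" for r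
  proof -
    define p where "p x = (LINT y|S2. poisson r x y *\<^sub>R cnj (\<psi> y))" for x
    define c where "c = (1 + r\<^sup>2) / (4 * pi * (1 - r\<^sup>2)\<^sup>2)"
    have bessel: "(\<Sum>(n, m)\<in>J L. (r\<^sup>2) ^ n * (norm (Y n m x))\<^sup>2) + (norm (p x))\<^sup>2 \<le> c" if x: "norm x = 1" for x L
    proof -
      have fin: "finite (insert None (Some ` J L))"
        by (simp add: J_def)
      have "(\<Sum>i\<in>insert None (Some ` J L). (norm (LINT y|S2. of_real (poisson r x y) * cnj (e i y)))\<^sup>2) \<le>
          (LINT y|S2. (norm (complex_of_real (poisson r x y)))\<^sup>2)"
      proof (rule Bessel_inequality[OF fin])
        show "e i \<in> L2_space S2" if "i \<in> insert None (Some ` J L)" for i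
          using that \<psi> YL2 by (auto simp: e_def J_def)
        show "(LINT y|S2. e i y * cnj (e j y)) = (if i = j then 1 else 0)"
          if ij: "i \<in> insert None (Some ` J L)" "j \<in> insert None (Some ` J L)" for i j
        proof -
          have "i = None \<or> (\<exists>n m. i = Some (n, m) \<and> m \<in> {- int n..int n})"
            "j = None \<or> (\<exists>n m. j = Some (n, m) \<and> m \<in> {- int n..int n})"
            using ij by (auto simp: J_def)
          then show ?thesis
            by (elim disjE exE conjE) (simp_all add: e_def \<psi>\<psi> YY Y\<psi> del: atLeastAtMost_iff)
        qed
        show "(\<lambda>y. complex_of_real (poisson r x y)) \<in> L2_space S2"
          by (intro L2_space_S2_continuous continuous_intros continuous_on_poisson_snd r x)
      qed
      moreover have "(LINT y|S2. (norm (complex_of_real (poisson r x y)))\<^sup>2) = c"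
        using integral_poisson_sq[OF r x] by (simp add: c_def)
      moreover have "(norm (LINT y|S2. of_real (poisson r x y) * cnj (e (Some z) y)))\<^sup>2 =
          (case z of (n, m) \<Rightarrow> (r\<^sup>2) ^ n * (norm (Y n m x))\<^sup>2)" if zJ: "z \<in> J L" for z
      proof -
        obtain n m where z: "z = (n, m)" "m \<in> {- int n..int n}"
          using zJ by (auto simp: J_def)
        have "(LINT y|S2. of_real (poisson r x y) * cnj (e (Some z) y)) = r ^ n *\<^sub>R cnj (Y n m x)"
          using poisson_eigenfunction_cnj[OF harm[OF z(2)]] r x
          by (simp add: poisson_eigenfunction_def e_def z scaleR_conv_of_real)
        then show ?thesis
          using r by (simp add: z power_mult_distrib flip: power_mult) (simp add: mult.commute)
      qed
      moreover have "(LINT y|S2. of_real (poisson r x y) * cnj (e None y)) = p x"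
        by (simp add: p_def e_def scaleR_conv_of_real)
      ultimately show ?thesis
        by (simp add: sum.reindex J_def cong: sum.cong)
    qed
    have mp: "p \<in> borel_measurable S2"
      unfolding p_def by (intro borel_measurable_poisson_integral L2_space_measurable L2_space_cnj \<psi>)
    have ip: "integrable S2 (\<lambda>x. (norm (p x))\<^sup>2)"
    proof (rule integrable_S2_bounded[where B = c])
      show "(\<lambda>x. (norm (p x))\<^sup>2) \<in> borel_measurable S2"
        using mp by simp
      show "norm ((norm (p x))\<^sup>2) \<le> c" if "norm x = 1" for x
      proof -
        have "0 \<le> (\<Sum>(n, m)\<in>J 0. (r\<^sup>2) ^ n * (norm (Y n m x))\<^sup>2)"
          by (intro sum_nonneg) auto
        then have "(norm (p x))\<^sup>2 \<le> c"
          using bessel[OF that, of 0] by linarith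
        then show ?thesis by simp
      qed
    qed
    define A where "A = (LINT x|S2. (norm (p x))\<^sup>2)"
    have q: "\<bar>r\<^sup>2\<bar> < 1"
      using r by (simp add: power2_less_1_iff)
    have partial: "(\<Sum>n\<le>L. (2 * real n + 1) * (r\<^sup>2) ^ n) \<le> (1 + r\<^sup>2) / (1 - r\<^sup>2)\<^sup>2 - A" for L
    proof -
      have iY: "integrable S2 (\<lambda>x. (norm (Y n m x))\<^sup>2)" if "m \<in> {- int n..int n}" for n m
        using YL2[OF that] by (simp add: L2_space_def)
      have nY: "(LINT x|S2. (norm (Y n m x))\<^sup>2) = 1" if "m \<in> {- int n..int n}" for n m
      proof -
        have "complex_of_real (LINT x|S2. (norm (Y n m x))\<^sup>2) = (LINT x|S2. Y n m x * cnj (Y n m x))"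
          unfolding integral_complex_of_real[symmetric]
          by (intro Bochner_Integration.integral_cong refl) (simp only: complex_norm_square)
        then show ?thesis
          using YY[OF that that] by simp
      qed
      have int: "integrable S2 (\<lambda>x. case z of (n, m) \<Rightarrow> (r\<^sup>2) ^ n * (norm (Y n m x))\<^sup>2)" if "z \<in> J L" for z
        using that iY by (auto simp: J_def)
      have "(LINT x|S2. (\<Sum>(n, m)\<in>J L. (r\<^sup>2) ^ n * (norm (Y n m x))\<^sup>2) + (norm (p x))\<^sup>2) \<le> (LINT x|S2. c)"
        using bessel int ip by (intro integral_mono Bochner_Integration.integrable_add Bochner_Integration.integrable_sum) auto
      also have "(LINT x|S2. c) = (1 + r\<^sup>2) / (1 - r\<^sup>2)\<^sup>2"
        by (simp add: measure_S2 c_def)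
      also have "(LINT x|S2. (\<Sum>(n, m)\<in>J L. (r\<^sup>2) ^ n * (norm (Y n m x))\<^sup>2) + (norm (p x))\<^sup>2) =
          (\<Sum>z\<in>J L. LINT x|S2. (case z of (n, m) \<Rightarrow> (r\<^sup>2) ^ n * (norm (Y n m x))\<^sup>2)) + A"
        unfolding A_def using int ip
        by (subst Bochner_Integration.integral_add)
           (auto intro!: Bochner_Integration.integrable_sum Bochner_Integration.integral_sum)
      also have "(\<Sum>z\<in>J L. LINT x|S2. (case z of (n, m) \<Rightarrow> (r\<^sup>2) ^ n * (norm (Y n m x))\<^sup>2)) =
          (\<Sum>(n, m)\<in>J L. (r\<^sup>2) ^ n)"
        using nY by (intro sum.cong) (auto simp: J_def)
      also have "\<dots> = (\<Sum>n\<le>L. \<Sum>m\<in>{- int n..int n}. (r\<^sup>2) ^ n)"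
        unfolding J_def by (subst sum.Sigma) auto
      also have "\<dots> = (\<Sum>n\<le>L. (2 * real n + 1) * (r\<^sup>2) ^ n)"
        by (intro sum.cong) (auto simp: nat_add_distrib nat_mult_distrib)
      finally show ?thesis by simp
    qed
    have "(\<lambda>L. \<Sum>n\<le>L. (2 * real n + 1) * (r\<^sup>2) ^ n) \<longlonglongrightarrow> (1 + r\<^sup>2) / (1 - r\<^sup>2)\<^sup>2"
      using sums_odd_powers[OF q] by (simp add: sums_def_le)
    then have "(1 + r\<^sup>2) / (1 - r\<^sup>2)\<^sup>2 \<le> (1 + r\<^sup>2) / (1 - r\<^sup>2)\<^sup>2 - A"
      by (rule LIMSEQ_le_const2) (use partial in blast)
    moreover have "0 \<le> A"
      by (simp add: A_def)
    ultimately have "A = 0" by simp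
    then have "AE x in S2. (norm (p x))\<^sup>2 = 0"
      using integral_nonneg_eq_0_iff_AE[OF ip] by (simp add: A_def)
    then show ?thesis
      by (simp add: p_def)
  qed
  have i\<psi>: "integrable S2 (\<lambda>y. cnj (\<psi> y))"
    using L2_space_S2_integrable[OF L2_space_cnj[OF \<psi>]] .
  have "AE y in S2. cnj (\<psi> y) = 0"
  proof (rule AE_S2_zeroI[OF i\<psi>])
    fix g :: "real^3 \<Rightarrow> complex" assume g: "continuous_on (sphere 0 1) g"
    have ig: "integrable S2 (\<lambda>y. cnj (\<psi> y) * g y)"
      using L2_space_mult_integrable[OF L2_space_cnj[OF \<psi>] L2_space_S2_continuous[OF g]] .
    define K where "K = (LINT y|S2. norm (cnj (\<psi> y)))"
    have K: "0 \<le> K" by (simp add: K_def)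
    have "norm (LINT y|S2. cnj (\<psi> y) * g y) \<le> 0 + e" if "0 < e" for e
    proof -
      define e' where "e' = e / (K + 1)"
      have e': "0 < e'" "e' * K \<le> e"
        using K \<open>0 < e\<close> by (auto simp: e'_def field_simps)
      obtain r0 where r0: "0 < r0" "r0 < 1" and close: "\<And>r x. r0 < r \<Longrightarrow> r < 1 \<Longrightarrow> norm x = 1 \<Longrightarrow>
          norm ((LINT y|S2. poisson r x y *\<^sub>R g y) - g x) \<le> e'"
        using poisson_approximate_identity[OF g e'(1)] by blast
      define r where "r = (r0 + 1) / 2"
      have r: "r0 < r" "0 < r" "r < 1"
        using r0 by (auto simp: r_def)
      define h where "h x = (LINT y|S2. poisson r x y *\<^sub>R g y)" for x
      have zero: "(LINT y|S2. cnj (\<psi> y) * h y) = 0"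
      proof -
        have "(LINT y|S2. cnj (\<psi> y) * h y) = (LINT x|S2. (LINT y|S2. poisson r x y *\<^sub>R cnj (\<psi> y)) * g x)"
          unfolding h_def by (rule poisson_duality[OF r(2,3) i\<psi> g, symmetric])
        also have "\<dots> = 0"
          by (rule integral_eq_zero_AE) (use P0[OF r(2,3)] in \<open>auto elim: eventually_mono\<close>)
        finally show ?thesis .
      qed
      have mh: "h \<in> borel_measurable S2"
        unfolding h_def by (intro borel_measurable_poisson_integral borel_measurable_S2_continuous g)
      have m: "(\<lambda>y. cnj (\<psi> y) * (h y - g y)) \<in> borel_measurable S2"
        by (intro borel_measurable_times borel_measurable_diff mh borel_measurable_S2_continuous[OF g]
            L2_space_measurable L2_space_cnj \<psi>)
      have bd: "norm (cnj (\<psi> y) * (h y - g y)) \<le> norm (cnj (\<psi> y)) * e'" if "norm y = 1" for y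
        unfolding norm_mult using close[OF r(1,3) that] by (intro mult_left_mono) (auto simp: h_def)
      have ihg: "integrable S2 (\<lambda>y. cnj (\<psi> y) * (h y - g y))"
      proof (rule Bochner_Integration.integrable_bound[OF _ m])
        show "integrable S2 (\<lambda>y. norm (cnj (\<psi> y)) * e')"
          using i\<psi> by (intro integrable_mult_left integrable_norm)
        show "AE y in S2. norm (cnj (\<psi> y) * (h y - g y)) \<le> norm (norm (cnj (\<psi> y)) * e')"
          using bd e' by (intro AE_I2) (simp add: abs_mult)
      qed
      have "(LINT y|S2. cnj (\<psi> y) * g y) = (LINT y|S2. cnj (\<psi> y) * h y) - (LINT y|S2. cnj (\<psi> y) * (h y - g y))"
        using Bochner_Integration.integral_add[OF ihg ig] by (simp add: algebra_simps)
      then have "norm (LINT y|S2. cnj (\<psi> y) * g y) = norm (LINT y|S2. cnj (\<psi> y) * (h y - g y))"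
        by (simp add: zero)
      also have "\<dots> \<le> (LINT y|S2. norm (cnj (\<psi> y) * (h y - g y)))"
        by (rule integral_norm_bound)
      also have "\<dots> \<le> (LINT y|S2. norm (cnj (\<psi> y)) * e')"
        using bd ihg i\<psi> by (intro integral_mono integrable_mult_left integrable_norm) auto
      also have "\<dots> = K * e'"
        unfolding K_def by (rule integral_mult_left_zero)
      finally show ?thesis
        using e' by (simp add: mult.commute)
    qed
    then have "norm (LINT y|S2. cnj (\<psi> y) * g y) \<le> 0"
      by (rule field_le_epsilon)
    then show "(LINT y|S2. cnj (\<psi> y) * g y) = 0"
      by simp
  qed
  then show ?thesis
    using N by (simp add: \<psi>_def)
qed


section \<open>The Neumann--Poincare-type operator\<close>

definition radial_op :: "real \<Rightarrow> (real^3 \<Rightarrow> complex) \<Rightarrow> real^3 \<Rightarrow> complex" where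
  "radial_op t \<phi> x = (LINT y|S2. radial_kernel t x y *\<^sub>R \<phi> y)"

lemma has_derivative_G:
  assumes "z \<noteq> y"
  shows "((\<lambda>z. G (z - y)) has_derivative (\<lambda>h. ((z - y) \<bullet> h) / (4 * pi * norm (z - y) ^ 3))) (at z)"
proof -
  have G: "G (z - y) = - 1 / (4 * pi) * inverse (norm (z - y) ^ 1)" for z
    by (simp add: G_def inverse_eq_divide)
  show ?thesis
    unfolding G
    by (rule has_derivative_eq_rhs[OF has_derivative_mult_right[OF has_derivative_inverse_norm_power[OF assms]]])
       (simp add: fun_eq_iff power3_eq_cube inverse_eq_divide)
qed

lemma normal_derivative_eq:
  assumes "(u has_derivative D) (at (s *\<^sub>R x))" "norm x = 1" "0 < s"
  shows "normal_derivative u (s *\<^sub>R x) = D x"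
proof -
  have "(s *\<^sub>R x) /\<^sub>R norm (s *\<^sub>R x) = x"
    using assms by simp
  then show ?thesis
    unfolding normal_derivative_def using frechet_derivative_at[OF assms(1)] by simp
qed

lemma radial_kernel_rescale:
  assumes "norm x = 1" "norm y = 1" "0 < r"
  shows "r\<^sup>2 * (((s *\<^sub>R x - r *\<^sub>R y) \<bullet> x) / (4 * pi * norm (s *\<^sub>R x - r *\<^sub>R y) ^ 3)) = radial_kernel (s / r) x y"
proof -
  have 1: "s *\<^sub>R x - r *\<^sub>R y = r *\<^sub>R ((s / r) *\<^sub>R x - y)"
    using assms by (simp add: scaleR_diff_right)
  have 2: "((s / r) *\<^sub>R x - y) \<bullet> x = s / r - x \<bullet> y"
    using assms by (simp add: inner_diff_left inner_commute[of y x] dot_square_norm)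
  show ?thesis
    unfolding 1 radial_kernel_def inner_scaleR_left 2 norm_scaleR power_mult_distrib using assms
    by (simp add: power2_eq_square power3_eq_cube)
qed

lemma NP_adjoint_eq_radial_op:
  assumes r: "0 < r" and \<phi>: "\<phi> \<in> borel_measurable (sphere_measure r)" and x: "norm x = 1"
  shows "NP_adjoint r \<phi> (r *\<^sub>R x) = radial_op 1 (\<lambda>y. \<phi> (r *\<^sub>R y)) x"
proof -
  define k where "k y = ((r *\<^sub>R x - y) \<bullet> x) / (4 * pi * norm (r *\<^sub>R x - y) ^ 3)" for y
  define C where "C = normal_derivative (\<lambda>z. G (z - r *\<^sub>R x)) (r *\<^sub>R x) *\<^sub>R \<phi> (r *\<^sub>R x)"
  have [measurable]: "\<phi> \<in> borel_measurable (sphere_measure r)" "(\<lambda>x. x) \<in> borel_measurable (sphere_measure r)"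
    using \<phi> by (auto intro: measurable_sphere_measureI)
  have mk: "(\<lambda>y. k y *\<^sub>R \<phi> y) \<in> borel_measurable (sphere_measure r)"
    unfolding k_def by measurable
  have eq: "normal_derivative (\<lambda>z. G (z - y)) (r *\<^sub>R x) *\<^sub>R \<phi> y = (if y = r *\<^sub>R x then C else k y *\<^sub>R \<phi> y)" for y
    using normal_derivative_eq[OF has_derivative_G x r, of y] by (auto simp: C_def k_def)
  have "NP_adjoint r \<phi> (r *\<^sub>R x) = (LINT y|sphere_measure r. (if y = r *\<^sub>R x then C else k y *\<^sub>R \<phi> y))"
    unfolding NP_adjoint_def eq ..
  also have "\<dots> = (LINT y|sphere_measure r. k y *\<^sub>R \<phi> y)"
  proof (rule integral_cong_AE)
    have "(\<lambda>y. y) -` {r *\<^sub>R x} \<inter> space (sphere_measure r) \<in> sets (sphere_measure r)"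
      by (rule measurable_sets[where A = borel]) (auto intro: measurable_sphere_measureI)
    moreover have "(\<lambda>y. y) -` {r *\<^sub>R x} \<inter> space (sphere_measure r) = {y \<in> space (sphere_measure r). y = r *\<^sub>R x}"
      by auto
    ultimately have "{y \<in> space (sphere_measure r). y = r *\<^sub>R x} \<in> sets (sphere_measure r)"
      by (simp only:)
    then show "(\<lambda>y. if y = r *\<^sub>R x then C else k y *\<^sub>R \<phi> y) \<in> borel_measurable (sphere_measure r)"
      by (intro measurable_If mk) simp_all
    show "AE y in sphere_measure r. (if y = r *\<^sub>R x then C else k y *\<^sub>R \<phi> y) = k y *\<^sub>R \<phi> y"
      unfolding AE_sphere_scale[OF r] using S2_singleton_null[of x] by eventually_elim (use r in auto)
  qed (rule mk)
  also have "\<dots> = r\<^sup>2 *\<^sub>R (LINT y|S2. k (r *\<^sub>R y) *\<^sub>R \<phi> (r *\<^sub>R y))"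
    by (rule integral_sphere_scale[OF r mk])
  also have "\<dots> = (LINT y|S2. r\<^sup>2 *\<^sub>R (k (r *\<^sub>R y) *\<^sub>R \<phi> (r *\<^sub>R y)))"
    by (rule Bochner_Integration.integral_scaleR_right[symmetric])
  also have "\<dots> = radial_op 1 (\<lambda>y. \<phi> (r *\<^sub>R y)) x"
    unfolding radial_op_def
  proof (rule integral_S2_cong)
    fix y :: "real^3" assume "norm y = 1"
    then have "r\<^sup>2 * k (r *\<^sub>R y) = radial_kernel 1 x y"
      using radial_kernel_rescale[OF x _ r, of y r] r by (simp add: k_def)
    then show "r\<^sup>2 *\<^sub>R (k (r *\<^sub>R y) *\<^sub>R \<phi> (r *\<^sub>R y)) = radial_kernel 1 x y *\<^sub>R \<phi> (r *\<^sub>R y)"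
      by (simp only: scaleR_scaleR)
  qed
  finally show ?thesis .
qed

lemma normal_derivative_single_layer:
  assumes r: "0 < r" and \<phi>: "\<phi> \<in> borel_measurable (sphere_measure r)"
    and int: "integrable S2 (\<lambda>y. \<phi> (r *\<^sub>R y))" and x: "norm x = 1" and s: "0 < s" "s \<noteq> r"
  shows "normal_derivative (single_layer r \<phi>) (s *\<^sub>R x) = radial_op (s / r) (\<lambda>y. \<phi> (r *\<^sub>R y)) x"
proof -
  define U where "U = {z::real^3. norm z \<noteq> r}"
  have U: "open U" "s *\<^sub>R x \<in> U"
    using s x by (auto simp: U_def intro!: open_Collect_neq continuous_intros)
  have neq: "z \<noteq> r *\<^sub>R y" if "z \<in> U" "norm y = 1" for z y
    using that r by (auto simp: U_def)
  have [measurable]: "\<phi> \<in> borel_measurable (sphere_measure r)" "(\<lambda>x. x) \<in> borel_measurable (sphere_measure r)"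
    using \<phi> by (auto intro: measurable_sphere_measureI)
  define V where "V z = (LINT y|S2. G (z - r *\<^sub>R y) *\<^sub>R \<phi> (r *\<^sub>R y))" for z
  define g where "g z y = (1 / (4 * pi * norm (z - r *\<^sub>R y) ^ 3)) *\<^sub>R (z - r *\<^sub>R y)" for z y :: "real^3"
  have sl: "single_layer r \<phi> = (\<lambda>z. r\<^sup>2 *\<^sub>R V z)"
  proof
    fix z
    have "(\<lambda>y. G (z - y) *\<^sub>R \<phi> y) \<in> borel_measurable (sphere_measure r)"
      unfolding G_def by measurable
    then show "single_layer r \<phi> z = r\<^sup>2 *\<^sub>R V z"
      unfolding single_layer_def V_def by (rule integral_sphere_scale[OF r])
  qed
  have "(V has_derivative (\<lambda>h. LINT y|S2. (g (s *\<^sub>R x) y \<bullet> h) *\<^sub>R \<phi> (r *\<^sub>R y))) (at (s *\<^sub>R x))"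
    unfolding V_def
  proof (rule has_derivative_sphere_integral[OF U _ _ _ int])
    show "((\<lambda>z. G (z - r *\<^sub>R y)) has_derivative (\<lambda>h. g z y \<bullet> h)) (at z)" if "z \<in> U" "norm y = 1" for z y
      using has_derivative_G[OF neq[OF that]] by (simp add: g_def)
    show "continuous_on (U \<times> sphere 0 1) (\<lambda>(z, y). g z y)"
      unfolding g_def case_prod_beta by (intro continuous_intros) (use neq in force)
    show "continuous_on (sphere 0 1) (\<lambda>y. G (z - r *\<^sub>R y))" if "z \<in> U" for z
      unfolding G_def by (intro continuous_intros) (use neq[OF that] in force)
  qed
  then have "(single_layer r \<phi> has_derivative
      (\<lambda>h. r\<^sup>2 *\<^sub>R (LINT y|S2. (g (s *\<^sub>R x) y \<bullet> h) *\<^sub>R \<phi> (r *\<^sub>R y)))) (at (s *\<^sub>R x))"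
    unfolding sl by (rule has_derivative_scaleR_right)
  then have "normal_derivative (single_layer r \<phi>) (s *\<^sub>R x) = r\<^sup>2 *\<^sub>R (LINT y|S2. (g (s *\<^sub>R x) y \<bullet> x) *\<^sub>R \<phi> (r *\<^sub>R y))"
    by (rule normal_derivative_eq[OF _ x s(1)])
  also have "\<dots> = (LINT y|S2. r\<^sup>2 *\<^sub>R ((g (s *\<^sub>R x) y \<bullet> x) *\<^sub>R \<phi> (r *\<^sub>R y)))"
    by (rule Bochner_Integration.integral_scaleR_right[symmetric])
  also have "\<dots> = radial_op (s / r) (\<lambda>y. \<phi> (r *\<^sub>R y)) x"
    unfolding radial_op_def
  proof (rule integral_S2_cong)
    fix y :: "real^3" assume "norm y = 1"
    then have "r\<^sup>2 * (g (s *\<^sub>R x) y \<bullet> x) = radial_kernel (s / r) x y"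
      using radial_kernel_rescale[OF x _ r, of y s] by (simp add: g_def)
    then show "r\<^sup>2 *\<^sub>R ((g (s *\<^sub>R x) y \<bullet> x) *\<^sub>R \<phi> (r *\<^sub>R y)) = radial_kernel (s / r) x y *\<^sub>R \<phi> (r *\<^sub>R y)"
      by (simp only: scaleR_scaleR)
  qed
  finally show ?thesis .
qed

lemma L2_space_sphere_scale_iff:
  assumes "0 < r" "\<phi> \<in> borel_measurable (sphere_measure r)"
  shows "\<phi> \<in> L2_space (sphere_measure r) \<longleftrightarrow> (\<lambda>y. \<phi> (r *\<^sub>R y)) \<in> L2_space S2"
  using assms measurable_S2_scale[OF assms] integrable_sphere_scale_iff[OF assms(1), of "\<lambda>x. (norm (\<phi> x))\<^sup>2"]
  by (simp add: L2_space_def)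

lemma NP_eigenfunction_iff:
  assumes radii: "0 < ri" "ri < re"
    and m: "fst \<Phi> \<in> borel_measurable (sphere_measure ri)" "snd \<Phi> \<in> borel_measurable (sphere_measure re)"
    and a: "a = (\<lambda>y. fst \<Phi> (ri *\<^sub>R y))" and b: "b = (\<lambda>y. snd \<Phi> (re *\<^sub>R y))"
  shows "NP_eigenfunction ri re \<kappa> \<Phi> \<longleftrightarrow> a \<in> L2_space S2 \<and> b \<in> L2_space S2 \<and>
    \<not> ((AE x in S2. a x = 0) \<and> (AE x in S2. b x = 0)) \<and>
    (AE x in S2. - radial_op 1 a x - radial_op (ri / re) b x = \<kappa> * a x) \<and>
    (AE x in S2. radial_op (re / ri) a x + radial_op 1 b x = \<kappa> * b x)"
proof (cases "a \<in> L2_space S2 \<and> b \<in> L2_space S2")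
  case True
  have re: "0 < re"
    using radii by simp
  have int: "integrable S2 a" "integrable S2 b"
    using True by (auto intro: L2_space_S2_integrable)
  have "fst (NP_op ri re \<Phi>) (ri *\<^sub>R x) = - radial_op 1 a x - radial_op (ri / re) b x" if "norm x = 1" for x
    using NP_adjoint_eq_radial_op[OF radii(1) m(1) that]
      normal_derivative_single_layer[OF re m(2) int(2)[unfolded b] that radii(1)] radii
    by (simp add: NP_op_def case_prod_beta a b)
  moreover have "snd (NP_op ri re \<Phi>) (re *\<^sub>R x) = radial_op (re / ri) a x + radial_op 1 b x" if "norm x = 1" for x
    using NP_adjoint_eq_radial_op[OF re m(2) that]
      normal_derivative_single_layer[OF radii(1) m(1) int(1)[unfolded a] that re] radii
    by (simp add: NP_op_def case_prod_beta a b)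
  ultimately have
    "(AE x in S2. fst (NP_op ri re \<Phi>) (ri *\<^sub>R x) = \<kappa> * a x) \<longleftrightarrow>
     (AE x in S2. - radial_op 1 a x - radial_op (ri / re) b x = \<kappa> * a x)"
    "(AE x in S2. snd (NP_op ri re \<Phi>) (re *\<^sub>R x) = \<kappa> * b x) \<longleftrightarrow>
     (AE x in S2. radial_op (re / ri) a x + radial_op 1 b x = \<kappa> * b x)"
    by (auto intro!: AE_cong)
  then show ?thesis
    using L2_space_sphere_scale_iff[OF radii(1) m(1)] L2_space_sphere_scale_iff[OF re m(2)] True
    unfolding NP_eigenfunction_def eq_ae_def AE_sphere_scale[OF radii(1)] AE_sphere_scale[OF re] L2_pairs_def
    by (auto simp: a b mem_Times_iff)
next
  case False
  then show ?thesis
    using L2_space_sphere_scale_iff[OF radii(1) m(1)] L2_space_sphere_scale_iff[OF _ m(2)] radii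
    by (auto simp: NP_eigenfunction_def L2_pairs_def a b mem_Times_iff)
qed

lemma radial_op_coefficient:
  assumes t: "0 < t" and a: "a \<in> L2_space S2" and f: "poisson_eigenfunction n f"
  shows "integrable S2 (\<lambda>x. radial_op t a x * cnj (f x))"
    and "(LINT x|S2. radial_op t a x * cnj (f x)) = of_real (radial_eigenvalue n t) * (LINT x|S2. a x * cnj (f x))"
  unfolding radial_op_def
  using radial_kernel_duality[OF t L2_space_S2_integrable[OF a] poisson_eigenfunction_cnj[OF f]] by auto

lemma radial_op_eigenfunction:
  assumes "poisson_eigenfunction n f" "norm x = 1" "0 < t"
  shows "radial_op t (\<lambda>y. c * f y) x = of_real (radial_eigenvalue n t) * (c * f x)"
proof -
  have "radial_op t (\<lambda>y. c * f y) x = (LINT y|S2. c * (radial_kernel t x y *\<^sub>R f y))"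
    by (simp add: radial_op_def)
  also have "\<dots> = c * (LINT y|S2. radial_kernel t x y *\<^sub>R f y)"
    by (rule integral_mult_right_zero)
  also have "(LINT y|S2. radial_kernel t x y *\<^sub>R f y) = radial_eigenvalue n t *\<^sub>R f x"
    by (rule radial_kernel_eigenfunction[OF assms])
  finally show ?thesis
    by (simp add: scaleR_conv_of_real mult_ac)
qed

lemma radial_op_cong: "(\<And>y. norm y = 1 \<Longrightarrow> f y = g y) \<Longrightarrow> radial_op t f x = radial_op t g x"
  unfolding radial_op_def by (rule Bochner_Integration.integral_cong) auto

lemma orthonormal_spherical_harmonics_expansion:
  assumes Y: "orthonormal_spherical_harmonics Y" and \<phi>: "\<phi> \<in> L2_space S2"
    and zero: "\<And>l m. l \<noteq> n \<Longrightarrow> m \<in> {- int l..int l} \<Longrightarrow> (LINT x|S2. \<phi> x * cnj (Y l m x)) = 0"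
  shows "AE x in S2. \<phi> x = (\<Sum>m\<in>{- int n..int n}. (LINT y|S2. \<phi> y * cnj (Y n m y)) * Y n m x)"
proof -
  define c where "c m = (LINT y|S2. \<phi> y * cnj (Y n m y))" for m
  define s where "s x = (\<Sum>m\<in>{- int n..int n}. c m * Y n m x)" for x
  note YL2 = poisson_eigenfunction_L2[OF orthonormal_spherical_harmonics_poisson[OF Y]]
  have s: "s \<in> L2_space S2"
    unfolding s_def by (intro L2_space_sum L2_space_cmult YL2) auto
  note int = L2_space_mult_integrable[OF _ L2_space_cnj]
  have "AE x in S2. \<phi> x - s x = 0"
  proof (rule orthonormal_spherical_harmonics_complete[OF Y L2_space_diff[OF \<phi> s]])
    fix l m assume m: "m \<in> {- int l..int l}"
    have "(LINT x|S2. s x * cnj (Y l m x)) = (LINT x|S2. (\<Sum>m'\<in>{- int n..int n}. c m' * (Y n m' x * cnj (Y l m x))))"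
      by (simp add: s_def sum_distrib_right mult.assoc)
    also have "\<dots> = (\<Sum>m'\<in>{- int n..int n}. (LINT x|S2. c m' * (Y n m' x * cnj (Y l m x))))"
      by (intro Bochner_Integration.integral_sum integrable_mult_right int YL2 m)
    also have "\<dots> = (\<Sum>m'\<in>{- int n..int n}. if m' = m then (if n = l then c m' else 0) else 0)"
      by (intro sum.cong refl) (simp add: orthonormal_spherical_harmonics_inner[OF Y _ m])
    also have "\<dots> = (LINT x|S2. \<phi> x * cnj (Y l m x))"
      using m zero[of l m] by (auto simp: c_def)
    finally have "(LINT x|S2. s x * cnj (Y l m x)) = (LINT x|S2. \<phi> x * cnj (Y l m x))" .
    moreover have "(LINT x|S2. (\<phi> x - s x) * cnj (Y l m x)) =
        (LINT x|S2. \<phi> x * cnj (Y l m x)) - (LINT x|S2. s x * cnj (Y l m x))"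
      unfolding left_diff_distrib by (intro Bochner_Integration.integral_diff int \<phi> s YL2 m)
    ultimately show "(LINT x|S2. (\<phi> x - s x) * cnj (Y l m x)) = 0"
      by simp
  qed
  then show ?thesis
    by (simp add: s_def c_def)
qed

lemma eigenvalue_sq_strict_decreasing:
  fixes \<rho> :: real
  assumes "0 < \<rho>" "\<rho> < 1" "n < m"
  defines "f \<equiv> \<lambda>n. (1 + 4 * real n * (real n + 1) * \<rho> ^ (2 * n + 1)) / (2 * real n + 1)\<^sup>2"
  shows "f m < f n"
proof -
  define u where "u n = 1 / (2 * real n + 1)\<^sup>2" for n
  define t where "t n = \<rho> ^ (2 * n + 1)" for n
  have f: "f k = t k + (1 - t k) * u k" for k
  proof -
    define N where "N = 2 * real k + 1"
    have N: "N \<noteq> 0" "4 * real k * (real k + 1) = N\<^sup>2 - 1"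
      by (auto simp: N_def power2_eq_square algebra_simps)
    show ?thesis
      unfolding f_def u_def t_def[symmetric] N_def[symmetric] N(2) using N(1) by (simp add: field_simps)
  qed
  have t: "t m < t n" "t m < 1"
    using assms power_Suc_less_one[of \<rho> "2 * m"] by (auto simp: t_def intro!: power_strict_decreasing)
  have u: "u m < u n" "u n \<le> 1"
  proof -
    show "u m < u n"
      unfolding u_def using \<open>n < m\<close> by (intro divide_strict_left_mono power_strict_mono mult_pos_pos) auto
    show "u n \<le> 1"
      by (simp add: u_def)
  qed
  have "f m < t m + (1 - t m) * u n"
    unfolding f using t u by (intro add_strict_left_mono mult_strict_left_mono) auto
  also have "\<dots> = u n + t m * (1 - u n)"
    by (simp add: algebra_simps)
  also have "\<dots> \<le> u n + t n * (1 - u n)"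
    using t u by (intro add_left_mono mult_right_mono) auto
  also have "\<dots> = f n"
    unfolding f by (simp add: algebra_simps)
  finally show ?thesis .
qed

text \<open>
  On the harmonics of degree n the operator acts as a matrix [[-p, q], [w, p]] of trace 0, where
  p^2 + q w is the square of the claimed eigenvalue.
\<close>

theorem proposition3p3:
  fixes ri re \<rho> :: real
    and Y :: "nat \<Rightarrow> int \<Rightarrow> real^3 \<Rightarrow> complex"
    and R :: "nat \<Rightarrow> real"
    and E :: "real \<Rightarrow> nat \<Rightarrow> int \<Rightarrow> density_pair"
  assumes radii: "0 < ri" "ri < re"
    and Y: "orthonormal_spherical_harmonics Y"
  defines "\<rho> \<equiv> ri / re"
    and "R \<equiv> \<lambda>n. sqrt (1 + 4 * real n * (real n + 1) * \<rho> ^ (2 * n + 1))"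
    and "E \<equiv> \<lambda>s n m.
          (\<lambda>x. complex_of_real (s * R n - 1) * Y n m (x /\<^sub>R norm x),
           \<lambda>x. complex_of_real (2 * (real n + 1) * \<rho> ^ (n + 2)) * Y n m (x /\<^sub>R norm x))"
  shows "{\<kappa>. NP_eigenvalue ri re \<kappa>} =
           {complex_of_real (s * (1 / (2 * (2 * real n + 1)) * R n)) | s n. s \<in> {1, -1}} \<and>
         (\<forall>s\<in>{1, -1}. \<forall>n. \<forall>m\<in>{- int n..int n}.
           NP_eigenfunction ri re
             (complex_of_real (s * (1 / (2 * (2 * real n + 1)) * R n))) (E s n m)) \<and>
         (\<forall>s\<in>{1, -1}. \<forall>n \<Phi>.
           NP_eigenfunction ri re
             (complex_of_real (s * (1 / (2 * (2 * real n + 1)) * R n))) \<Phi> \<longrightarrow>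
           (\<exists>c :: int \<Rightarrow> complex. eq_ae ri re \<Phi>
              (\<lambda>x. \<Sum>m\<in>{- int n..int n}. c m * fst (E s n m) x,
               \<lambda>x. \<Sum>m\<in>{- int n..int n}. c m * snd (E s n m) x)))"
proof -
  have re: "0 < re"
    using radii by simp
  have \<rho>: "0 < \<rho>" "\<rho> < 1" and \<rho>_inv: "re / ri = 1 / \<rho>"
    using radii by (auto simp: \<rho>_def)
  define ev where "ev s n = s * (1 / (2 * (2 * real n + 1)) * R n)" for s n
  define p where "p n = 1 / (2 * (2 * real n + 1))" for n
  define q where "q n = real n * \<rho> ^ n / (\<rho> * (2 * real n + 1))" for n
  define w where "w n = (real n + 1) * \<rho> ^ (n + 2) / (2 * real n + 1)" for n
  define B where "B n = 2 * (real n + 1) * \<rho> ^ (n + 2)" for n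
  have mu: "radial_eigenvalue n 1 = p n" "radial_eigenvalue n (ri / re) = - q n"
    "radial_eigenvalue n (re / ri) = w n" for n
    unfolding \<rho>_inv \<rho>_def[symmetric] using \<rho> by (simp_all add: radial_eigenvalue_def p_def q_def w_def)
  have R2: "(R n)\<^sup>2 = 1 + 4 * real n * (real n + 1) * \<rho> ^ (2 * n + 1)" for n
    unfolding R_def using \<rho> by (intro real_sqrt_pow2) (auto intro!: add_nonneg_nonneg)
  have qw: "4 * (2 * real n + 1)\<^sup>2 * (q n * w n) = (R n)\<^sup>2 - 1" for n
  proof -
    have "\<rho> ^ n * \<rho> ^ (n + 2) = \<rho> * \<rho> ^ (2 * n + 1)"
      by (simp add: mult_2 flip: power_add power_Suc)
    moreover have "x * a / (\<rho> * N) * (y * c / N) = x * y * d / N\<^sup>2" if "a * c = \<rho> * d" for a c d x y N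
    proof -
      have "x * a / (\<rho> * N) * (y * c / N) = x * y * (a * c) / (\<rho> * N\<^sup>2)"
        by (simp add: power2_eq_square mult_ac)
      then show ?thesis
        using \<rho> by (simp add: that)
    qed
    ultimately have "q n * w n = real n * (real n + 1) * \<rho> ^ (2 * n + 1) / (2 * real n + 1)\<^sup>2"
      unfolding q_def w_def by blast
    then show ?thesis
      unfolding R2 by simp
  qed
  have ev_p: "ev s n - p n = (s * R n - 1) / (2 * (2 * real n + 1))"
    "ev s n + p n = (s * R n + 1) / (2 * (2 * real n + 1))" for s n
    by (simp_all add: ev_def p_def diff_divide_distrib add_divide_distrib)
  have w_B: "w n = B n / (2 * (2 * real n + 1))" for n
  proof -
    have "a * x / N = 2 * a * x / (2 * N)" for a x N :: real
      by (simp add: mult.assoc)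
    then show ?thesis
      unfolding w_def B_def by blast
  qed
  have B_nz: "B n \<noteq> 0" for n
    using \<rho> by (simp add: B_def add_eq_0_iff)
  have sq_div: "(s * (1 / (2 * N) * r))\<^sup>2 = s\<^sup>2 * r\<^sup>2 / (4 * N\<^sup>2)" for s N r :: real
    by (simp add: power_mult_distrib power_divide)
  have ev2: "(ev s n)\<^sup>2 = (p n)\<^sup>2 + q n * w n" if "s \<in> {1, -1}" for s n
  proof -
    have "s\<^sup>2 = 1" using that by auto
    then have "(ev s n)\<^sup>2 = (R n)\<^sup>2 / (4 * (2 * real n + 1)\<^sup>2)"
      unfolding ev_def sq_div by simp
    also have "\<dots> = (p n)\<^sup>2 + ((R n)\<^sup>2 - 1) / (4 * (2 * real n + 1)\<^sup>2)"
      using sq_div[of 1 "2 * real n + 1" 1] by (simp add: p_def diff_divide_distrib)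
    also have "((R n)\<^sup>2 - 1) / (4 * (2 * real n + 1)\<^sup>2) = q n * w n"
      unfolding qw[symmetric] by simp
    finally show ?thesis .
  qed
  have ev_inj: "l = n" if "s \<in> {1, -1}" "(p l)\<^sup>2 + q l * w l = (ev s n)\<^sup>2" for l n s
  proof -
    define f where "f k = (1 + 4 * real k * (real k + 1) * \<rho> ^ (2 * k + 1)) / (2 * real k + 1)\<^sup>2" for k
    have sq: "(p k)\<^sup>2 + q k * w k = f k / 4" for k
      using ev2[of 1 k] unfolding ev_def sq_div R2 f_def by simp
    have "f l = f n"
      using that(2) ev2[OF that(1), of n] unfolding sq by simp
    moreover have "f i < f j" if "j < i" for i j
      unfolding f_def by (rule eigenvalue_sq_strict_decreasing[OF \<rho> that])
    ultimately show ?thesis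
      by (metis less_irrefl linorder_neqE_nat)
  qed
  note harm = orthonormal_spherical_harmonics_poisson[OF Y]
  have Em: "fst (E s n m) \<in> borel_measurable (sphere_measure ri)" "snd (E s n m) \<in> borel_measurable (sphere_measure re)"
    if m: "m \<in> {- int n..int n}" for s n m
  proof -
    have "Y n m \<in> borel_measurable S2"
      using harm[OF m] by (intro borel_measurable_S2_continuous) (simp add: poisson_eigenfunction_def)
    then show "fst (E s n m) \<in> borel_measurable (sphere_measure ri)" "snd (E s n m) \<in> borel_measurable (sphere_measure re)"
      unfolding E_def fst_conv snd_conv
      by (intro borel_measurable_times borel_measurable_const measurable_sphere_unscale radii re; assumption)+
  qed
  have eigen: "NP_eigenfunction ri re (of_real (ev s n)) (E s n m)"
    if s: "s \<in> {1, -1}" and m: "m \<in> {- int n..int n}" for s n m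
  proof -
    define a where "a = (\<lambda>y. fst (E s n m) (ri *\<^sub>R y))"
    define b where "b = (\<lambda>y. snd (E s n m) (re *\<^sub>R y))"
    have ab: "a y = of_real (s * R n - 1) * Y n m y" "b y = of_real (B n) * Y n m y" if "norm y = 1" for y
      using that radii re by (simp_all add: a_def b_def E_def B_def)
    have cY: "continuous_on (sphere 0 1) (Y n m)"
      using harm[OF m] by (simp add: poisson_eigenfunction_def)
    have "continuous_on (sphere 0 1) a"
      by (rule continuous_on_eq[of _ "\<lambda>y. of_real (s * R n - 1) * Y n m y"])
         (auto simp: ab intro!: continuous_intros cY)
    moreover have "continuous_on (sphere 0 1) b"
      by (rule continuous_on_eq[of _ "\<lambda>y. of_real (B n) * Y n m y"])
         (auto simp: ab intro!: continuous_intros cY)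
    ultimately have L2: "a \<in> L2_space S2" "b \<in> L2_space S2"
      by (auto intro: L2_space_S2_continuous)
    have op: "radial_op t a x = of_real (radial_eigenvalue n t * (s * R n - 1)) * Y n m x"
      "radial_op t b x = of_real (radial_eigenvalue n t * B n) * Y n m x" if "norm x = 1" "0 < t" for t x
    proof -
      have "radial_op t a x = radial_op t (\<lambda>y. of_real (s * R n - 1) * Y n m y) x"
        by (rule radial_op_cong) (rule ab(1))
      then show "radial_op t a x = of_real (radial_eigenvalue n t * (s * R n - 1)) * Y n m x"
        unfolding radial_op_eigenfunction[OF harm[OF m] that] by simp
      have "radial_op t b x = radial_op t (\<lambda>y. of_real (B n) * Y n m y) x"
        by (rule radial_op_cong) (rule ab(2))
      then show "radial_op t b x = of_real (radial_eigenvalue n t * B n) * Y n m x"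
        unfolding radial_op_eigenfunction[OF harm[OF m] that] by simp
    qed
    have nz: "\<not> (AE x in S2. b x = 0)"
    proof
      assume "AE x in S2. b x = 0"
      then have "AE x in S2. Y n m x * cnj (Y n m x) = 0"
        using AE_space
      proof eventually_elim
        case (elim x)
        then show ?case
          using ab(2)[of x] B_nz by auto
      qed
      then have "(LINT x|S2. Y n m x * cnj (Y n m x)) = 0"
        by (rule integral_eq_zero_AE)
      then show False
        using Y m by (simp add: orthonormal_spherical_harmonics_def)
    qed
    have s2: "s * s = 1" using s by auto
    have 1: "- (p n * (s * R n - 1)) + q n * B n = ev s n * (s * R n - 1)"
    proof -
      have "q n * B n = 2 * (2 * real n + 1) * (q n * w n)"
        by (simp add: w_B)
      also have "\<dots> = ((R n)\<^sup>2 - 1) / (2 * (2 * real n + 1))"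
      proof -
        have "2 * N * z = 4 * N\<^sup>2 * z / (2 * N)" if "N \<noteq> 0" for N z :: real
          using that by (simp add: power2_eq_square)
        moreover have "2 * real n + 1 \<noteq> 0"
          by simp
        ultimately show ?thesis
          unfolding qw[symmetric] by blast
      qed
      also have "(R n)\<^sup>2 - 1 = (s * R n + 1) * (s * R n - 1)"
        using s2 by (simp add: algebra_simps power2_eq_square)
      also have "(s * R n + 1) * (s * R n - 1) / (2 * (2 * real n + 1)) = (ev s n + p n) * (s * R n - 1)"
        unfolding ev_p by simp
      finally show ?thesis
        by (simp add: algebra_simps)
    qed
    have 2: "w n * (s * R n - 1) + p n * B n = ev s n * B n"
    proof -
      have "w n * (s * R n - 1) = (ev s n - p n) * B n"
        unfolding ev_p w_B by simp
      then show ?thesis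
        by (simp add: algebra_simps)
    qed
    have "- radial_op 1 a x - radial_op (ri / re) b x = of_real (ev s n) * a x" if "norm x = 1" for x
    proof -
      have "- radial_op 1 a x - radial_op (ri / re) b x = of_real (- (p n * (s * R n - 1)) + q n * B n) * Y n m x"
        using that radii re by (simp add: op mu algebra_simps)
      then show ?thesis
        unfolding 1 ab(1)[OF that] by simp
    qed
    moreover have "radial_op (re / ri) a x + radial_op 1 b x = of_real (ev s n) * b x" if "norm x = 1" for x
    proof -
      have "radial_op (re / ri) a x + radial_op 1 b x = of_real (w n * (s * R n - 1) + p n * B n) * Y n m x"
        using that radii re by (simp add: op mu algebra_simps)
      then show ?thesis
        unfolding 2 ab(2)[OF that] by simp
    qed
    ultimately show ?thesis
      using L2 nz unfolding NP_eigenfunction_iff[OF radii Em[OF m] a_def b_def] by auto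
  qed
  have coeff: "(\<kappa> + of_real (p n)) * (LINT x|S2. fst \<Phi> (ri *\<^sub>R x) * cnj (Y n m x)) =
        of_real (q n) * (LINT x|S2. snd \<Phi> (re *\<^sub>R x) * cnj (Y n m x))"
      "(\<kappa> - of_real (p n)) * (LINT x|S2. snd \<Phi> (re *\<^sub>R x) * cnj (Y n m x)) =
        of_real (w n) * (LINT x|S2. fst \<Phi> (ri *\<^sub>R x) * cnj (Y n m x))"
    if eig: "NP_eigenfunction ri re \<kappa> \<Phi>" and m: "m \<in> {- int n..int n}" for \<kappa> \<Phi> n m
  proof -
    have meas: "fst \<Phi> \<in> borel_measurable (sphere_measure ri)" "snd \<Phi> \<in> borel_measurable (sphere_measure re)"
      using eig by (auto simp: NP_eigenfunction_def L2_pairs_def mem_Times_iff L2_space_def)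
    define a where "a = (\<lambda>y. fst \<Phi> (ri *\<^sub>R y))"
    define b where "b = (\<lambda>y. snd \<Phi> (re *\<^sub>R y))"
    have a: "a \<in> L2_space S2" and b: "b \<in> L2_space S2"
      and 1: "AE x in S2. - radial_op 1 a x - radial_op (ri / re) b x = \<kappa> * a x"
      and 2: "AE x in S2. radial_op (re / ri) a x + radial_op 1 b x = \<kappa> * b x"
      using eig unfolding NP_eigenfunction_iff[OF radii meas a_def b_def] by auto
    note YL2 = poisson_eigenfunction_L2[OF harm[OF m]]
    note int = L2_space_mult_integrable[OF _ L2_space_cnj[OF YL2]]
    note op = radial_op_coefficient[OF _ _ harm[OF m]]
    have pos: "0 < ri / re" "0 < re / ri"
      using radii re by auto
    have "(LINT x|S2. \<kappa> * (a x * cnj (Y n m x))) =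
        (LINT x|S2. - (radial_op 1 a x * cnj (Y n m x)) - radial_op (ri / re) b x * cnj (Y n m x))"
    proof (rule integral_cong_AE)
      show "AE x in S2. \<kappa> * (a x * cnj (Y n m x)) =
          - (radial_op 1 a x * cnj (Y n m x)) - radial_op (ri / re) b x * cnj (Y n m x)"
        using 1
      proof eventually_elim
        case (elim x)
        from arg_cong[OF elim, of "\<lambda>z. z * cnj (Y n m x)"] show ?case
          by (simp add: algebra_simps)
      qed
    qed (intro borel_measurable_integrable integrable_mult_right Bochner_Integration.integrable_diff
        Bochner_Integration.integrable_minus int op a b pos zero_less_one)+
    also have "\<dots> = - (LINT x|S2. radial_op 1 a x * cnj (Y n m x)) - (LINT x|S2. radial_op (ri / re) b x * cnj (Y n m x))"
      by (simp only: Bochner_Integration.integral_minus Bochner_Integration.integral_diff[OF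
          Bochner_Integration.integrable_minus[OF op(1)[OF zero_less_one a]] op(1)[OF pos(1) b]])
    finally show "(\<kappa> + of_real (p n)) * (LINT x|S2. fst \<Phi> (ri *\<^sub>R x) * cnj (Y n m x)) =
        of_real (q n) * (LINT x|S2. snd \<Phi> (re *\<^sub>R x) * cnj (Y n m x))"
      unfolding op(2)[OF zero_less_one a] op(2)[OF pos(1) b] mu integral_mult_right_zero
      by (simp add: a_def b_def algebra_simps)
    have "(LINT x|S2. \<kappa> * (b x * cnj (Y n m x))) =
        (LINT x|S2. radial_op (re / ri) a x * cnj (Y n m x) + radial_op 1 b x * cnj (Y n m x))"
    proof (rule integral_cong_AE)
      show "AE x in S2. \<kappa> * (b x * cnj (Y n m x)) =
          radial_op (re / ri) a x * cnj (Y n m x) + radial_op 1 b x * cnj (Y n m x)"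
        using 2
      proof eventually_elim
        case (elim x)
        from arg_cong[OF elim, of "\<lambda>z. z * cnj (Y n m x)"] show ?case
          by (simp add: algebra_simps)
      qed
    qed (intro borel_measurable_integrable integrable_mult_right Bochner_Integration.integrable_add
        int op a b pos zero_less_one)+
    also have "\<dots> = (LINT x|S2. radial_op (re / ri) a x * cnj (Y n m x)) + (LINT x|S2. radial_op 1 b x * cnj (Y n m x))"
      by (intro Bochner_Integration.integral_add op a b pos zero_less_one)
    finally show "(\<kappa> - of_real (p n)) * (LINT x|S2. snd \<Phi> (re *\<^sub>R x) * cnj (Y n m x)) =
        of_real (w n) * (LINT x|S2. fst \<Phi> (ri *\<^sub>R x) * cnj (Y n m x))"
      unfolding op(2)[OF zero_less_one b] op(2)[OF pos(2) a] mu integral_mult_right_zero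
      by (simp add: a_def b_def algebra_simps)
  qed
  have coeff_sq: "\<kappa>\<^sup>2 = of_real ((p n)\<^sup>2 + q n * w n)"
    if eig: "NP_eigenfunction ri re \<kappa> \<Phi>" and m: "m \<in> {- int n..int n}"
      and nz: "(LINT x|S2. fst \<Phi> (ri *\<^sub>R x) * cnj (Y n m x)) \<noteq> 0 \<or>
        (LINT x|S2. snd \<Phi> (re *\<^sub>R x) * cnj (Y n m x)) \<noteq> 0" for \<kappa> \<Phi> n m
  proof -
    define \<alpha> where "\<alpha> = (LINT x|S2. fst \<Phi> (ri *\<^sub>R x) * cnj (Y n m x))"
    define \<beta> where "\<beta> = (LINT x|S2. snd \<Phi> (re *\<^sub>R x) * cnj (Y n m x))"
    have 1: "(\<kappa> + of_real (p n)) * \<alpha> = of_real (q n) * \<beta>" and 2: "(\<kappa> - of_real (p n)) * \<beta> = of_real (w n) * \<alpha>"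
      using coeff[OF eig m] by (simp_all add: \<alpha>_def \<beta>_def)
    have "(\<kappa>\<^sup>2 - ((of_real (p n))\<^sup>2 + of_real (q n) * of_real (w n))) * \<alpha> = 0"
      "(\<kappa>\<^sup>2 - ((of_real (p n))\<^sup>2 + of_real (q n) * of_real (w n))) * \<beta> = 0"
      using 1 2 by algebra+
    then show ?thesis
      using nz unfolding \<alpha>_def[symmetric] \<beta>_def[symmetric] by auto
  qed
  have "\<exists>s n. s \<in> {1, -1} \<and> \<kappa> = of_real (ev s n)" if "NP_eigenvalue ri re \<kappa>" for \<kappa>
  proof -
    obtain \<Phi> where eig: "NP_eigenfunction ri re \<kappa> \<Phi>"
      using \<open>NP_eigenvalue ri re \<kappa>\<close> by (auto simp: NP_eigenvalue_def)
    have meas: "fst \<Phi> \<in> borel_measurable (sphere_measure ri)" "snd \<Phi> \<in> borel_measurable (sphere_measure re)"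
      using eig by (auto simp: NP_eigenfunction_def L2_pairs_def mem_Times_iff L2_space_def)
    have L2: "(\<lambda>y. fst \<Phi> (ri *\<^sub>R y)) \<in> L2_space S2" "(\<lambda>y. snd \<Phi> (re *\<^sub>R y)) \<in> L2_space S2"
      and nz: "\<not> ((AE x in S2. fst \<Phi> (ri *\<^sub>R x) = 0) \<and> (AE x in S2. snd \<Phi> (re *\<^sub>R x) = 0))"
      using eig unfolding NP_eigenfunction_iff[OF radii meas refl refl] by auto
    have "\<exists>n m. m \<in> {- int n..int n} \<and> ((LINT x|S2. fst \<Phi> (ri *\<^sub>R x) * cnj (Y n m x)) \<noteq> 0 \<or>
        (LINT x|S2. snd \<Phi> (re *\<^sub>R x) * cnj (Y n m x)) \<noteq> 0)"
      using orthonormal_spherical_harmonics_complete[OF Y L2(1)]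
        orthonormal_spherical_harmonics_complete[OF Y L2(2)] nz by blast
    then obtain n where "\<kappa>\<^sup>2 = of_real ((p n)\<^sup>2 + q n * w n)"
      using coeff_sq[OF eig] by blast
    then have "\<kappa>\<^sup>2 = (of_real (ev 1 n))\<^sup>2"
      unfolding of_real_power[symmetric] using ev2[of 1 n] by simp
    then have "\<kappa> = of_real (ev 1 n) \<or> \<kappa> = of_real (ev (-1) n)"
      by (simp add: power2_eq_iff ev_def)
    then show ?thesis by blast
  qed
  moreover have "NP_eigenvalue ri re (of_real (ev s n))" if "s \<in> {1, -1}" for s n
    unfolding NP_eigenvalue_def by (rule exI[of _ "E s n 0"]) (rule eigen[OF that], simp)
  ultimately have part1: "{\<kappa>. NP_eigenvalue ri re \<kappa>} = {complex_of_real (ev s n) | s n. s \<in> {1, -1}}"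
    by blast
  have part3: "\<exists>c :: int \<Rightarrow> complex. eq_ae ri re \<Phi>
              (\<lambda>x. \<Sum>m\<in>{- int n..int n}. c m * fst (E s n m) x,
               \<lambda>x. \<Sum>m\<in>{- int n..int n}. c m * snd (E s n m) x)"
    if s: "s \<in> {1, -1}" and eig: "NP_eigenfunction ri re (of_real (ev s n)) \<Phi>" for s n \<Phi>
  proof -
    have meas: "fst \<Phi> \<in> borel_measurable (sphere_measure ri)" "snd \<Phi> \<in> borel_measurable (sphere_measure re)"
      using eig by (auto simp: NP_eigenfunction_def L2_pairs_def mem_Times_iff L2_space_def)
    have L2: "(\<lambda>y. fst \<Phi> (ri *\<^sub>R y)) \<in> L2_space S2" "(\<lambda>y. snd \<Phi> (re *\<^sub>R y)) \<in> L2_space S2"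
      using eig unfolding NP_eigenfunction_iff[OF radii meas refl refl] by auto
    have vanish: "(LINT x|S2. fst \<Phi> (ri *\<^sub>R x) * cnj (Y l m x)) = 0"
      "(LINT x|S2. snd \<Phi> (re *\<^sub>R x) * cnj (Y l m x)) = 0" if "l \<noteq> n" "m \<in> {- int l..int l}" for l m
    proof -
      have "(complex_of_real (ev s n))\<^sup>2 \<noteq> of_real ((p l)\<^sup>2 + q l * w l)"
        using ev_inj[OF s, of l n] \<open>l \<noteq> n\<close> by (metis of_real_eq_iff of_real_power)
      then show "(LINT x|S2. fst \<Phi> (ri *\<^sub>R x) * cnj (Y l m x)) = 0"
        "(LINT x|S2. snd \<Phi> (re *\<^sub>R x) * cnj (Y l m x)) = 0"
        using coeff_sq[OF eig that(2)] by blast+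
    qed
    define \<alpha> where "\<alpha> m = (LINT x|S2. fst \<Phi> (ri *\<^sub>R x) * cnj (Y n m x))" for m
    define \<beta> where "\<beta> m = (LINT x|S2. snd \<Phi> (re *\<^sub>R x) * cnj (Y n m x))" for m
    define c where "c m = \<beta> m / of_real (B n)" for m
    have \<beta>: "\<beta> m = c m * of_real (B n)" for m
      using B_nz by (simp add: c_def)
    have \<alpha>: "\<alpha> m = c m * of_real (s * R n - 1)" if m: "m \<in> {- int n..int n}" for m
    proof -
      have "of_real (ev s n - p n) * \<beta> m = of_real (w n) * \<alpha> m"
        using coeff(2)[OF eig m] by (simp add: \<alpha>_def \<beta>_def)
      then have "of_real (1 / (2 * (2 * real n + 1))) * (of_real (s * R n - 1) * \<beta> m) =
          of_real (1 / (2 * (2 * real n + 1))) * (of_real (B n) * \<alpha> m)"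
        unfolding ev_p w_B by (simp add: field_simps)
      moreover have "complex_of_real (1 / (2 * (2 * real n + 1))) \<noteq> 0"
        unfolding of_real_eq_0_iff by simp
      ultimately have "of_real (s * R n - 1) * \<beta> m = of_real (B n) * \<alpha> m"
        using mult_left_cancel by blast
      then show ?thesis
        using B_nz by (simp add: c_def field_simps)
    qed
    have expand: "AE x in S2. fst \<Phi> (ri *\<^sub>R x) = (\<Sum>m\<in>{- int n..int n}. \<alpha> m * Y n m x)"
      "AE x in S2. snd \<Phi> (re *\<^sub>R x) = (\<Sum>m\<in>{- int n..int n}. \<beta> m * Y n m x)"
      unfolding \<alpha>_def \<beta>_def
      by (rule orthonormal_spherical_harmonics_expansion[OF Y L2(1)], erule (1) vanish(1))
         (rule orthonormal_spherical_harmonics_expansion[OF Y L2(2)], erule (1) vanish(2))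
    have "AE x in S2. fst \<Phi> (ri *\<^sub>R x) = (\<Sum>m\<in>{- int n..int n}. c m * fst (E s n m) (ri *\<^sub>R x))"
      using expand(1) AE_space
    proof eventually_elim
      case (elim x)
      then show ?case
        using radii by (simp add: \<alpha> E_def mult.assoc)
    qed
    moreover have "AE x in S2. snd \<Phi> (re *\<^sub>R x) = (\<Sum>m\<in>{- int n..int n}. c m * snd (E s n m) (re *\<^sub>R x))"
      using expand(2) AE_space
    proof eventually_elim
      case (elim x)
      then show ?case
        using re by (simp add: \<beta> E_def B_def mult.assoc)
    qed
    ultimately show ?thesis
      unfolding eq_ae_def AE_sphere_scale[OF radii(1)] AE_sphere_scale[OF re] by auto
  qed
  show ?thesis
    using part1 eigen part3 unfolding ev_def by blast
qed

end
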